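(* For the $2$-user Gaussian Z interference channel with unidirectional transmitter cooperation from transmitter $2$ to transmitter $1$ and weak secrecy constraints, in the weak/moderate interference regime $0\le\kappa\le1$, the optimal secure sum generalized degrees of freedom is $$d_{\text{sum}}(\kappa,\gamma)=\min\{2,\ 2-\kappa+\min(\gamma,1)\}.$$
   Context: Gaussian model: $y_1=h_dx_1+h_cx_2+z_1$, $y_2=h_dx_2+z_2$, real gains $h_d,h_c$, noises $\mathcal{N}(0,1)$ i.i.d., power constraints $E[|x_i|^2]\le P$; $\text{SNR}=h_d^2P$, $\text{INR}=h_c^2P$. Transmitter $i$ has message $W_i$ uniform on $\{1,\dots,2^{NR_i}\}$. Transmitter $2$ can send to transmitter $1$ over a noiseless secure link of rate $C_G$ bits per channel use; transmitter $2$'s (possibly stochastic) encoder depends only on $W_2$, transmitter $1$'s encoder may use $W_1$, cooperative-link information received causally, and local randomness. A rate pair is securely achievable if error probabilities $\to0$ and $\frac1N I(W_2;\mathbf{y}_1^N)\to0$ as $N\to\infty$. $C_{\text{sum}}(\text{SNR},\text{INR})$ denotes the supremum of $R_1+R_2$ over securely achievable pairs. With $\kappa=\lim_{\text{SNR}\to\infty}\frac{\log\text{INR}}{\log\text{SNR}}$ and $\gamma=\lim_{\text{SNR}\to\infty}\frac{C_G}{0.5\log\text{SNR}}$, the secure sum GDOF is $d_{\text{sum}}(\kappa,\gamma)=\lim_{\text{SNR}\to\infty}\frac{C_{\text{sum}}(\text{SNR},\text{INR})}{0.5\log\text{SNR}}$. *)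

theory Defs
  imports "HOL-Probability.Probability"
begin

text \<open>Gaussian Z interference channel with unidirectional transmitter cooperation
  (transmitter 2 to transmitter 1) and a weak secrecy constraint at receiver 1.

  Block length N.  Canonical probability space of a block:
    (W1, W2, U1, U2, Z1, Z2)
  with W_i uniform on {1..m_i}, U_i the local randomness of transmitter i
  (an arbitrary real random variable with law mu_i), and Z_i the i.i.d.
  N(0,1) noise vectors indexed by {..<N}; all components independent.\<close>

definition noise_vec :: "nat \<Rightarrow> (nat \<Rightarrow> real) measure" where
  "noise_vec N = PiM {..<N} (\<lambda>_. density lborel std_normal_density)"

definition block_space ::
  "nat \<Rightarrow> nat \<Rightarrow> nat \<Rightarrow> real measure \<Rightarrow> real measure \<Rightarrow>
   (nat \<times> nat \<times> real \<times> real \<times> (nat \<Rightarrow> real) \<times> (nat \<Rightarrow> real)) measure" where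
  "block_space N m1 m2 \<mu>1 \<mu>2 =
     measure_pmf (pmf_of_set {1..m1}) \<Otimes>\<^sub>M (measure_pmf (pmf_of_set {1..m2}) \<Otimes>\<^sub>M
       (\<mu>1 \<Otimes>\<^sub>M (\<mu>2 \<Otimes>\<^sub>M (noise_vec N \<Otimes>\<^sub>M noise_vec N))))"

definition out_space :: "nat \<Rightarrow> (nat \<Rightarrow> real) measure" where
  "out_space N = PiM {..<N} (\<lambda>_. borel)"

text \<open>A secure code of block length N with m1, m2 messages, per-symbol power P,
  gains h_d, h_c and cooperative-link rate CG (bits per channel use) whose
  average error probabilities are at most eps and whose information leakage
  I(W2; y1^N) (in bits) is at most lk.

  Encoders:
  \<^item> transmitter 2: channel input x2 w2 u2 t and link symbol lnk w2 u2 t < Lk t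
    (depending only on W2 and its local randomness U2);
  \<^item> transmitter 1: channel input x1 w1 u1 t ls, where ls is the sequence of link
    symbols, and x1 depends on ls only through ls 0, ..., ls t (causality);
  the link carries in total at most N*CG bits: sum_{t<N} log2 (Lk t) <= N*CG.
  Decoders g1, g2 map received vectors to message estimates.\<close>
definition secure_code ::
  "real \<Rightarrow> real \<Rightarrow> real \<Rightarrow> real \<Rightarrow> nat \<Rightarrow> nat \<Rightarrow> nat \<Rightarrow> real \<Rightarrow> real \<Rightarrow> bool" where
  "secure_code h_d h_c P CG N m1 m2 eps lk \<longleftrightarrow>
    (\<exists>(\<mu>1::real measure) (\<mu>2::real measure)
       (x1 :: nat \<Rightarrow> real \<Rightarrow> nat \<Rightarrow> (nat \<Rightarrow> nat) \<Rightarrow> real)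
       (x2 :: nat \<Rightarrow> real \<Rightarrow> nat \<Rightarrow> real)
       (lnk :: nat \<Rightarrow> real \<Rightarrow> nat \<Rightarrow> nat) (Lk :: nat \<Rightarrow> nat)
       (g1 :: (nat \<Rightarrow> real) \<Rightarrow> nat) (g2 :: (nat \<Rightarrow> real) \<Rightarrow> nat).
      let \<Omega> = block_space N m1 m2 \<mu>1 \<mu>2;
          X1 = (\<lambda>t (w1, w2, u1, u2, z1, z2). x1 w1 u1 t (\<lambda>s. lnk w2 u2 s));
          X2 = (\<lambda>t (w1, w2, u1, u2, z1, z2). x2 w2 u2 t);
          Y1 = (\<lambda>\<omega>. restrict (\<lambda>t. h_d * X1 t \<omega> + h_c * X2 t \<omega> +
                        (case \<omega> of (w1, w2, u1, u2, z1, z2) \<Rightarrow> z1 t)) {..<N});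
          Y2 = (\<lambda>\<omega>. restrict (\<lambda>t. h_d * X2 t \<omega> +
                        (case \<omega> of (w1, w2, u1, u2, z1, z2) \<Rightarrow> z2 t)) {..<N});
          W1 = (\<lambda>(w1, w2, u1, u2, z1, z2). w1);
          W2 = (\<lambda>(w1, w2, u1, u2, z1, z2). w2)
      in
        prob_space \<mu>1 \<and> sets \<mu>1 = sets borel \<and>
        prob_space \<mu>2 \<and> sets \<mu>2 = sets borel \<and>
        (\<forall>w t ls. (\<lambda>u. x1 w u t ls) \<in> borel_measurable borel) \<and>
        (\<forall>w t. (\<lambda>u. x2 w u t) \<in> borel_measurable borel) \<and>
        (\<forall>w t. (\<lambda>u. lnk w u t) \<in> measurable borel (count_space UNIV)) \<and>
        (\<forall>w u t ls ls'. (\<forall>s\<le>t. ls s = ls' s) \<longrightarrow> x1 w u t ls = x1 w u t ls') \<and>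
        (\<forall>w u t. t < N \<longrightarrow> lnk w u t < Lk t) \<and>
        (\<forall>t<N. 1 \<le> Lk t) \<and>
        (\<Sum>t<N. log 2 (Lk t)) \<le> N * CG \<and>
        g1 \<in> measurable (out_space N) (count_space UNIV) \<and>
        g2 \<in> measurable (out_space N) (count_space UNIV) \<and>
        (\<forall>t<N. integrable \<Omega> (\<lambda>\<omega>. (X1 t \<omega>)\<^sup>2) \<and>
               integral\<^sup>L \<Omega> (\<lambda>\<omega>. (X1 t \<omega>)\<^sup>2) \<le> P) \<and>
        (\<forall>t<N. integrable \<Omega> (\<lambda>\<omega>. (X2 t \<omega>)\<^sup>2) \<and>
               integral\<^sup>L \<Omega> (\<lambda>\<omega>. (X2 t \<omega>)\<^sup>2) \<le> P) \<and>
        measure \<Omega> {\<omega> \<in> space \<Omega>. g1 (Y1 \<omega>) \<noteq> W1 \<omega>} \<le> eps \<and>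
        measure \<Omega> {\<omega> \<in> space \<Omega>. g2 (Y2 \<omega>) \<noteq> W2 \<omega>} \<le> eps \<and>
        prob_space.mutual_information \<Omega> 2 (count_space UNIV) (out_space N) W2 Y1 \<le> lk)"

definition num_msgs :: "nat \<Rightarrow> real \<Rightarrow> nat" where
  "num_msgs N R = nat \<lceil>2 powr (real N * R)\<rceil>"

definition securely_achievable :: "real \<Rightarrow> real \<Rightarrow> real \<Rightarrow> real \<Rightarrow> real \<Rightarrow> real \<Rightarrow> bool" where
  "securely_achievable h_d h_c P CG R1 R2 \<longleftrightarrow>
     0 \<le> R1 \<and> 0 \<le> R2 \<and>
     (\<exists>eps lk :: nat \<Rightarrow> real.
        eps \<longlonglongrightarrow> 0 \<and> (\<lambda>N. lk N / real N) \<longlonglongrightarrow> 0 \<and>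
        (\<forall>N. secure_code h_d h_c P CG N (num_msgs N R1) (num_msgs N R2) (eps N) (lk N)))"

definition C_sum :: "real \<Rightarrow> real \<Rightarrow> real \<Rightarrow> real \<Rightarrow> real" where
  "C_sum h_d h_c P CG = Sup {R1 + R2 | R1 R2. securely_achievable h_d h_c P CG R1 R2}"

end

theory Submission
  imports Defs
begin

text \<open>Converse. The unknown output densities are removed by comparing log-likelihood ratios: each
  message rate, and the leakage, is the expectation of a logarithm of a ratio of conditional
  densities, and in the sum of these terms the densities of the true outputs cancel.  The remaining
  logarithms are bounded by \<open>log R \<le> R - 1\<close>, with Gaussian reference densities whose scale produces
  the terms \<open>log (SNR + INR)\<close>, \<open>log (1 + SNR / INR)\<close> and the link rate.

  Achievability. Both users send pulse amplitude modulation with constant spacing, so that symbol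
  errors occur only where the noise is an outlier, and a random block code corrects those.
  The symbol of user 2 splits into a fine part, received by user 1 below the noise level, and a
  coarse part, which travels over the link and is precancelled by transmitter 1.  Weak secrecy
  results from a random codebook with dummy messages, whose leakage is bounded by a chi-square
  distance.\<close>

text \<open>Working with differential entropies would require finite entropies of output mixtures
  for arbitrary codes. Here an inequality \<open>F \<le> G - k\<close> with
  \<open>E G \<le> k\<close> gives \<open>E F \<le> 0\<close>; only nonnegative ratios are
  integrated, and the one logarithm of unknown densities that must be integrable is that of the
  leakage.

  The key to the sum rate: with its own transmitter's input removed, receiver 1 sees
  \<open>h_c X2 + Z1\<close>, which scaled by \<open>h_d / h_c\<close> predicts \<open>Y2\<close> up
  to noise of variance \<open>1 + SNR / INR\<close>. That input depends on user 2 only through the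
  link word, and there are at most \<open>2 powr (N * CG)\<close> words: this count is the price of
  removing it. Because of the link the two inputs may be correlated, so all estimates hold pointwise
  in the inputs.

  In the construction the symbol spacing, the dummy rate and the bits lost in counting do not depend
  on SNR and vanish after division by \<open>log SNR\<close>. Only the fraction of outlying
  positions costs a share of \<open>log SNR\<close>; it is the same \<open>e\<close> that serves as
  tolerance in the limits, and it tends to 0 at the end.\<close>

section \<open>Gaussian densities on blocks and translated noise\<close>

definition lam :: "nat \<Rightarrow> (nat \<Rightarrow> real) measure" where
  "lam N = PiM {..<N} (\<lambda>_. lborel)"

definition nd :: "nat \<Rightarrow> (nat \<Rightarrow> real) \<Rightarrow> real \<Rightarrow> (nat \<Rightarrow> real) \<Rightarrow> real" where
  "nd N c \<sigma> y = (\<Prod>t<N. normal_density (c t) \<sigma> (y t))"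

lemma sets_lam [measurable_cong]: "sets (lam N) = sets (out_space N)"
  unfolding lam_def out_space_def by (rule sets_PiM_cong) auto

lemma space_lam: "space (lam N) = space (out_space N)"
  using sets_lam by (rule sets_eq_imp_space_eq)

lemma sets_noise_vec [measurable_cong]: "sets (noise_vec N) = sets (out_space N)"
  unfolding noise_vec_def out_space_def by (rule sets_PiM_cong) auto

lemma sigma_finite_lam: "sigma_finite_measure (lam N)"
proof -
  interpret finite_product_sigma_finite "\<lambda>_. lborel :: real measure" "{..<N}"
    by unfold_locales auto
  show ?thesis unfolding lam_def by (rule sigma_finite_measure_axioms)
qed

lemma prob_space_noise_vec: "prob_space (noise_vec N)"
  unfolding noise_vec_def
  by (intro prob_space_PiM prob_space_normal_density) auto

lemma measurable_out_space_component [measurable]: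
  "t < N \<Longrightarrow> (\<lambda>y. y t) \<in> borel_measurable (out_space N)"
  unfolding out_space_def by (rule measurable_component_singleton) auto

lemma measurable_normal_density2 [measurable]:
  assumes [measurable]: "f \<in> borel_measurable M" "g \<in> borel_measurable M"
  shows "(\<lambda>x. normal_density (f x) \<sigma> (g x)) \<in> borel_measurable M"
  unfolding normal_density_def by measurable

lemma measurable_nd [measurable (raw)]:
  assumes c: "\<And>t. t < N \<Longrightarrow> (\<lambda>x. c x t) \<in> borel_measurable M"
    and y[measurable]: "y \<in> measurable M (out_space N)"
  shows "(\<lambda>x. nd N (c x) \<sigma> (y x)) \<in> borel_measurable M"
  unfolding nd_def
proof (rule borel_measurable_prod)
  fix t assume "t \<in> {..<N}"
  then have t: "t < N" by simp
  note c[OF t, measurable]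
  have [measurable]: "(\<lambda>x. y x t) \<in> borel_measurable M"
    using measurable_compose[OF y measurable_out_space_component[OF t]] .
  show "(\<lambda>x. normal_density (c x t) \<sigma> (y x t)) \<in> borel_measurable M"
    by measurable
qed

lemma nd_pos: "0 < \<sigma> \<Longrightarrow> 0 < nd N c \<sigma> y"
  unfolding nd_def by (intro prod_pos) (auto intro: normal_density_pos)

lemma nd_nonneg [simp]: "0 \<le> nd N c \<sigma> y"
  unfolding nd_def by (intro prod_nonneg) auto

lemma normal_density_le_1:
  assumes "1 \<le> \<sigma>" shows "normal_density \<mu> \<sigma> x \<le> 1"
proof -
  have "1\<^sup>2 \<le> \<sigma>\<^sup>2" using assms by (intro power_mono) auto
  then have "1 \<le> 2 * pi * \<sigma>\<^sup>2"
    using pi_ge_two by (intro order_trans[OF _ mult_mono[of 1 "2*pi" 1 "\<sigma>\<^sup>2"]]) auto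
  then have "1 \<le> sqrt (2 * pi * \<sigma>\<^sup>2)" by simp
  moreover have "exp (- (x - \<mu>)\<^sup>2 / (2 * \<sigma>\<^sup>2)) \<le> 1" by simp
  ultimately show ?thesis unfolding normal_density_def
    by (intro mult_le_one) (auto simp: field_simps)
qed

lemma nd_le_1: "1 \<le> \<sigma> \<Longrightarrow> nd N c \<sigma> y \<le> 1"
  unfolding nd_def by (intro prod_le_1) (auto intro: normal_density_le_1)

lemma nn_integral_lam_prod:
  assumes "\<And>t. t < N \<Longrightarrow> f t \<in> borel_measurable borel"
  shows "(\<integral>\<^sup>+y. (\<Prod>t<N. f t (y t)) \<partial>lam N) = (\<Prod>t<N. \<integral>\<^sup>+x. f t x \<partial>lborel)"
proof -
  interpret product_sigma_finite "\<lambda>_. lborel :: real measure"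
    by unfold_locales
  show ?thesis unfolding lam_def using assms by (intro product_nn_integral_prod) auto
qed

lemma nn_integral_normal_density:
  "0 < \<sigma> \<Longrightarrow> (\<integral>\<^sup>+x. ennreal (normal_density \<mu> \<sigma> x) \<partial>lborel) = 1"
  by (subst nn_integral_eq_integral) auto

lemma nn_integral_nd:
  assumes "0 < \<sigma>" shows "(\<integral>\<^sup>+y. ennreal (nd N c \<sigma> y) \<partial>lam N) = 1"
proof -
  have "(\<integral>\<^sup>+y. ennreal (nd N c \<sigma> y) \<partial>lam N)
      = (\<integral>\<^sup>+y. (\<Prod>t<N. ennreal (normal_density (c t) \<sigma> (y t))) \<partial>lam N)"
    unfolding nd_def by (simp add: prod_ennreal)
  also have "\<dots> = (\<Prod>t<N. \<integral>\<^sup>+x. ennreal (normal_density (c t) \<sigma> x) \<partial>lborel)"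
    by (rule nn_integral_lam_prod) auto
  finally show ?thesis using assms by (simp add: nn_integral_normal_density)
qed

definition shift :: "nat \<Rightarrow> (nat \<Rightarrow> real) \<Rightarrow> (nat \<Rightarrow> real) \<Rightarrow> nat \<Rightarrow> real" where
  "shift N c z = restrict (\<lambda>t. c t + z t) {..<N}"

lemma measurable_shift [measurable (raw)]:
  assumes c: "\<And>t. t < N \<Longrightarrow> (\<lambda>x. c x t) \<in> borel_measurable M"
    and z: "z \<in> measurable M (out_space N)"
  shows "(\<lambda>x. shift N (c x) (z x)) \<in> measurable M (out_space N)"
  unfolding shift_def out_space_def
proof (rule measurable_restrict)
  fix t assume "t \<in> {..<N}"
  then have t: "t < N" by simp
  note c[OF t, measurable]
  have [measurable]: "(\<lambda>x. z x t) \<in> borel_measurable M"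
    using measurable_compose[OF z measurable_out_space_component[OF t]] .
  show "(\<lambda>x. c x t + z x t) \<in> borel_measurable M" by measurable
qed

lemma nn_integral_noise_prod:
  assumes "\<And>t. t < N \<Longrightarrow> f t \<in> borel_measurable borel"
  shows "(\<integral>\<^sup>+z. (\<Prod>t<N. f t (z t)) \<partial>noise_vec N)
     = (\<Prod>t<N. \<integral>\<^sup>+x. ennreal (std_normal_density x) * f t x \<partial>lborel)"
proof -
  interpret N: prob_space "density lborel (\<lambda>x. ennreal (std_normal_density x))"
    by (rule prob_space_normal_density) simp
  interpret product_sigma_finite "\<lambda>_. density lborel (\<lambda>x. ennreal (std_normal_density x))"
    by unfold_locales
  have "(\<integral>\<^sup>+z. (\<Prod>t<N. f t (z t)) \<partial>noise_vec N)
    = (\<Prod>t<N. \<integral>\<^sup>+x. f t x \<partial>density lborel (\<lambda>x. ennreal (std_normal_density x)))"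
    unfolding noise_vec_def using assms by (intro product_nn_integral_prod) auto
  also have "\<dots> = (\<Prod>t<N. \<integral>\<^sup>+x. ennreal (std_normal_density x) * f t x \<partial>lborel)"
    using assms by (intro prod.cong nn_integral_density) auto
  finally show ?thesis .
qed

text \<open>Both measures are identified with the product of the one-dimensional Gaussians centred
  at \<open>c t\<close>: a product measure is determined by its values on boxes, where the indicator
  splits over the coordinates.\<close>

lemma distr_shift_noise:
  "distr (noise_vec N) (out_space N) (shift N c) = density (lam N) (\<lambda>y. ennreal (nd N c 1 y))"
proof -
  let ?D = "\<lambda>t. density lborel (\<lambda>x. ennreal (normal_density (c t) 1 x))"
  have pD: "prob_space (?D t)" for t by (rule prob_space_normal_density) simp
  interpret D: product_prob_space ?D by (rule product_prob_spaceI) (rule pD)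
  have set_eq: "sets (PiM {..<N} ?D) = sets (out_space N)"
    unfolding out_space_def by (rule sets_PiM_cong) auto
  \<comment> \<open>The product inspects only coordinates below \<open>N\<close>, whereas
    \<open>Pi\<^sub>E\<close> also prescribes the values elsewhere; hence the restriction to
    extensional \<open>y\<close>.\<close>
  have box: "(\<Prod>t<N. indicator (A t) (y t) :: ennreal) = indicator (Pi\<^sub>E {..<N} A) y"
    if ext: "y \<in> extensional {..<N}" for A and y :: "nat \<Rightarrow> real"
  proof (cases "y \<in> Pi\<^sub>E {..<N} A")
    case True then show ?thesis by (auto simp: indicator_def PiE_iff)
  next
    case False
    then obtain t where "t < N" "y t \<notin> A t" using ext by (auto simp: PiE_iff)
    then have "(\<Prod>t<N. indicator (A t) (y t) :: ennreal) = 0"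
      by (intro prod_zero) (auto simp: indicator_def intro!: bexI[of _ t])
    then show ?thesis using False by (simp add: indicator_def)
  qed
  have "distr (noise_vec N) (out_space N) (shift N c) = PiM {..<N} ?D"
  proof (rule D.PiM_eqI)
    show "sets (distr (noise_vec N) (out_space N) (shift N c)) = sets (PiM {..<N} ?D)"
      using set_eq by simp
    fix A assume A: "\<And>i. i \<in> {..<N} \<Longrightarrow> A i \<in> sets (?D i)"
    have [measurable]: "Pi\<^sub>E {..<N} A \<in> sets (out_space N)"
      unfolding out_space_def using A by (intro sets_PiM_I_finite) auto
    have Ab: "A t \<in> sets borel" if "t < N" for t using A[of t] that by simp
    have [measurable]: "shift N c \<in> measurable (noise_vec N) (out_space N)"
      by measurable
    have "emeasure (distr (noise_vec N) (out_space N) (shift N c)) (Pi\<^sub>E {..<N} A)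
       = (\<integral>\<^sup>+y. indicator (Pi\<^sub>E {..<N} A) y \<partial>distr (noise_vec N) (out_space N) (shift N c))"
      by (rule nn_integral_indicator[symmetric]) auto
    also have "\<dots> = (\<integral>\<^sup>+z. indicator (Pi\<^sub>E {..<N} A) (shift N c z) \<partial>noise_vec N)"
      by (rule nn_integral_distr) auto
    also have "\<dots> = (\<integral>\<^sup>+z. (\<Prod>t<N. indicator (A t) (c t + z t)) \<partial>noise_vec N)"
    proof (intro nn_integral_cong)
      fix z :: "nat \<Rightarrow> real"
      have "(\<Prod>t<N. indicator (A t) (shift N c z t) :: ennreal) = indicator (Pi\<^sub>E {..<N} A) (shift N c z)"
        by (rule box) (simp add: shift_def extensional_def)
      then show "indicator (Pi\<^sub>E {..<N} A) (shift N c z) = (\<Prod>t<N. indicator (A t) (c t + z t) :: ennreal)"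
        by (simp add: shift_def)
    qed
    also have "\<dots> = (\<Prod>t<N. \<integral>\<^sup>+x. ennreal (std_normal_density x) * indicator (A t) (c t + x) \<partial>lborel)"
    proof (rule nn_integral_noise_prod)
      fix t assume "t < N"
      note Ab[OF this, measurable]
      show "(\<lambda>z. indicator (A t) (c t + z) :: ennreal) \<in> borel_measurable borel" by measurable
    qed
    also have "\<dots> = (\<Prod>t<N. emeasure (?D t) (A t))"
    proof (intro prod.cong refl)
      fix t assume "t \<in> {..<N}"
      then have [measurable]: "A t \<in> sets borel" using Ab by simp
      have "emeasure (?D t) (A t) = (\<integral>\<^sup>+x. ennreal (normal_density (c t) 1 x) * indicator (A t) x \<partial>lborel)"
        by (simp add: emeasure_density)
      \<comment> \<open>Translation invariance of Lebesgue measure moves the shift from the event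
        into the density.\<close>
      also have "\<dots> = (\<integral>\<^sup>+x. ennreal (normal_density (c t) 1 x) * indicator (A t) x
              \<partial>distr lborel borel ((+) (c t)))"
        by (simp add: lborel_distr_plus)
      also have "\<dots> = (\<integral>\<^sup>+x. ennreal (normal_density (c t) 1 (c t + x)) * indicator (A t) (c t + x) \<partial>lborel)"
        by (subst nn_integral_distr) auto
      finally show "(\<integral>\<^sup>+x. ennreal (std_normal_density x) * indicator (A t) (c t + x) \<partial>lborel)
          = emeasure (?D t) (A t)"
        by (simp add: normal_density_def)
    qed
    finally show "emeasure (distr (noise_vec N) (out_space N) (shift N c)) (Pi\<^sub>E {..<N} A)
        = (\<Prod>i<N. emeasure (?D i) (A i))" .
  qed simp
  moreover have "density (lam N) (\<lambda>y. ennreal (nd N c 1 y)) = PiM {..<N} ?D"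
  proof (rule D.PiM_eqI)
    show "sets (density (lam N) (\<lambda>y. ennreal (nd N c 1 y))) = sets (PiM {..<N} ?D)"
      using set_eq by (simp add: sets_lam)
    fix A assume A: "\<And>i. i \<in> {..<N} \<Longrightarrow> A i \<in> sets (?D i)"
    have [measurable]: "Pi\<^sub>E {..<N} A \<in> sets (out_space N)"
      unfolding out_space_def using A by (intro sets_PiM_I_finite) auto
    have "emeasure (density (lam N) (\<lambda>y. ennreal (nd N c 1 y))) (Pi\<^sub>E {..<N} A)
      = (\<integral>\<^sup>+y. ennreal (nd N c 1 y) * indicator (Pi\<^sub>E {..<N} A) y \<partial>lam N)"
      by (rule emeasure_density) (auto simp: sets_lam)
    also have "\<dots> = (\<integral>\<^sup>+y. (\<Prod>t<N. ennreal (normal_density (c t) 1 (y t)) * indicator (A t) (y t)) \<partial>lam N)"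
    proof (intro nn_integral_cong)
      fix y assume "y \<in> space (lam N)"
      then have "y \<in> extensional {..<N}" by (auto simp: space_lam out_space_def space_PiM PiE_def)
      from box[OF this, symmetric]
      show "ennreal (nd N c 1 y) * indicator (Pi\<^sub>E {..<N} A) y
         = (\<Prod>t<N. ennreal (normal_density (c t) 1 (y t)) * indicator (A t) (y t))"
        by (simp add: nd_def prod.distrib prod_ennreal)
    qed
    also have "\<dots> = (\<Prod>t<N. \<integral>\<^sup>+x. ennreal (normal_density (c t) 1 x) * indicator (A t) x \<partial>lborel)"
    proof (rule nn_integral_lam_prod)
      fix t assume "t < N"
      then have [measurable]: "A t \<in> sets borel" using A[of t] by simp
      show "(\<lambda>x. ennreal (normal_density (c t) 1 x) * indicator (A t) x) \<in> borel_measurable borel" by measurable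
    qed
    also have "\<dots> = (\<Prod>t<N. emeasure (?D t) (A t))"
      using A by (intro prod.cong refl) (auto simp: emeasure_density)
    finally show "emeasure (density (lam N) (\<lambda>y. ennreal (nd N c 1 y))) (Pi\<^sub>E {..<N} A)
        = (\<Prod>i<N. emeasure (?D i) (A i))" .
  qed simp
  ultimately show ?thesis by simp
qed

text \<open>The bridge used in all later computations: an expectation over the noise becomes an
  integral against the conditional density of the received block, where ratios of densities can be
  cancelled.\<close>

lemma nn_integral_shift_noise:
  assumes [measurable]: "H \<in> borel_measurable (out_space N)"
  shows "(\<integral>\<^sup>+z. H (shift N c z) \<partial>noise_vec N) = (\<integral>\<^sup>+y. ennreal (nd N c 1 y) * H y \<partial>lam N)"
proof -
  have [measurable]: "shift N c \<in> measurable (noise_vec N) (out_space N)" by measurable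
  have "(\<integral>\<^sup>+z. H (shift N c z) \<partial>noise_vec N)
     = (\<integral>\<^sup>+y. H y \<partial>distr (noise_vec N) (out_space N) (shift N c))"
    by (subst nn_integral_distr) auto
  also have "\<dots> = (\<integral>\<^sup>+y. ennreal (nd N c 1 y) * H y \<partial>lam N)"
    unfolding distr_shift_noise by (subst nn_integral_density) auto
  finally show ?thesis .
qed

text \<open>The density of a Gaussian block with random mean. For \<open>1 \<le> \<sigma>\<close>
  Gaussian densities are at most 1, so the inner integral over a probability space is finite at
  every point and \<open>enn2real\<close> loses nothing.\<close>

definition mixd :: "'b measure \<Rightarrow> nat \<Rightarrow> real \<Rightarrow> ('b \<Rightarrow> nat \<Rightarrow> real) \<Rightarrow> (nat \<Rightarrow> real) \<Rightarrow> real" where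
  "mixd B N \<sigma> m y = enn2real (\<integral>\<^sup>+b. ennreal (nd N (m b) \<sigma> y) \<partial>B)"

context
  fixes B :: "'b measure" and N :: nat and \<sigma> :: real and m :: "'b \<Rightarrow> nat \<Rightarrow> real"
  assumes B: "prob_space B" and \<sigma>: "1 \<le> \<sigma>"
    and m[measurable]: "\<And>t. t < N \<Longrightarrow> (\<lambda>b. m b t) \<in> borel_measurable B"
begin

interpretation B: prob_space B by (rule B)

lemma mixd_nn_le_1:
  assumes "y \<in> space (out_space N)"
  shows "(\<integral>\<^sup>+b. ennreal (nd N (m b) \<sigma> y) \<partial>B) \<le> 1"
proof -
  have "(\<integral>\<^sup>+b. ennreal (nd N (m b) \<sigma> y) \<partial>B) \<le> (\<integral>\<^sup>+b. 1 \<partial>B)"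
    by (intro nn_integral_mono) (simp add: nd_le_1 \<sigma>)
  then show ?thesis by (simp add: B.emeasure_space_1)
qed

lemma ennreal_mixd:
  assumes "y \<in> space (out_space N)"
  shows "ennreal (mixd B N \<sigma> m y) = (\<integral>\<^sup>+b. ennreal (nd N (m b) \<sigma> y) \<partial>B)"
  unfolding mixd_def using mixd_nn_le_1[OF assms]
  by (intro ennreal_enn2real) (auto simp: less_top[symmetric] top_unique)

text \<open>An average of strictly positive numbers. Positivity at every point, not just almost
  everywhere, lets later ratios divide by output densities without exceptional null sets.\<close>

lemma mixd_pos:
  assumes y[measurable]: "y \<in> space (out_space N)" shows "0 < mixd B N \<sigma> m y"
proof -
  have "(\<integral>\<^sup>+b. ennreal (nd N (m b) \<sigma> y) \<partial>B) \<noteq> 0"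
  proof
    assume "(\<integral>\<^sup>+b. ennreal (nd N (m b) \<sigma> y) \<partial>B) = 0"
    then have "AE b in B. ennreal (nd N (m b) \<sigma> y) = 0"
      by (subst (asm) nn_integral_0_iff_AE) auto
    then have "AE b in B. False"
      by (rule AE_mp) (auto intro!: AE_I2 simp: ennreal_eq_0_iff not_le nd_pos[OF less_le_trans[OF zero_less_one \<sigma>]])
    then show False by simp
  qed
  then show ?thesis
    using ennreal_mixd[OF assms] by (metis ennreal_eq_0_iff not_le)
qed

lemma measurable_mixd [measurable]: "mixd B N \<sigma> m \<in> borel_measurable (out_space N)"
  unfolding mixd_def by measurable

lemma nn_integral_mixd:
  assumes H[measurable]: "H \<in> borel_measurable (out_space N)"
  shows "(\<integral>\<^sup>+y. H y * ennreal (mixd B N \<sigma> m y) \<partial>lam N)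
       = (\<integral>\<^sup>+b. (\<integral>\<^sup>+y. H y * ennreal (nd N (m b) \<sigma> y) \<partial>lam N) \<partial>B)"
proof -
  interpret L: sigma_finite_measure "lam N" by (rule sigma_finite_lam)
  interpret P: pair_sigma_finite B "lam N" ..
  have "(\<integral>\<^sup>+y. H y * ennreal (mixd B N \<sigma> m y) \<partial>lam N)
      = (\<integral>\<^sup>+y. (\<integral>\<^sup>+b. H y * ennreal (nd N (m b) \<sigma> y) \<partial>B) \<partial>lam N)"
    by (intro nn_integral_cong, subst ennreal_mixd) (auto simp: space_lam nn_integral_cmult)
  also have "\<dots> = (\<integral>\<^sup>+b. (\<integral>\<^sup>+y. H y * ennreal (nd N (m b) \<sigma> y) \<partial>lam N) \<partial>B)"
    by (rule P.Fubini') measurable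
  finally show ?thesis .
qed

lemma nn_integral_mixd_1: "(\<integral>\<^sup>+y. ennreal (mixd B N \<sigma> m y) \<partial>lam N) = 1"
  using nn_integral_mixd[of "\<lambda>_. 1"] \<sigma> by (simp add: nn_integral_nd B.emeasure_space_1)

end

section \<open>The probability space of a cooperative code\<close>

text \<open>Power, error, leakage and rate constraints are left out, so that one density calculus
  serves both the arbitrary code of the converse and the constructed code.\<close>

locale cooperative_code =
  fixes h_d h_c :: real and N m1 m2 :: nat and \<mu>1 \<mu>2 :: "real measure"
    and x1 :: "nat \<Rightarrow> real \<Rightarrow> nat \<Rightarrow> (nat \<Rightarrow> nat) \<Rightarrow> real"
    and x2 :: "nat \<Rightarrow> real \<Rightarrow> nat \<Rightarrow> real"
    and lnk :: "nat \<Rightarrow> real \<Rightarrow> nat \<Rightarrow> nat"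
  assumes m1_pos: "1 \<le> m1" and m2_pos: "1 \<le> m2"
    and prob_\<mu>1: "prob_space \<mu>1" and sets_\<mu>1 [measurable_cong]: "sets \<mu>1 = sets borel"
    and prob_\<mu>2: "prob_space \<mu>2" and sets_\<mu>2 [measurable_cong]: "sets \<mu>2 = sets borel"
    and x1_meas: "\<And>w t ls. (\<lambda>u. x1 w u t ls) \<in> borel_measurable borel"
    and x2_meas: "\<And>w t. (\<lambda>u. x2 w u t) \<in> borel_measurable borel"
    and lnk_meas: "\<And>w t. (\<lambda>u. lnk w u t) \<in> measurable borel (count_space UNIV)"
    and causal: "\<And>w u t ls ls'. (\<And>s. s \<le> t \<Longrightarrow> ls s = ls' s) \<Longrightarrow> x1 w u t ls = x1 w u t ls'"
begin

abbreviation "p1 \<equiv> measure_pmf (pmf_of_set {1..m1})"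
abbreviation "p2 \<equiv> measure_pmf (pmf_of_set {1..m2})"
abbreviation "noise \<equiv> noise_vec N"
abbreviation "OUT \<equiv> out_space N"

definition "Om = block_space N m1 m2 \<mu>1 \<mu>2"
definition "A1 = p1 \<Otimes>\<^sub>M \<mu>1"
definition "A2 = p2 \<Otimes>\<^sub>M \<mu>2"

sublocale MU1: prob_space \<mu>1 by (rule prob_\<mu>1)
sublocale MU2: prob_space \<mu>2 by (rule prob_\<mu>2)
sublocale NO: prob_space "noise_vec N" by (rule prob_space_noise_vec)
sublocale LA: sigma_finite_measure "lam N" by (rule sigma_finite_lam)

lemma prob_A1: "prob_space A1"
proof -
  interpret pair_prob_space p1 \<mu>1 ..
  show ?thesis unfolding A1_def by (rule prob_space_axioms)
qed

lemma prob_A2: "prob_space A2"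
proof -
  interpret pair_prob_space p2 \<mu>2 ..
  show ?thesis unfolding A2_def by (rule prob_space_axioms)
qed

lemma prob_Om: "prob_space Om"
proof -
  have pp: "prob_space (M \<Otimes>\<^sub>M M')" if "prob_space M" "prob_space M'"
    for M :: "'x measure" and M' :: "'y measure"
  proof -
    interpret M: prob_space M by fact
    interpret M': prob_space M' by fact
    interpret pair_prob_space M M' ..
    show ?thesis by (rule prob_space_axioms)
  qed
  show ?thesis unfolding Om_def block_space_def
    by (intro pp measure_pmf.prob_space_axioms prob_\<mu>1 prob_\<mu>2 prob_space_noise_vec)
qed

sublocale A1: prob_space A1 by (rule prob_A1)
sublocale A2: prob_space A2 by (rule prob_A2)
sublocale Om: prob_space Om by (rule prob_Om)

fun ia :: "nat \<times> nat \<times> real \<times> real \<times> (nat \<Rightarrow> real) \<times> (nat \<Rightarrow> real) \<Rightarrow> nat \<times> real" where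
  "ia (w1, w2, u1, u2, z1, z2) = (w1, u1)"
fun ib :: "nat \<times> nat \<times> real \<times> real \<times> (nat \<Rightarrow> real) \<times> (nat \<Rightarrow> real) \<Rightarrow> nat \<times> real" where
  "ib (w1, w2, u1, u2, z1, z2) = (w2, u2)"
fun iz1 :: "nat \<times> nat \<times> real \<times> real \<times> (nat \<Rightarrow> real) \<times> (nat \<Rightarrow> real) \<Rightarrow> nat \<Rightarrow> real" where
  "iz1 (w1, w2, u1, u2, z1, z2) = z1"
fun iz2 :: "nat \<times> nat \<times> real \<times> real \<times> (nat \<Rightarrow> real) \<times> (nat \<Rightarrow> real) \<Rightarrow> nat \<Rightarrow> real" where
  "iz2 (w1, w2, u1, u2, z1, z2) = z2"

lemma inputs_as_projections:
  "ia = (\<lambda>\<omega>. (fst \<omega>, fst (snd (snd \<omega>))))"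
  "ib = (\<lambda>\<omega>. (fst (snd \<omega>), fst (snd (snd (snd \<omega>)))))"
  "iz1 = (\<lambda>\<omega>. fst (snd (snd (snd (snd \<omega>)))))"
  "iz2 = (\<lambda>\<omega>. snd (snd (snd (snd (snd \<omega>)))))"
  by (auto simp: fun_eq_iff)

lemma measurable_inputs [measurable]:
  "ia \<in> measurable Om A1" "ib \<in> measurable Om A2"
  "iz1 \<in> measurable Om OUT" "iz2 \<in> measurable Om OUT"
  unfolding inputs_as_projections Om_def block_space_def A1_def A2_def
  by measurable

text \<open>\<open>block_space\<close> lists both messages before both local random variables.
  Exchanging \<open>p2\<close> and \<open>\<mu>1\<close> regroups the integral by transmitter; for
  fixed \<open>a\<close> and \<open>b\<close> only the noise is then random.\<close>

lemma nn_integral_Om: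
  assumes G: "G \<in> borel_measurable Om"
  shows "(\<integral>\<^sup>+\<omega>. G \<omega> \<partial>Om) = (\<integral>\<^sup>+a. \<integral>\<^sup>+b. \<integral>\<^sup>+z1. \<integral>\<^sup>+z2.
     G (fst a, fst b, snd a, snd b, z1, z2) \<partial>noise \<partial>noise \<partial>A2 \<partial>A1)"
proof -
  have [measurable]: "G \<in> borel_measurable (p1 \<Otimes>\<^sub>M (p2 \<Otimes>\<^sub>M (\<mu>1 \<Otimes>\<^sub>M (\<mu>2 \<Otimes>\<^sub>M (noise \<Otimes>\<^sub>M noise)))))"
    using G unfolding Om_def block_space_def .
  have [measurable]: "fst \<in> measurable A1 p1" "snd \<in> measurable A1 \<mu>1"
    "fst \<in> measurable A2 p2" "snd \<in> measurable A2 \<mu>2"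
    unfolding A1_def A2_def by (rule measurable_fst measurable_snd)+
  have F: "(\<lambda>a. \<integral>\<^sup>+b. \<integral>\<^sup>+z1. \<integral>\<^sup>+z2.
     G (fst a, fst b, snd a, snd b, z1, z2) \<partial>noise \<partial>noise \<partial>A2) \<in> borel_measurable A1"
    by measurable
  interpret Z: pair_prob_space noise noise ..
  interpret Q2: pair_prob_space \<mu>2 "noise \<Otimes>\<^sub>M noise" ..
  interpret Q1: pair_prob_space \<mu>1 "\<mu>2 \<Otimes>\<^sub>M (noise \<Otimes>\<^sub>M noise)" ..
  interpret Q0: pair_prob_space p2 "\<mu>1 \<Otimes>\<^sub>M (\<mu>2 \<Otimes>\<^sub>M (noise \<Otimes>\<^sub>M noise))" ..
  interpret S: pair_sigma_finite p2 \<mu>1 ..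
  have "(\<integral>\<^sup>+\<omega>. G \<omega> \<partial>Om) = (\<integral>\<^sup>+w1. \<integral>\<^sup>+w2. \<integral>\<^sup>+u1. \<integral>\<^sup>+u2. \<integral>\<^sup>+z1. \<integral>\<^sup>+z2.
     G (w1, w2, u1, u2, z1, z2) \<partial>noise \<partial>noise \<partial>\<mu>2 \<partial>\<mu>1 \<partial>p2 \<partial>p1)"
    unfolding Om_def block_space_def
    apply (subst Q0.nn_integral_fst[symmetric], measurable)
    apply (intro nn_integral_cong)
    apply (subst Q1.nn_integral_fst[symmetric], measurable)
    apply (intro nn_integral_cong)
    apply (subst Q2.nn_integral_fst[symmetric], measurable)
    apply (intro nn_integral_cong)
    apply (subst Z.nn_integral_fst[symmetric], measurable)
    apply (intro nn_integral_cong)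
    apply (subst NO.nn_integral_fst[symmetric], measurable)
    done
  also have "\<dots> = (\<integral>\<^sup>+w1. \<integral>\<^sup>+u1. \<integral>\<^sup>+w2. \<integral>\<^sup>+u2. \<integral>\<^sup>+z1. \<integral>\<^sup>+z2.
     G (w1, w2, u1, u2, z1, z2) \<partial>noise \<partial>noise \<partial>\<mu>2 \<partial>p2 \<partial>\<mu>1 \<partial>p1)"
    by (intro nn_integral_cong S.Fubini'[symmetric]) measurable
  also have "\<dots> = (\<integral>\<^sup>+w1. \<integral>\<^sup>+u1. \<integral>\<^sup>+b. \<integral>\<^sup>+z1. \<integral>\<^sup>+z2.
     G (w1, fst b, u1, snd b, z1, z2) \<partial>noise \<partial>noise \<partial>A2 \<partial>\<mu>1 \<partial>p1)"
    unfolding A2_def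
    apply (intro nn_integral_cong)
    apply (subst MU2.nn_integral_fst[symmetric], measurable)
    done
  also have "\<dots> = (\<integral>\<^sup>+a. \<integral>\<^sup>+b. \<integral>\<^sup>+z1. \<integral>\<^sup>+z2.
     G (fst a, fst b, snd a, snd b, z1, z2) \<partial>noise \<partial>noise \<partial>A2 \<partial>A1)"
    using MU1.nn_integral_fst[OF F[unfolded A1_def]] by (simp add: A1_def)
  finally show ?thesis .
qed

definition e1 :: "nat \<times> real \<Rightarrow> nat \<times> real \<Rightarrow> nat \<Rightarrow> real" where
  "e1 a b t = h_d * x1 (fst a) (snd a) t (\<lambda>s. lnk (fst b) (snd b) s) + h_c * x2 (fst b) (snd b) t"

definition e2 :: "nat \<times> real \<Rightarrow> nat \<Rightarrow> real" where
  "e2 b t = h_d * x2 (fst b) (snd b) t"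

text \<open>The interference alone: the mean at receiver 1 once the contribution of its own
  transmitter has been subtracted.\<close>

definition es :: "nat \<times> real \<Rightarrow> nat \<Rightarrow> real" where
  "es b t = h_c * x2 (fst b) (snd b) t"

text \<open>Messages range over a countable set, so measurability in the local randomness for each
  fixed message suffices; this is all that \<open>secure_code\<close> provides.\<close>

lemma measurable_pmf_pair:
  fixes f :: "'i::countable \<Rightarrow> 'u \<Rightarrow> 'k"
  assumes "\<And>w. (\<lambda>u. f w u) \<in> measurable M K"
  shows "(\<lambda>b. f (fst b) (snd b)) \<in> measurable (measure_pmf q \<Otimes>\<^sub>M M) K"
proof -
  have "(\<lambda>b. f (fst b) (snd b)) \<in> measurable (count_space UNIV \<Otimes>\<^sub>M M) K"
    by (rule measurable_pair_measure_countable1) (use assms in auto)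
  then show ?thesis
    by (subst measurable_cong_sets[OF sets_pair_measure_cong[OF sets_measure_pmf_count_space refl] refl])
qed

lemma x2_A2 [measurable]: "(\<lambda>b. x2 (fst b) (snd b) t) \<in> borel_measurable A2"
  unfolding A2_def by (rule measurable_pmf_pair, subst measurable_cong_sets[OF sets_\<mu>2 refl]) (rule x2_meas)

lemma lnk_A2 [measurable]: "(\<lambda>b. lnk (fst b) (snd b) t) \<in> measurable A2 (count_space UNIV)"
  unfolding A2_def by (rule measurable_pmf_pair, subst measurable_cong_sets[OF sets_\<mu>2 refl]) (rule lnk_meas)

lemma x1_A1 [measurable]: "(\<lambda>a. x1 (fst a) (snd a) t ls) \<in> borel_measurable A1"
  unfolding A1_def by (rule measurable_pmf_pair, subst measurable_cong_sets[OF sets_\<mu>1 refl]) (rule x1_meas)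

lemma x1_A12 [measurable]:
  "(\<lambda>(a, b). x1 (fst a) (snd a) t (\<lambda>s. lnk (fst b) (snd b) s)) \<in> borel_measurable (A1 \<Otimes>\<^sub>M A2)"
proof -
  \<comment> \<open>The link symbols are substituted one at a time: each of them takes countably many values.\<close>
  have *: "(\<lambda>ab. x1 (fst (fst ab)) (snd (fst ab)) t
      (\<lambda>s. if s < k then lnk (fst (snd ab)) (snd (snd ab)) s else ls s)) \<in> borel_measurable (A1 \<Otimes>\<^sub>M A2)"
    for k ls
  proof (induction k arbitrary: ls)
    case 0
    show ?case by simp
  next
    case (Suc k)
    let ?F = "\<lambda>i ab. x1 (fst (fst ab)) (snd (fst ab)) t
      (\<lambda>s. if s < k then lnk (fst (snd ab)) (snd (snd ab)) s else (ls(k := i)) s)"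
    have "(\<lambda>ab. ?F (lnk (fst (snd ab)) (snd (snd ab)) k) ab) \<in> borel_measurable (A1 \<Otimes>\<^sub>M A2)"
      by (rule measurable_compose_countable[OF Suc]) measurable
    moreover have "(\<lambda>s. if s < k then l s else (ls(k := l k)) s) = (\<lambda>s. if s < Suc k then l s else ls s)"
      for l by (auto simp: fun_eq_iff less_Suc_eq)
    ultimately show ?case by simp
  qed
  \<comment> \<open>Causality: at time \<open>t\<close> only the link symbols up to \<open>t\<close>
    matter, so finitely many substitutions reach the full link sequence.\<close>
  have "(\<lambda>(a, b). x1 (fst a) (snd a) t (\<lambda>s. lnk (fst b) (snd b) s))
     = (\<lambda>ab. x1 (fst (fst ab)) (snd (fst ab)) t
      (\<lambda>s. if s < Suc t then lnk (fst (snd ab)) (snd (snd ab)) s else 0))"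
    by (auto simp: fun_eq_iff intro!: causal)
  with *[of "Suc t" "\<lambda>_. 0"] show ?thesis by simp
qed

lemma x1_meas2 [measurable (raw)]:
  assumes [measurable]: "f \<in> measurable M A1" "g \<in> measurable M A2"
  shows "(\<lambda>x. x1 (fst (f x)) (snd (f x)) t (\<lambda>s. lnk (fst (g x)) (snd (g x)) s)) \<in> borel_measurable M"
proof -
  have "(\<lambda>x. (\<lambda>(a, b). x1 (fst a) (snd a) t (\<lambda>s. lnk (fst b) (snd b) s)) (f x, g x)) \<in> borel_measurable M"
    by measurable
  then show ?thesis by simp
qed

lemma measurable_e1 [measurable (raw)]:
  assumes [measurable]: "f \<in> measurable M A1" "g \<in> measurable M A2"
  shows "(\<lambda>x. e1 (f x) (g x) t) \<in> borel_measurable M"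
  unfolding e1_def by measurable

lemma measurable_e2 [measurable (raw)]:
  assumes [measurable]: "g \<in> measurable M A2"
  shows "(\<lambda>x. e2 (g x) t) \<in> borel_measurable M"
  unfolding e2_def by measurable

lemma measurable_es [measurable (raw)]:
  assumes [measurable]: "g \<in> measurable M A2"
  shows "(\<lambda>x. es (g x) t) \<in> borel_measurable M"
  unfolding es_def by measurable

definition "Y1 \<omega> = shift N (e1 (ia \<omega>) (ib \<omega>)) (iz1 \<omega>)"
definition "Y2 \<omega> = shift N (e2 (ib \<omega>)) (iz2 \<omega>)"

lemma measurable_Y [measurable]: "Y1 \<in> measurable Om OUT" "Y2 \<in> measurable Om OUT"
  unfolding Y1_def[abs_def] Y2_def[abs_def] by measurable

end

lemma distributedI_nn_integral:
  assumes X[measurable]: "X \<in> measurable M S" and f[measurable]: "f \<in> borel_measurable S"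
    and eq: "\<And>H. H \<in> borel_measurable S \<Longrightarrow> (\<integral>\<^sup>+\<omega>. H (X \<omega>) \<partial>M) = (\<integral>\<^sup>+y. f y * H y \<partial>S)"
  shows "distributed M S X f"
  unfolding distributed_def
proof (intro conjI X f measure_eqI)
  fix A assume "A \<in> sets (distr M S X)"
  then have [measurable]: "A \<in> sets S" by simp
  have "emeasure (distr M S X) A = (\<integral>\<^sup>+y. indicator A y \<partial>distr M S X)"
    by (rule nn_integral_indicator[symmetric]) simp
  also have "\<dots> = (\<integral>\<^sup>+\<omega>. indicator A (X \<omega>) \<partial>M)" by (rule nn_integral_distr) auto
  also have "\<dots> = (\<integral>\<^sup>+y. f y * indicator A y \<partial>S)" by (rule eq) simp
  also have "\<dots> = emeasure (density S f) A" by (simp add: emeasure_density)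
  finally show "emeasure (distr M S X) A = emeasure (density S f) A" .
qed simp

lemma nn_integral_bound_real:
  fixes f :: "'a \<Rightarrow> real"
  assumes "f \<in> borel_measurable M" "\<And>x. x \<in> space M \<Longrightarrow> 0 \<le> f x"
    and "(\<integral>\<^sup>+x. ennreal (f x) \<partial>M) \<le> ennreal c" "0 \<le> c"
  shows "integrable M f" "integral\<^sup>L M f \<le> c"
proof -
  show int: "integrable M f"
    using assms by (intro integrableI_nonneg) (auto intro: AE_I2 le_less_trans)
  have "ennreal (integral\<^sup>L M f) = (\<integral>\<^sup>+x. ennreal (f x) \<partial>M)"
    using assms int by (intro nn_integral_eq_integral[symmetric]) (auto intro: AE_I2)
  then show "integral\<^sup>L M f \<le> c" using assms by (simp flip: ennreal_le_iff)
qed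

section \<open>The output density at receiver 1 and the leakage\<close>

context cooperative_code
begin

text \<open>The conditional density of \<open>Y1\<close> given \<open>W2 = w\<close>: the Gaussian
  density averaged over the local randomness of transmitter 2 and over everything at transmitter 1.
  Since \<open>W2\<close> is uniform, \<open>pbar\<close> below is the density of
  \<open>Y1\<close>.\<close>

definition pd :: "nat \<Rightarrow> (nat \<Rightarrow> real) \<Rightarrow> real" where
  "pd w = mixd (\<mu>2 \<Otimes>\<^sub>M A1) N 1 (\<lambda>ua. e1 (snd ua) (w, fst ua))"

definition pbar :: "(nat \<Rightarrow> real) \<Rightarrow> real" where
  "pbar y = (\<Sum>w=1..m2. pd w y) / m2"

lemma prob_\<mu>2A1: "prob_space (\<mu>2 \<Otimes>\<^sub>M A1)"
proof -
  interpret pair_prob_space \<mu>2 A1 ..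
  show ?thesis by (rule prob_space_axioms)
qed

lemma measurable_Pair_A2 [measurable]: "Pair w \<in> measurable \<mu>2 A2"
  unfolding A2_def by (rule measurable_Pair1') simp

lemma measurable_pd_mean:
  "(\<lambda>ua. e1 (snd ua) (w, fst ua) t) \<in> borel_measurable (\<mu>2 \<Otimes>\<^sub>M A1)"
  by measurable

lemma pd_pos: "y \<in> space OUT \<Longrightarrow> 0 < pd w y"
  unfolding pd_def by (rule mixd_pos[OF prob_\<mu>2A1 order_refl measurable_pd_mean])

lemma measurable_pd1: "pd w \<in> borel_measurable OUT"
  unfolding pd_def by (rule measurable_mixd[OF prob_\<mu>2A1 order_refl measurable_pd_mean])

lemma nn_integral_pd:
  "H \<in> borel_measurable OUT \<Longrightarrow> (\<integral>\<^sup>+y. H y * ennreal (pd w y) \<partial>lam N)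
    = (\<integral>\<^sup>+ua. \<integral>\<^sup>+y. H y * ennreal (nd N (e1 (snd ua) (w, fst ua)) 1 y) \<partial>lam N \<partial>(\<mu>2 \<Otimes>\<^sub>M A1))"
  unfolding pd_def by (rule nn_integral_mixd[OF prob_\<mu>2A1 order_refl measurable_pd_mean])

lemma nn_integral_pd_1: "(\<integral>\<^sup>+y. ennreal (pd w y) \<partial>lam N) = 1"
  unfolding pd_def by (rule nn_integral_mixd_1[OF prob_\<mu>2A1 order_refl measurable_pd_mean])

lemma measurable_pd [measurable (raw)]:
  assumes [measurable]: "f \<in> measurable M (count_space UNIV)" and [measurable]: "g \<in> measurable M OUT"
  shows "(\<lambda>x. pd (f x) (g x)) \<in> borel_measurable M"
  by (rule measurable_compose_countable[OF measurable_compose[OF assms(2) measurable_pd1] assms(1)])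

lemma measurable_pbar [measurable]: "pbar \<in> borel_measurable OUT"
  unfolding pbar_def[abs_def] by measurable

lemma pbar_pos:
  assumes "y \<in> space OUT" shows "0 < pbar y"
  unfolding pbar_def using m2_pos pd_pos[OF assms]
  by (intro divide_pos_pos sum_pos) auto

text \<open>One term of an average of nonnegative terms. It bounds the likelihood ratio of the
  leakage by \<open>m2\<close>, which handles the positive part of its logarithm.\<close>

lemma pd_le_pbar:
  assumes "y \<in> space OUT" "w \<in> {1..m2}" shows "pd w y \<le> m2 * pbar y"
  unfolding pbar_def using m2_pos member_le_sum[OF assms(2), of "\<lambda>w. pd w y"]
  by (simp add: less_imp_le[OF pd_pos[OF assms(1)]])

lemma nn_integral_p2: "(\<integral>\<^sup>+w. f w \<partial>p2) = (\<Sum>w=1..m2. f w) / of_nat m2"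
  using m2_pos by (subst nn_integral_pmf_of_set) auto

lemma nn_integral_p1: "(\<integral>\<^sup>+w. f w \<partial>p1) = (\<Sum>w=1..m1. f w) / of_nat m1"
  using m1_pos by (subst nn_integral_pmf_of_set) auto

definition "W1 \<omega> = fst (ia \<omega>)"
definition "W2 \<omega> = fst (ib \<omega>)"

lemma measurable_fst_A [measurable]:
  "fst \<in> measurable A1 (count_space UNIV)" "fst \<in> measurable A2 (count_space UNIV)"
  unfolding A1_def A2_def by measurable

lemma measurable_W [measurable]:
  "W1 \<in> measurable Om (count_space UNIV)" "W2 \<in> measurable Om (count_space UNIV)"
  unfolding W1_def[abs_def] W2_def[abs_def] by measurable

lemma nn_integral_W2_Y1:
  assumes H[measurable]: "H \<in> borel_measurable (p2 \<Otimes>\<^sub>M OUT)"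
  shows "(\<integral>\<^sup>+\<omega>. H (W2 \<omega>, Y1 \<omega>) \<partial>Om) = (\<integral>\<^sup>+w. \<integral>\<^sup>+y. H (w, y) * ennreal (pd w y) \<partial>lam N \<partial>p2)"
proof -
  have H2[measurable]: "(\<lambda>y. H (w, y)) \<in> borel_measurable OUT" for w by measurable
  have [measurable]: "fst \<in> measurable A2 p2" unfolding A2_def by (rule measurable_fst)
  interpret P: pair_sigma_finite A1 A2 ..
  interpret Q: pair_sigma_finite \<mu>2 A1 ..
  have K[measurable]: "(\<lambda>(a, b). \<integral>\<^sup>+y. ennreal (nd N (e1 a b) 1 y) * H (fst b, y) \<partial>lam N)
      \<in> borel_measurable (A1 \<Otimes>\<^sub>M A2)"
    by measurable
  have "(\<integral>\<^sup>+\<omega>. H (W2 \<omega>, Y1 \<omega>) \<partial>Om) = (\<integral>\<^sup>+a. \<integral>\<^sup>+b. \<integral>\<^sup>+z1. \<integral>\<^sup>+z2.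
     H (fst b, shift N (e1 a b) z1) \<partial>noise \<partial>noise \<partial>A2 \<partial>A1)"
    by (subst nn_integral_Om) (auto simp: W2_def Y1_def)
  also have "\<dots> = (\<integral>\<^sup>+a. \<integral>\<^sup>+b. \<integral>\<^sup>+y. ennreal (nd N (e1 a b) 1 y) * H (fst b, y) \<partial>lam N \<partial>A2 \<partial>A1)"
    by (intro nn_integral_cong) (simp add: NO.emeasure_space_1 nn_integral_shift_noise[OF H2])
  also have "\<dots> = (\<integral>\<^sup>+b. \<integral>\<^sup>+a. \<integral>\<^sup>+y. ennreal (nd N (e1 a b) 1 y) * H (fst b, y) \<partial>lam N \<partial>A1 \<partial>A2)"
    by (rule P.Fubini'[symmetric]) (use K in simp)
  also have "\<dots> = (\<integral>\<^sup>+w. \<integral>\<^sup>+u. \<integral>\<^sup>+a. \<integral>\<^sup>+y. ennreal (nd N (e1 a (w, u)) 1 y) * H (w, y) \<partial>lam N \<partial>A1 \<partial>\<mu>2 \<partial>p2)"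
  proof -
    have "(\<lambda>b. \<integral>\<^sup>+a. \<integral>\<^sup>+y. ennreal (nd N (e1 a b) 1 y) * H (fst b, y) \<partial>lam N \<partial>A1) \<in> borel_measurable A2"
      by measurable
    from MU2.nn_integral_fst[OF this[unfolded A2_def]] show ?thesis by (simp add: A2_def)
  qed
  also have "\<dots> = (\<integral>\<^sup>+w. \<integral>\<^sup>+ua. \<integral>\<^sup>+y. H (w, y) * ennreal (nd N (e1 (snd ua) (w, fst ua)) 1 y) \<partial>lam N \<partial>(\<mu>2 \<Otimes>\<^sub>M A1) \<partial>p2)"
    by (intro nn_integral_cong, subst A1.nn_integral_fst[symmetric]) (auto simp: mult.commute)
  also have "\<dots> = (\<integral>\<^sup>+w. \<integral>\<^sup>+y. H (w, y) * ennreal (pd w y) \<partial>lam N \<partial>p2)"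
    by (intro nn_integral_cong nn_integral_pd[symmetric] H2)
  finally show ?thesis .
qed

lemma nn_integral_Y1:
  assumes [measurable]: "H \<in> borel_measurable OUT"
  shows "(\<integral>\<^sup>+\<omega>. H (Y1 \<omega>) \<partial>Om) = (\<integral>\<^sup>+y. H y * ennreal (pbar y) \<partial>lam N)"
proof -
  have "(\<integral>\<^sup>+\<omega>. H (Y1 \<omega>) \<partial>Om) = (\<integral>\<^sup>+w. \<integral>\<^sup>+y. H y * ennreal (pd w y) \<partial>lam N \<partial>p2)"
    using nn_integral_W2_Y1[of "\<lambda>wy. H (snd wy)"] by simp
  also have "\<dots> = (\<integral>\<^sup>+y. (\<Sum>w=1..m2. H y * ennreal (pd w y)) \<partial>lam N) / of_nat m2"
    by (subst nn_integral_p2, subst nn_integral_sum) auto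
  also have "\<dots> = (\<integral>\<^sup>+y. (\<Sum>w=1..m2. H y * ennreal (pd w y)) / of_nat m2 \<partial>lam N)"
    by (rule nn_integral_divide[symmetric]) measurable
  also have "\<dots> = (\<integral>\<^sup>+y. H y * ennreal (pbar y) \<partial>lam N)"
  proof (intro nn_integral_cong)
    fix y assume "y \<in> space (lam N)"
    then have y: "y \<in> space OUT" by (simp add: space_lam)
    have "ennreal (pbar y) = (\<Sum>w=1..m2. ennreal (pd w y)) / of_nat m2"
    proof -
      have nn: "\<And>w. 0 \<le> pd w y" using pd_pos[OF y] less_imp_le by blast
      show ?thesis unfolding pbar_def using m2_pos
        by (simp add: divide_ennreal[symmetric] sum_nonneg nn ennreal_of_nat_eq_real_of_nat sum_ennreal)
    qed
    then show "(\<Sum>w=1..m2. H y * ennreal (pd w y)) / of_nat m2 = H y * ennreal (pbar y)"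
      by (simp add: sum_distrib_left[symmetric] ennreal_times_divide)
  qed
  finally show ?thesis .
qed

lemma nn_integral_pbar_1: "(\<integral>\<^sup>+y. ennreal (pbar y) \<partial>lam N) = 1"
  using nn_integral_Y1[of "\<lambda>_. 1"] by (simp add: Om.emeasure_space_1)

lemma distributed_W2_Y1:
  "distributed Om (p2 \<Otimes>\<^sub>M lam N) (\<lambda>\<omega>. (W2 \<omega>, Y1 \<omega>)) (\<lambda>wy. ennreal (pd (fst wy) (snd wy)))"
proof (rule distributedI_nn_integral)
  fix H :: "nat \<times> (nat \<Rightarrow> real) \<Rightarrow> ennreal" assume "H \<in> borel_measurable (p2 \<Otimes>\<^sub>M lam N)"
  then have [measurable]: "H \<in> borel_measurable (p2 \<Otimes>\<^sub>M OUT)"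
    using measurable_cong_sets[OF sets_pair_measure_cong[OF refl sets_lam] refl] by blast
  show "(\<integral>\<^sup>+\<omega>. H (W2 \<omega>, Y1 \<omega>) \<partial>Om) = (\<integral>\<^sup>+y. ennreal (pd (fst y) (snd y)) * H y \<partial>(p2 \<Otimes>\<^sub>M lam N))"
    by (subst LA.nn_integral_fst[symmetric]) (auto simp: nn_integral_W2_Y1 mult.commute)
qed measurable

lemma distributed_Y1: "distributed Om (lam N) Y1 (\<lambda>y. ennreal (pbar y))"
proof (rule distributedI_nn_integral)
  fix H :: "(nat \<Rightarrow> real) \<Rightarrow> ennreal" assume [measurable]: "H \<in> borel_measurable (lam N)"
  then show "(\<integral>\<^sup>+\<omega>. H (Y1 \<omega>) \<partial>Om) = (\<integral>\<^sup>+y. ennreal (pbar y) * H y \<partial>lam N)"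
    by (subst nn_integral_Y1) (auto simp: mult.commute)
qed measurable

lemma distributed_W2: "distributed Om p2 W2 (\<lambda>_. ennreal 1)"
proof (rule distributedI_nn_integral)
  fix H :: "nat \<Rightarrow> ennreal" assume [measurable]: "H \<in> borel_measurable p2"
  have "(\<integral>\<^sup>+\<omega>. H (W2 \<omega>) \<partial>Om) = (\<integral>\<^sup>+w. \<integral>\<^sup>+y. H w * ennreal (pd w y) \<partial>lam N \<partial>p2)"
    using nn_integral_W2_Y1[of "\<lambda>wy. H (fst wy)"] by simp
  also have "\<dots> = (\<integral>\<^sup>+w. H w \<partial>p2)"
    by (intro nn_integral_cong) (simp add: nn_integral_cmult nn_integral_pd_1)
  finally show "(\<integral>\<^sup>+\<omega>. H (W2 \<omega>) \<partial>Om) = (\<integral>\<^sup>+w. ennreal 1 * H w \<partial>p2)" by simp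
qed measurable

lemma AE_W2: "AE \<omega> in Om. W2 \<omega> \<in> {1..m2}"
proof -
  have "(\<integral>\<^sup>+\<omega>. indicator (- {1..m2}) (W2 \<omega>) \<partial>Om) = (\<integral>\<^sup>+w. indicator (- {1..m2}) w \<partial>p2)"
    using distributed_nn_integral[OF distributed_W2, of "indicator (- {1..m2})"] by simp
  also have "\<dots> = 0" by (subst nn_integral_p2) auto
  finally have "AE \<omega> in Om. (indicator (- {1..m2}) (W2 \<omega>) :: ennreal) = 0"
    using measurable_compose[OF measurable_W(2), of "indicator (- {1..m2})" borel]
    by (subst (asm) nn_integral_0_iff_AE) auto
  then show ?thesis by eventually_elim (auto simp: indicator_def split: if_splits)
qed

lemma Y1_space: "\<omega> \<in> space Om \<Longrightarrow> Y1 \<omega> \<in> space OUT"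
  and Y2_space: "\<omega> \<in> space Om \<Longrightarrow> Y2 \<omega> \<in> space OUT"
  using measurable_Y[THEN measurable_space] by auto

definition leakage :: real where
  "leakage = prob_space.mutual_information Om 2 (count_space UNIV) OUT W2 Y1"

lemma leakage_eq: "leakage = (\<integral>\<omega>. log 2 (pd (W2 \<omega>) (Y1 \<omega>) / pbar (Y1 \<omega>)) \<partial>Om)"
proof -
  interpret I: information_space Om 2 by standard auto
  have sp: "sets (count_space UNIV \<Otimes>\<^sub>M OUT) = sets (p2 \<Otimes>\<^sub>M lam N)"
    by (intro sets_pair_measure_cong) (auto simp: sets_lam)
  \<comment> \<open>Mutual information sees only the sigma-algebras of the two value spaces, so
    \<open>count_space UNIV\<close> and \<open>OUT\<close> may be exchanged for \<open>p2\<close>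
    and \<open>lam N\<close>, the measures with respect to which densities are known.\<close>
  have "leakage = Om.mutual_information 2 p2 (lam N) W2 Y1"
    unfolding leakage_def Om.mutual_information_def
    by (intro arg_cong2[where f="KL_divergence 2"] arg_cong2[where f="(\<Otimes>\<^sub>M)"] distr_cong sp)
       (auto simp: sets_lam)
  also have "\<dots> = (\<integral>wy. pd (fst wy) (snd wy) *
      log 2 (pd (fst wy) (snd wy) / (1 * pbar (snd wy))) \<partial>(p2 \<Otimes>\<^sub>M lam N))"
    by (rule I.mutual_information_distr[OF _ _ distributed_W2 _ distributed_Y1 _ distributed_W2_Y1])
       (auto intro!: less_imp_le pbar_pos pd_pos simp: space_lam measure_pmf.sigma_finite_measure_axioms LA.sigma_finite_measure_axioms)
  also have "\<dots> = (\<integral>\<omega>. log 2 (pd (fst (W2 \<omega>, Y1 \<omega>)) (snd (W2 \<omega>, Y1 \<omega>)) / (1 * pbar (snd (W2 \<omega>, Y1 \<omega>)))) \<partial>Om)"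
    by (rule distributed_integral[OF distributed_W2_Y1])
       (auto intro!: less_imp_le pd_pos simp: space_pair_measure space_lam)
  finally show ?thesis by simp
qed

lemma measurable_pd_W2_Y1: "(\<lambda>\<omega>. pd (W2 \<omega>) (Y1 \<omega>)) \<in> borel_measurable Om"
  by (rule measurable_pd[OF measurable_W(2) measurable_Y(1)])

lemma measurable_pbar_Y1: "(\<lambda>\<omega>. pbar (Y1 \<omega>)) \<in> borel_measurable Om"
  by (rule measurable_compose[OF measurable_Y(1) measurable_pbar])

text \<open>Under the joint law the factor \<open>pd\<close> cancels and leaves the total mass of
  \<open>pbar\<close>. This controls the negative part of the logarithm in
  \<open>integrable_ln_ratio\<close>.\<close>

lemma integrable_pbar_div_pd:
  "integrable Om (\<lambda>\<omega>. pbar (Y1 \<omega>) / pd (W2 \<omega>) (Y1 \<omega>))"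
proof (rule nn_integral_bound_real[where c=1])
  have "(\<integral>\<^sup>+\<omega>. ennreal (pbar (Y1 \<omega>) / pd (W2 \<omega>) (Y1 \<omega>)) \<partial>Om)
     = (\<integral>\<^sup>+w. \<integral>\<^sup>+y. ennreal (pbar y / pd w y) * ennreal (pd w y) \<partial>lam N \<partial>p2)"
    using nn_integral_W2_Y1[of "\<lambda>wy. ennreal (pbar (snd wy) / pd (fst wy) (snd wy))"] by simp
  also have "\<dots> = (\<integral>\<^sup>+w. \<integral>\<^sup>+y. ennreal (pbar y) \<partial>lam N \<partial>p2)"
  proof (intro nn_integral_cong)
    fix w y assume "y \<in> space (lam N)"
    then have "y \<in> space OUT" by (simp add: space_lam)
    note pd_pos[OF this, of w] pbar_pos[OF this]
    then show "ennreal (pbar y / pd w y) * ennreal (pd w y) = ennreal (pbar y)"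
      by (subst ennreal_mult[symmetric]) auto
  qed
  finally show "(\<integral>\<^sup>+\<omega>. ennreal (pbar (Y1 \<omega>) / pd (W2 \<omega>) (Y1 \<omega>)) \<partial>Om) \<le> ennreal 1"
    by (simp add: nn_integral_pbar_1)
  fix \<omega> assume "\<omega> \<in> space Om"
  from pd_pos[OF Y1_space[OF this]] pbar_pos[OF Y1_space[OF this]]
  show "0 \<le> pbar (Y1 \<omega>) / pd (W2 \<omega>) (Y1 \<omega>)" by (intro divide_nonneg_nonneg less_imp_le)
qed (simp_all add: borel_measurable_divide measurable_pbar_Y1 measurable_pd_W2_Y1)

text \<open>For \<open>r = pd / pbar\<close>, \<open>ln r \<le> r - 1 \<le> m2 - 1\<close> from
  above and \<open>- ln r \<le> 1 / r - 1\<close> from below, so \<open>m2 + 1 / r\<close> dominates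
  the absolute value.\<close>

lemma integrable_ln_ratio:
  "integrable Om (\<lambda>\<omega>. ln (pd (W2 \<omega>) (Y1 \<omega>) / pbar (Y1 \<omega>)))"
proof (rule Bochner_Integration.integrable_bound)
  show "integrable Om (\<lambda>\<omega>. real m2 + pbar (Y1 \<omega>) / pd (W2 \<omega>) (Y1 \<omega>))"
    using integrable_pbar_div_pd by simp
  show "AE \<omega> in Om. norm (ln (pd (W2 \<omega>) (Y1 \<omega>) / pbar (Y1 \<omega>)))
       \<le> norm (real m2 + pbar (Y1 \<omega>) / pd (W2 \<omega>) (Y1 \<omega>))"
    using AE_W2 AE_space
  proof eventually_elim
    fix \<omega> assume W: "W2 \<omega> \<in> {1..m2}" and "\<omega> \<in> space Om"
    then have y: "Y1 \<omega> \<in> space OUT" by (simp add: Y1_space)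
    define r where "r = pd (W2 \<omega>) (Y1 \<omega>) / pbar (Y1 \<omega>)"
    have inv: "pbar (Y1 \<omega>) / pd (W2 \<omega>) (Y1 \<omega>) = inverse r" by (simp add: r_def)
    have r: "0 < r" using pd_pos[OF y] pbar_pos[OF y] by (simp add: r_def)
    have "r \<le> m2" using pd_le_pbar[OF y W] pbar_pos[OF y] by (simp add: r_def divide_le_eq)
    moreover have "ln r \<le> r - 1" using r by (rule ln_le_minus_one)
    moreover have "ln (inverse r) \<le> inverse r - 1" using r by (intro ln_le_minus_one) simp
    moreover have "0 < inverse r" using r by simp
    ultimately show "norm (ln (pd (W2 \<omega>) (Y1 \<omega>) / pbar (Y1 \<omega>)))
       \<le> norm (real m2 + pbar (Y1 \<omega>) / pd (W2 \<omega>) (Y1 \<omega>))"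
      unfolding inv r_def[symmetric] using r by (simp only: ln_inverse real_norm_def)
  qed
qed (intro borel_measurable_ln borel_measurable_divide measurable_pbar_Y1 measurable_pd_W2_Y1)

lemma integral_ln_ratio:
  "(\<integral>\<omega>. ln (pd (W2 \<omega>) (Y1 \<omega>) / pbar (Y1 \<omega>)) \<partial>Om) = leakage * ln 2"
  unfolding leakage_eq log_def by simp

text \<open>The true output density is replaced by a reference \<open>q\<close> through
  \<open>ln (p / pbar) = ln (p / q) + ln (q / pbar)\<close>. With \<open>ln x \<le> x - 1\<close> in
  both terms, the first has expectation at most \<open>C\<close> by the chi-square hypothesis and
  the second at most 0, because \<open>q\<close> has mass at most 1.\<close>

lemma leakage_le_chi_square:
  assumes q[measurable]: "q \<in> borel_measurable OUT" and qpos: "\<And>y. y \<in> space OUT \<Longrightarrow> 0 < q y"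
    and q1: "(\<integral>\<^sup>+y. ennreal (q y) \<partial>lam N) \<le> 1"
    and C: "(\<integral>\<^sup>+w. \<integral>\<^sup>+y. ennreal ((pd w y)\<^sup>2 / q y) \<partial>lam N \<partial>p2) \<le> ennreal (1 + C)" "0 \<le> 1 + C"
  shows "leakage * ln 2 \<le> C"
proof -
  let ?F = "\<lambda>\<omega>. pd (W2 \<omega>) (Y1 \<omega>) / q (Y1 \<omega>)" and ?G = "\<lambda>\<omega>. q (Y1 \<omega>) / pbar (Y1 \<omega>)"
  have "(\<integral>\<^sup>+\<omega>. ennreal (?F \<omega>) \<partial>Om)
     = (\<integral>\<^sup>+w. \<integral>\<^sup>+y. ennreal (pd w y / q y) * ennreal (pd w y) \<partial>lam N \<partial>p2)"
    using nn_integral_W2_Y1[of "\<lambda>wy. ennreal (pd (fst wy) (snd wy) / q (snd wy))"] by simp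
  also have "\<dots> = (\<integral>\<^sup>+w. \<integral>\<^sup>+y. ennreal ((pd w y)\<^sup>2 / q y) \<partial>lam N \<partial>p2)"
  proof (intro nn_integral_cong)
    fix w y assume "y \<in> space (lam N)"
    then have y: "y \<in> space OUT" by (simp add: space_lam)
    note pd_pos[OF y, of w]
    then show "ennreal (pd w y / q y) * ennreal (pd w y) = ennreal ((pd w y)\<^sup>2 / q y)"
      using qpos[OF y] by (subst ennreal_mult[symmetric]) (auto simp: power2_eq_square)
  qed
  finally have F: "(\<integral>\<^sup>+\<omega>. ennreal (?F \<omega>) \<partial>Om) \<le> ennreal (1 + C)" using C by simp
  have "(\<integral>\<^sup>+\<omega>. ennreal (?G \<omega>) \<partial>Om) = (\<integral>\<^sup>+y. ennreal (q y / pbar y) * ennreal (pbar y) \<partial>lam N)"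
    by (subst nn_integral_Y1[symmetric]) auto
  also have "\<dots> = (\<integral>\<^sup>+y. ennreal (q y) \<partial>lam N)"
  proof (intro nn_integral_cong)
    fix y assume "y \<in> space (lam N)"
    then have "y \<in> space OUT" by (simp add: space_lam)
    note pbar_pos[OF this] qpos[OF this]
    then show "ennreal (q y / pbar y) * ennreal (pbar y) = ennreal (q y)"
      by (subst ennreal_mult[symmetric]) auto
  qed
  finally have G: "(\<integral>\<^sup>+\<omega>. ennreal (?G \<omega>) \<partial>Om) \<le> ennreal 1" using q1 by simp
  have nn: "0 \<le> ?F \<omega>" "0 \<le> ?G \<omega>" if "\<omega> \<in> space Om" for \<omega>
    using pd_pos[OF Y1_space[OF that]] pbar_pos[OF Y1_space[OF that]] qpos[OF Y1_space[OF that]]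
    by (auto intro: divide_nonneg_nonneg less_imp_le)
  have mF: "?F \<in> borel_measurable Om" and mG: "?G \<in> borel_measurable Om"
    by (intro borel_measurable_divide measurable_pbar_Y1 measurable_pd_W2_Y1
        measurable_compose[OF measurable_Y(1) q])+
  note F = nn_integral_bound_real[OF mF nn(1) F C(2)]
  note G = nn_integral_bound_real[OF mG nn(2) G]
  have "leakage * ln 2 = (\<integral>\<omega>. ln (pd (W2 \<omega>) (Y1 \<omega>) / pbar (Y1 \<omega>)) \<partial>Om)"
    by (rule integral_ln_ratio[symmetric])
  also have "\<dots> \<le> (\<integral>\<omega>. ?F \<omega> + ?G \<omega> - 2 \<partial>Om)"
  proof (rule integral_mono)
    fix \<omega> assume "\<omega> \<in> space Om"
    then have y: "Y1 \<omega> \<in> space OUT" by (simp add: Y1_space)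
    note p = pd_pos[OF y, of "W2 \<omega>"] pbar_pos[OF y] qpos[OF y]
    have "ln (pd (W2 \<omega>) (Y1 \<omega>) / pbar (Y1 \<omega>)) = ln (?F \<omega>) + ln (?G \<omega>)"
      using p by (simp add: ln_div)
    also have "\<dots> \<le> (?F \<omega> - 1) + (?G \<omega> - 1)"
      using p by (intro add_mono ln_le_minus_one) auto
    finally show "ln (pd (W2 \<omega>) (Y1 \<omega>) / pbar (Y1 \<omega>)) \<le> ?F \<omega> + ?G \<omega> - 2" by simp
  qed (use integrable_ln_ratio F G in auto)
  also have "\<dots> = integral\<^sup>L Om ?F + integral\<^sup>L Om ?G - 2"
    using F G by (simp add: Om.prob_space)
  also have "\<dots> \<le> C" using F G by simp
  finally show ?thesis .
qed

end

section \<open>Ratios whose expectation is at most 1\<close>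

text \<open>The even mixture of the constant 1 and of \<open>m\<close> times the indicator of the
  decoded message. The constant keeps the weight positive, hence its logarithm finite, at decoding
  errors, while the sum over messages stays at most \<open>m\<close>.\<close>

definition Ms :: "((nat \<Rightarrow> real) \<Rightarrow> nat) \<Rightarrow> nat \<Rightarrow> nat \<Rightarrow> (nat \<Rightarrow> real) \<Rightarrow> real" where
  "Ms g m w y = (if g y = w then (real m + 1) / 2 else 1 / 2)"

lemma Ms_pos: "0 < Ms g m w y" by (simp add: Ms_def)

lemma Ms_nonneg [simp]: "0 \<le> Ms g m w y" by (simp add: Ms_def)

lemma sum_Ms: "(\<Sum>w=1..m. Ms g m w y) \<le> m"
proof -
  have "(\<Sum>w=1..m. Ms g m w y) = (\<Sum>w=1..m. 1 / 2 + (if w = g y then real m / 2 else 0))"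
    by (intro sum.cong) (auto simp: Ms_def add_divide_distrib)
  also have "\<dots> \<le> m" by (simp add: sum.distrib)
  finally show ?thesis .
qed

text \<open>The substitute for Fano's inequality: its expectation yields
  \<open>(1 - eps) * ln m - ln 2\<close>. The loss \<open>ln 2\<close> comes from the weight one
  half in the mixture.\<close>

lemma ln_Ms:
  assumes "1 \<le> m"
  shows "ln m * (1 - (if g y \<noteq> w then 1 else 0)) - ln 2 \<le> ln (Ms g m w y)"
proof -
  have "ln (real m / 2) \<le> ln ((real m + 1) / 2)" using assms by (subst ln_le_cancel_iff) auto
  then show ?thesis using assms by (auto simp: Ms_def ln_div)
qed

lemma measurable_Ms [measurable (raw)]:
  assumes W[measurable]: "W \<in> measurable M (count_space UNIV)" and Y[measurable]: "Y \<in> measurable M (out_space N)"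
    and g[measurable]: "g \<in> measurable (out_space N) (count_space UNIV)"
  shows "(\<lambda>x. Ms g m (W x) (Y x)) \<in> borel_measurable M"
proof -
  have [measurable]: "(\<lambda>x. g (Y x)) \<in> measurable M (count_space UNIV)"
    by (rule measurable_compose[OF Y g])
  have "(\<lambda>x. if g (Y x) = W x then (real m + 1) / 2 else 1 / 2) \<in> borel_measurable M"
    by (rule measurable_compose_countable[OF _ W]) measurable
  then show ?thesis by (simp add: Ms_def)
qed

context cooperative_code
begin

lemma nn_integral_A1_fst: "(\<integral>\<^sup>+a. F (fst a) \<partial>A1) = (\<integral>\<^sup>+w. F w \<partial>p1)"
proof -
  have "(\<integral>\<^sup>+a. F (fst a) \<partial>A1) = (\<integral>\<^sup>+w. \<integral>\<^sup>+u. F w \<partial>\<mu>1 \<partial>p1)"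
    unfolding A1_def by (subst MU1.nn_integral_fst[symmetric]) simp_all
  then show ?thesis by (simp add: MU1.emeasure_space_1)
qed

lemma nn_integral_A2_fst: "(\<integral>\<^sup>+a. F (fst a) \<partial>A2) = (\<integral>\<^sup>+w. F w \<partial>p2)"
proof -
  have "(\<integral>\<^sup>+a. F (fst a) \<partial>A2) = (\<integral>\<^sup>+w. \<integral>\<^sup>+u. F w \<partial>\<mu>2 \<partial>p2)"
    unfolding A2_def by (subst MU2.nn_integral_fst[symmetric]) simp_all
  then show ?thesis by (simp add: MU2.emeasure_space_1)
qed

text \<open>The mean \<open>c\<close> at receiver 1 stays free: \<open>e1\<close> gives the output
  \<open>Y1\<close>, while \<open>es\<close> gives the interference observation in
  \<open>smoothing_term\<close>. As \<open>K\<close> is only assumed measurable in the outputs for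
  fixed inputs, measurability in the sample point is a separate hypothesis.\<close>

lemma nn_integral_outputs:
  assumes K: "\<And>a b. (\<lambda>p. K a b (fst p) (snd p)) \<in> borel_measurable (OUT \<Otimes>\<^sub>M OUT)"
    and KO: "(\<lambda>\<omega>. K (ia \<omega>) (ib \<omega>) (shift N (c (ia \<omega>) (ib \<omega>)) (iz1 \<omega>)) (Y2 \<omega>)) \<in> borel_measurable Om"
  shows "(\<integral>\<^sup>+\<omega>. K (ia \<omega>) (ib \<omega>) (shift N (c (ia \<omega>) (ib \<omega>)) (iz1 \<omega>)) (Y2 \<omega>) \<partial>Om)
    = (\<integral>\<^sup>+a. \<integral>\<^sup>+b. \<integral>\<^sup>+y1. \<integral>\<^sup>+y2. ennreal (nd N (c a b) 1 y1) * (ennreal (nd N (e2 b) 1 y2) * K a b y1 y2)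
        \<partial>lam N \<partial>lam N \<partial>A2 \<partial>A1)"
proof -
  have Ks[measurable]: "K a b y1 \<in> borel_measurable OUT" if "y1 \<in> space OUT" for a b y1
    using measurable_compose[OF measurable_Pair1'[OF that] K[of a b]] by simp
  have I[measurable]: "(\<lambda>y1. \<integral>\<^sup>+y2. ennreal (nd N (e2 b) 1 y2) * K a b y1 y2 \<partial>lam N) \<in> borel_measurable OUT" for a b
  proof (rule LA.borel_measurable_nn_integral)
    have "(\<lambda>(x, y2). K a b x y2) \<in> borel_measurable (OUT \<Otimes>\<^sub>M OUT)"
      using K[of a b] by (simp add: case_prod_beta)
    note this[measurable]
    show "(\<lambda>(y1, y2). ennreal (nd N (e2 b) 1 y2) * K a b y1 y2) \<in> borel_measurable (OUT \<Otimes>\<^sub>M lam N)"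
      by measurable
  qed
  have sp: "shift N c z \<in> space OUT" for c z
    by (auto simp: shift_def out_space_def space_PiM)
  have "(\<integral>\<^sup>+\<omega>. K (ia \<omega>) (ib \<omega>) (shift N (c (ia \<omega>) (ib \<omega>)) (iz1 \<omega>)) (Y2 \<omega>) \<partial>Om)
     = (\<integral>\<^sup>+a. \<integral>\<^sup>+b. \<integral>\<^sup>+z1. \<integral>\<^sup>+z2. K a b (shift N (c a b) z1) (shift N (e2 b) z2) \<partial>noise \<partial>noise \<partial>A2 \<partial>A1)"
    by (subst nn_integral_Om[OF KO]) (simp add: Y2_def)
  also have "\<dots> = (\<integral>\<^sup>+a. \<integral>\<^sup>+b. \<integral>\<^sup>+z1. \<integral>\<^sup>+y2. ennreal (nd N (e2 b) 1 y2) * K a b (shift N (c a b) z1) y2 \<partial>lam N \<partial>noise \<partial>A2 \<partial>A1)"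
    by (intro nn_integral_cong nn_integral_shift_noise Ks sp)
  also have "\<dots> = (\<integral>\<^sup>+a. \<integral>\<^sup>+b. \<integral>\<^sup>+y1. ennreal (nd N (c a b) 1 y1) * (\<integral>\<^sup>+y2. ennreal (nd N (e2 b) 1 y2) * K a b y1 y2
        \<partial>lam N) \<partial>lam N \<partial>A2 \<partial>A1)"
    by (intro nn_integral_cong nn_integral_shift_noise I)
  also have "\<dots> = (\<integral>\<^sup>+a. \<integral>\<^sup>+b. \<integral>\<^sup>+y1. \<integral>\<^sup>+y2. ennreal (nd N (c a b) 1 y1) * (ennreal (nd N (e2 b) 1 y2) * K a b y1 y2)
        \<partial>lam N \<partial>lam N \<partial>A2 \<partial>A1)"
    by (intro nn_integral_cong nn_integral_cmult[symmetric]) (auto simp: space_lam intro!: borel_measurable_times)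
  finally show ?thesis .
qed

lemma nn_integral_output1:
  assumes K: "\<And>a b. K a b \<in> borel_measurable OUT"
    and KO: "(\<lambda>\<omega>. K (ia \<omega>) (ib \<omega>) (shift N (c (ia \<omega>) (ib \<omega>)) (iz1 \<omega>))) \<in> borel_measurable Om"
  shows "(\<integral>\<^sup>+\<omega>. K (ia \<omega>) (ib \<omega>) (shift N (c (ia \<omega>) (ib \<omega>)) (iz1 \<omega>)) \<partial>Om)
    = (\<integral>\<^sup>+a. \<integral>\<^sup>+b. \<integral>\<^sup>+y1. ennreal (nd N (c a b) 1 y1) * K a b y1 \<partial>lam N \<partial>A2 \<partial>A1)"
proof -
  have "(\<integral>\<^sup>+\<omega>. K (ia \<omega>) (ib \<omega>) (shift N (c (ia \<omega>) (ib \<omega>)) (iz1 \<omega>)) \<partial>Om)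
     = (\<integral>\<^sup>+a. \<integral>\<^sup>+b. \<integral>\<^sup>+z1. K a b (shift N (c a b) z1) \<partial>noise \<partial>A2 \<partial>A1)"
    by (subst nn_integral_Om[OF KO]) (simp add: NO.emeasure_space_1)
  also have "\<dots> = (\<integral>\<^sup>+a. \<integral>\<^sup>+b. \<integral>\<^sup>+y1. ennreal (nd N (c a b) 1 y1) * K a b y1 \<partial>lam N \<partial>A2 \<partial>A1)"
    by (intro nn_integral_cong nn_integral_shift_noise K)
  finally show ?thesis .
qed

lemma measurable_eout [measurable]:
  "(\<lambda>\<omega>. nd N (e1 (ia \<omega>) (ib \<omega>)) 1 (Y1 \<omega>)) \<in> borel_measurable Om"
  "(\<lambda>\<omega>. nd N (e2 (ib \<omega>)) 1 (Y2 \<omega>)) \<in> borel_measurable Om"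
   apply (rule measurable_nd[OF measurable_e1[OF measurable_inputs(1,2)] measurable_Y(1)])
  apply (rule measurable_nd[OF measurable_e2[OF measurable_inputs(2)] measurable_Y(2)])
  done

lemma ennreal_mult_divide_cancel:
  assumes "0 < x" "0 \<le> y" shows "ennreal x * ennreal (y / x) = ennreal y"
  using assms by (subst ennreal_mult[symmetric]) auto

text \<open>Interchanging sum and integral and applying \<open>sum_Ms\<close> pointwise leaves the
  mass of \<open>r\<close>; dividing by the number of messages removes the factor
  \<open>m\<close>.\<close>

lemma avg_Ms_le:
  assumes [measurable]: "g \<in> measurable OUT (count_space UNIV)" "r \<in> borel_measurable OUT"
    and r: "\<And>y. y \<in> space OUT \<Longrightarrow> 0 \<le> r y" "(\<integral>\<^sup>+y. ennreal (r y) \<partial>lam N) \<le> 1" and m: "1 \<le> m"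
  shows "(\<integral>\<^sup>+w. \<integral>\<^sup>+y. ennreal (Ms g m w y * r y) \<partial>lam N \<partial>measure_pmf (pmf_of_set {1..m})) \<le> 1"
proof -
  have "(\<integral>\<^sup>+w. \<integral>\<^sup>+y. ennreal (Ms g m w y * r y) \<partial>lam N \<partial>measure_pmf (pmf_of_set {1..m}))
     = (\<Sum>w=1..m. \<integral>\<^sup>+y. ennreal (Ms g m w y * r y) \<partial>lam N) / of_nat m"
    using m by (subst nn_integral_pmf_of_set) auto
  also have "\<dots> = (\<integral>\<^sup>+y. (\<Sum>w=1..m. ennreal (Ms g m w y * r y)) \<partial>lam N) / of_nat m"
    by (subst nn_integral_sum) measurable
  also have "\<dots> \<le> (\<integral>\<^sup>+y. ennreal (m * r y) \<partial>lam N) / of_nat m"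
  proof (intro divide_right_mono_ennreal nn_integral_mono)
    fix y assume "y \<in> space (lam N)"
    then have ry: "0 \<le> r y" using r by (simp add: space_lam)
    then have "(\<Sum>w=1..m. ennreal (Ms g m w y * r y)) = ennreal ((\<Sum>w=1..m. Ms g m w y) * r y)"
      by (simp add: sum_ennreal sum_distrib_right)
    also have "\<dots> \<le> ennreal (m * r y)"
      using ry sum_Ms by (intro ennreal_leI mult_right_mono)
    finally show "(\<Sum>w=1..m. ennreal (Ms g m w y * r y)) \<le> ennreal (m * r y)" .
  qed
  also have "\<dots> = of_nat m * (\<integral>\<^sup>+y. ennreal (r y) \<partial>lam N) / of_nat m"
    by (simp add: ennreal_mult' nn_integral_cmult ennreal_of_nat_eq_real_of_nat)
  also have "\<dots> \<le> of_nat m * 1 / of_nat m"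
    using r by (intro divide_right_mono_ennreal mult_left_mono) auto
  also have "\<dots> = 1" using m by (simp add: ennreal_of_nat_eq_real_of_nat divide_ennreal)
  finally show ?thesis .
qed

context
  fixes g1 g2 :: "(nat \<Rightarrow> real) \<Rightarrow> nat"
  assumes g1[measurable]: "g1 \<in> measurable OUT (count_space UNIV)"
    and g2[measurable]: "g2 \<in> measurable OUT (count_space UNIV)"
begin

lemma measurable_Ms_W [measurable]:
  "(\<lambda>\<omega>. Ms g1 m1 (W1 \<omega>) (Y1 \<omega>)) \<in> borel_measurable Om"
  "(\<lambda>\<omega>. Ms g2 m2 (W2 \<omega>) (Y2 \<omega>)) \<in> borel_measurable Om"
  by (rule measurable_Ms[OF measurable_W(1) measurable_Y(1) g1])
     (rule measurable_Ms[OF measurable_W(2) measurable_Y(2) g2])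

text \<open>Under the true law the density of \<open>Y1\<close> given both inputs cancels the
  denominator, whatever the reference \<open>r\<close> is; \<open>avg_Ms_le\<close> treats what is
  left.\<close>

lemma single_user1:
  assumes r[measurable]: "r \<in> borel_measurable OUT"
    and rpos: "\<And>y. y \<in> space OUT \<Longrightarrow> 0 \<le> r y" "(\<integral>\<^sup>+y. ennreal (r y) \<partial>lam N) \<le> 1"
  shows "(\<integral>\<^sup>+\<omega>. ennreal (Ms g1 m1 (W1 \<omega>) (Y1 \<omega>) * r (Y1 \<omega>) / nd N (e1 (ia \<omega>) (ib \<omega>)) 1 (Y1 \<omega>)) \<partial>Om) \<le> 1"
proof -
  let ?K = "\<lambda>a b y. ennreal (Ms g1 m1 (fst a) y * r y / nd N (e1 a b) 1 y)"
  have "(\<integral>\<^sup>+\<omega>. ennreal (Ms g1 m1 (W1 \<omega>) (Y1 \<omega>) * r (Y1 \<omega>) / nd N (e1 (ia \<omega>) (ib \<omega>)) 1 (Y1 \<omega>)) \<partial>Om)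
     = (\<integral>\<^sup>+\<omega>. ?K (ia \<omega>) (ib \<omega>) (shift N (e1 (ia \<omega>) (ib \<omega>)) (iz1 \<omega>)) \<partial>Om)"
    by (simp add: W1_def Y1_def)
  also have "\<dots> = (\<integral>\<^sup>+a. \<integral>\<^sup>+b. \<integral>\<^sup>+y1. ennreal (nd N (e1 a b) 1 y1) * ?K a b y1 \<partial>lam N \<partial>A2 \<partial>A1)"
  proof (rule nn_integral_output1)
    show "?K a b \<in> borel_measurable OUT" for a b by measurable
    have "(\<lambda>\<omega>. ennreal (Ms g1 m1 (W1 \<omega>) (Y1 \<omega>) * r (Y1 \<omega>) / nd N (e1 (ia \<omega>) (ib \<omega>)) 1 (Y1 \<omega>))) \<in> borel_measurable Om"
      by (intro measurable_compose[OF _ measurable_ennreal] borel_measurable_divide borel_measurable_times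
         measurable_Ms_W measurable_eout measurable_compose[OF measurable_Y(1) r])
    from this[unfolded W1_def Y1_def] show "(\<lambda>\<omega>. ?K (ia \<omega>) (ib \<omega>) (shift N (e1 (ia \<omega>) (ib \<omega>)) (iz1 \<omega>))) \<in> borel_measurable Om"
      .
  qed
  also have "\<dots> = (\<integral>\<^sup>+a. \<integral>\<^sup>+b. \<integral>\<^sup>+y. ennreal (Ms g1 m1 (fst a) y * r y) \<partial>lam N \<partial>A2 \<partial>A1)"
    by (intro nn_integral_cong ennreal_mult_divide_cancel nd_pos mult_nonneg_nonneg) (auto simp: rpos space_lam)
  also have "\<dots> = (\<integral>\<^sup>+a. \<integral>\<^sup>+y. ennreal (Ms g1 m1 (fst a) y * r y) \<partial>lam N \<partial>A1)"
    by (simp add: A2.emeasure_space_1)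
  also have "\<dots> = (\<integral>\<^sup>+w. \<integral>\<^sup>+y. ennreal (Ms g1 m1 w y * r y) \<partial>lam N \<partial>p1)"
    by (rule nn_integral_A1_fst)
  also have "\<dots> \<le> 1" using rpos m1_pos by (intro avg_Ms_le) auto
  finally show ?thesis .
qed

lemma single_user2:
  assumes r[measurable]: "r \<in> borel_measurable OUT"
    and rpos: "\<And>y. y \<in> space OUT \<Longrightarrow> 0 \<le> r y" "(\<integral>\<^sup>+y. ennreal (r y) \<partial>lam N) \<le> 1"
  shows "(\<integral>\<^sup>+\<omega>. ennreal (Ms g2 m2 (W2 \<omega>) (Y2 \<omega>) * r (Y2 \<omega>) / nd N (e2 (ib \<omega>)) 1 (Y2 \<omega>)) \<partial>Om) \<le> 1"
proof -
  let ?K = "\<lambda>(a::nat \<times> real) b (y1::nat \<Rightarrow> real) y. ennreal (Ms g2 m2 (fst b) y * r y / nd N (e2 b) 1 y)"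
  have "(\<integral>\<^sup>+\<omega>. ennreal (Ms g2 m2 (W2 \<omega>) (Y2 \<omega>) * r (Y2 \<omega>) / nd N (e2 (ib \<omega>)) 1 (Y2 \<omega>)) \<partial>Om)
     = (\<integral>\<^sup>+\<omega>. ?K (ia \<omega>) (ib \<omega>) (shift N (e1 (ia \<omega>) (ib \<omega>)) (iz1 \<omega>)) (Y2 \<omega>) \<partial>Om)"
    by (simp add: W2_def)
  also have "\<dots> = (\<integral>\<^sup>+a. \<integral>\<^sup>+b. \<integral>\<^sup>+y1. \<integral>\<^sup>+y2. ennreal (nd N (e1 a b) 1 y1) * (ennreal (nd N (e2 b) 1 y2) * ?K a b y1 y2)
        \<partial>lam N \<partial>lam N \<partial>A2 \<partial>A1)"
  proof (rule nn_integral_outputs)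
    show "(\<lambda>p. ?K a b (fst p) (snd p)) \<in> borel_measurable (OUT \<Otimes>\<^sub>M OUT)" for a b by measurable
    have "(\<lambda>\<omega>. ennreal (Ms g2 m2 (W2 \<omega>) (Y2 \<omega>) * r (Y2 \<omega>) / nd N (e2 (ib \<omega>)) 1 (Y2 \<omega>))) \<in> borel_measurable Om"
      by (intro measurable_compose[OF _ measurable_ennreal] borel_measurable_divide borel_measurable_times
         measurable_Ms_W measurable_eout measurable_compose[OF measurable_Y(2) r])
    then show "(\<lambda>\<omega>. ?K (ia \<omega>) (ib \<omega>) (shift N (e1 (ia \<omega>) (ib \<omega>)) (iz1 \<omega>)) (Y2 \<omega>)) \<in> borel_measurable Om"
      by (simp add: W2_def)
  qed
  also have "\<dots> = (\<integral>\<^sup>+a. \<integral>\<^sup>+b. \<integral>\<^sup>+y1. \<integral>\<^sup>+y2. ennreal (nd N (e1 a b) 1 y1) * ennreal (Ms g2 m2 (fst b) y2 * r y2)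
        \<partial>lam N \<partial>lam N \<partial>A2 \<partial>A1)"
    by (intro nn_integral_cong arg_cong2[where f="(*)"] refl ennreal_mult_divide_cancel nd_pos mult_nonneg_nonneg)
       (auto simp: rpos space_lam)
  also have "\<dots> = (\<integral>\<^sup>+a. \<integral>\<^sup>+b. \<integral>\<^sup>+y2. ennreal (Ms g2 m2 (fst b) y2 * r y2) \<partial>lam N \<partial>A2 \<partial>A1)"
    by (simp add: nn_integral_cmult nn_integral_multc nn_integral_nd)
  also have "\<dots> = (\<integral>\<^sup>+b. \<integral>\<^sup>+y2. ennreal (Ms g2 m2 (fst b) y2 * r y2) \<partial>lam N \<partial>A2)"
    by (simp add: A1.emeasure_space_1)
  also have "\<dots> = (\<integral>\<^sup>+w. \<integral>\<^sup>+y. ennreal (Ms g2 m2 w y * r y) \<partial>lam N \<partial>p2)"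
    by (rule nn_integral_A2_fst)
  also have "\<dots> \<le> 1" using rpos m2_pos by (intro avg_Ms_le) auto
  finally show ?thesis .
qed

text \<open>Given the inputs the two noises are independent, so \<open>Y2\<close> integrates out
  against its own conditional density and leaves \<open>A\<close>, a function of the message of user
  2 alone. The rest is an expectation over \<open>(W2, Y1)\<close>, whose density is
  \<open>pd\<close>; this cancels the second denominator.\<close>

lemma secrecy_term:
  assumes r1[measurable]: "r1 \<in> borel_measurable OUT"
    and r1pos: "\<And>y. y \<in> space OUT \<Longrightarrow> 0 \<le> r1 y" "(\<integral>\<^sup>+y. ennreal (r1 y) \<partial>lam N) \<le> 1"
    and r2[measurable]: "r2 \<in> borel_measurable OUT"
    and r2pos: "\<And>y. y \<in> space OUT \<Longrightarrow> 0 \<le> r2 y" "(\<integral>\<^sup>+y. ennreal (r2 y) \<partial>lam N) \<le> 1"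
  shows "(\<integral>\<^sup>+\<omega>. ennreal (Ms g2 m2 (W2 \<omega>) (Y2 \<omega>) * r2 (Y2 \<omega>) / nd N (e2 (ib \<omega>)) 1 (Y2 \<omega>)
             * (r1 (Y1 \<omega>) / pd (W2 \<omega>) (Y1 \<omega>))) \<partial>Om) \<le> 1"
proof -
  let ?K = "\<lambda>(a::nat \<times> real) b y1 y. ennreal (Ms g2 m2 (fst b) y * r2 y / nd N (e2 b) 1 y * (r1 y1 / pd (fst b) y1))"
  define A where "A w = (\<integral>\<^sup>+y2. ennreal (Ms g2 m2 w y2 * r2 y2) \<partial>lam N)" for w
  have mr: "(\<lambda>\<omega>. r1 (Y1 \<omega>) / pd (W2 \<omega>) (Y1 \<omega>)) \<in> borel_measurable Om"
    by (rule borel_measurable_divide[OF measurable_compose[OF measurable_Y(1) r1] measurable_pd_W2_Y1])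
  have [measurable]: "pd w \<in> borel_measurable OUT" for w by (rule measurable_pd1)
  have AM: "(\<lambda>\<omega>. A (W2 \<omega>)) \<in> borel_measurable Om"
    by (rule measurable_compose[OF measurable_W(2)]) simp
  have q: "0 \<le> r1 y / pd w y" if "y \<in> space OUT" for w y
    using r1pos(1)[OF that] pd_pos[OF that, of w] by (intro divide_nonneg_pos)
  have "(\<integral>\<^sup>+\<omega>. ennreal (Ms g2 m2 (W2 \<omega>) (Y2 \<omega>) * r2 (Y2 \<omega>) / nd N (e2 (ib \<omega>)) 1 (Y2 \<omega>)
             * (r1 (Y1 \<omega>) / pd (W2 \<omega>) (Y1 \<omega>))) \<partial>Om)
     = (\<integral>\<^sup>+\<omega>. ?K (ia \<omega>) (ib \<omega>) (shift N (e1 (ia \<omega>) (ib \<omega>)) (iz1 \<omega>)) (Y2 \<omega>) \<partial>Om)"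
    by (simp add: W2_def Y1_def)
  also have "\<dots> = (\<integral>\<^sup>+a. \<integral>\<^sup>+b. \<integral>\<^sup>+y1. \<integral>\<^sup>+y2. ennreal (nd N (e1 a b) 1 y1) * (ennreal (nd N (e2 b) 1 y2) * ?K a b y1 y2)
        \<partial>lam N \<partial>lam N \<partial>A2 \<partial>A1)"
  proof (rule nn_integral_outputs)
    show "(\<lambda>p. ?K a b (fst p) (snd p)) \<in> borel_measurable (OUT \<Otimes>\<^sub>M OUT)" for a b by measurable
    have "(\<lambda>\<omega>. ennreal (Ms g2 m2 (W2 \<omega>) (Y2 \<omega>) * r2 (Y2 \<omega>) / nd N (e2 (ib \<omega>)) 1 (Y2 \<omega>)
             * (r1 (Y1 \<omega>) / pd (W2 \<omega>) (Y1 \<omega>)))) \<in> borel_measurable Om"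
      by (intro measurable_compose[OF _ measurable_ennreal] borel_measurable_times[OF _ mr] borel_measurable_divide borel_measurable_times
         measurable_Ms_W measurable_eout measurable_compose[OF measurable_Y(2) r2])
    from this[unfolded W2_def Y1_def] show "(\<lambda>\<omega>. ?K (ia \<omega>) (ib \<omega>) (shift N (e1 (ia \<omega>) (ib \<omega>)) (iz1 \<omega>)) (Y2 \<omega>)) \<in> borel_measurable Om"
      .
  qed
  also have "\<dots> = (\<integral>\<^sup>+a. \<integral>\<^sup>+b. \<integral>\<^sup>+y1. \<integral>\<^sup>+y2. ennreal (nd N (e1 a b) 1 y1) *
        (ennreal (Ms g2 m2 (fst b) y2 * r2 y2) * ennreal (r1 y1 / pd (fst b) y1)) \<partial>lam N \<partial>lam N \<partial>A2 \<partial>A1)"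
  proof (intro nn_integral_cong, rule arg_cong2[where f="(*)", OF refl])
    fix b :: "nat \<times> real" and y1 y2 assume "y1 \<in> space (lam N)" "y2 \<in> space (lam N)"
    then have y: "y1 \<in> space OUT" "y2 \<in> space OUT" by (simp_all add: space_lam)
    have "?K undefined b y1 y2 = ennreal (Ms g2 m2 (fst b) y2 * r2 y2 / nd N (e2 b) 1 y2) * ennreal (r1 y1 / pd (fst b) y1)"
      by (rule ennreal_mult[OF _ q[OF y(1)]])
         (intro divide_nonneg_nonneg mult_nonneg_nonneg Ms_nonneg nd_nonneg r2pos y)
    then show "ennreal (nd N (e2 b) 1 y2) * ?K undefined b y1 y2
      = ennreal (Ms g2 m2 (fst b) y2 * r2 y2) * ennreal (r1 y1 / pd (fst b) y1)"
      by (simp only: mult.assoc[symmetric] ennreal_mult_divide_cancel[OF nd_pos[OF zero_less_one]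
            mult_nonneg_nonneg[OF Ms_nonneg r2pos(1)[OF y(2)]]])
  qed
  also have "\<dots> = (\<integral>\<^sup>+a. \<integral>\<^sup>+b. \<integral>\<^sup>+y1. ennreal (nd N (e1 a b) 1 y1) *
        (A (fst b) * ennreal (r1 y1 / pd (fst b) y1)) \<partial>lam N \<partial>A2 \<partial>A1)"
    unfolding A_def by (intro nn_integral_cong) (simp add: nn_integral_cmult nn_integral_multc)
  also have "\<dots> = (\<integral>\<^sup>+\<omega>. A (fst (ib \<omega>)) * ennreal (r1 (shift N (e1 (ia \<omega>) (ib \<omega>)) (iz1 \<omega>)) /
        pd (fst (ib \<omega>)) (shift N (e1 (ia \<omega>) (ib \<omega>)) (iz1 \<omega>))) \<partial>Om)"
  proof (rule nn_integral_output1[symmetric])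
    show "(\<lambda>y1. A (fst b) * ennreal (r1 y1 / pd (fst b) y1)) \<in> borel_measurable OUT" for b :: "nat \<times> real"
      by measurable
    show "(\<lambda>\<omega>. A (fst (ib \<omega>)) * ennreal (r1 (shift N (e1 (ia \<omega>) (ib \<omega>)) (iz1 \<omega>)) /
        pd (fst (ib \<omega>)) (shift N (e1 (ia \<omega>) (ib \<omega>)) (iz1 \<omega>)))) \<in> borel_measurable Om"
      by (rule borel_measurable_times_ennreal[OF AM[unfolded W2_def]
            measurable_compose[OF mr[unfolded W2_def Y1_def] measurable_ennreal]])
  qed
  also have "\<dots> = (\<integral>\<^sup>+\<omega>. (\<lambda>(w, y). A w * ennreal (r1 y / pd w y)) (W2 \<omega>, Y1 \<omega>) \<partial>Om)"
    by (simp add: W2_def Y1_def)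
  also have "\<dots> = (\<integral>\<^sup>+w. \<integral>\<^sup>+y. (\<lambda>(w, y). A w * ennreal (r1 y / pd w y)) (w, y) * ennreal (pd w y) \<partial>lam N \<partial>p2)"
  proof (rule nn_integral_W2_Y1)
    have "(\<lambda>(w, y). A w * ennreal (r1 y / pd w y)) \<in> borel_measurable (count_space UNIV \<Otimes>\<^sub>M OUT)"
      by (rule measurable_pair_measure_countable1) auto
    then show "(\<lambda>(w, y). A w * ennreal (r1 y / pd w y)) \<in> borel_measurable (p2 \<Otimes>\<^sub>M OUT)"
      by (subst measurable_cong_sets[OF sets_pair_measure_cong[OF sets_measure_pmf_count_space refl] refl])
  qed
  also have "\<dots> = (\<integral>\<^sup>+w. \<integral>\<^sup>+y. A w * ennreal (r1 y) \<partial>lam N \<partial>p2)"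
  proof (intro nn_integral_cong)
    fix w y assume "y \<in> space (lam N)"
    then have y: "y \<in> space OUT" by (simp add: space_lam)
    show "(\<lambda>(w, y). A w * ennreal (r1 y / pd w y)) (w, y) * ennreal (pd w y) = A w * ennreal (r1 y)"
      using ennreal_mult_divide_cancel[OF pd_pos[OF y, of w] r1pos(1)[OF y]] by (simp add: mult_ac)
  qed
  also have "\<dots> = (\<integral>\<^sup>+w. A w * (\<integral>\<^sup>+y. ennreal (r1 y) \<partial>lam N) \<partial>p2)"
    by (simp add: nn_integral_cmult)
  also have "\<dots> \<le> (\<integral>\<^sup>+w. A w * 1 \<partial>p2)" using r1pos by (intro nn_integral_mono mult_left_mono) auto
  also have "\<dots> \<le> 1" unfolding A_def using r2pos m2_pos by (simp only: mult_1_right) (intro avg_Ms_le, auto)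
  finally show ?thesis .
qed

end

end

section \<open>Single-letter Gaussian estimates\<close>

lemma nd_shift: "nd N c \<sigma> (shift N c z) = nd N (\<lambda>_. 0) \<sigma> z"
  unfolding nd_def by (intro prod.cong) (auto simp: shift_def normal_density_def)

lemma shift_space: "shift N c z \<in> space (out_space N)"
  by (auto simp: shift_def out_space_def space_PiM)

lemma nd_translate: "nd N (\<lambda>t. c t + d t) \<sigma> y = nd N c \<sigma> (shift N (\<lambda>t. - d t) y)"
  unfolding nd_def by (intro prod.cong) (auto simp: shift_def normal_density_def algebra_simps)

lemma ln_nd:
  assumes "0 < \<sigma>" shows "ln (nd N c \<sigma> y) = (\<Sum>t<N. ln (normal_density (c t) \<sigma> (y t)))"
proof -
  have "normal_density (c t) \<sigma> (y t) \<noteq> 0" for t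
    using normal_density_pos[OF assms] by (metis order_less_irrefl)
  then show ?thesis unfolding nd_def by (intro ln_prod) auto
qed

lemma ln_normal_density:
  assumes "0 < \<sigma>"
  shows "ln (normal_density \<mu> \<sigma> x) = - ln \<sigma> - ln (2 * pi) / 2 - (x - \<mu>)\<^sup>2 / (2 * \<sigma>\<^sup>2)"
proof -
  have "sqrt (2 * pi * \<sigma>\<^sup>2) = sqrt (2 * pi) * \<sigma>"
    using assms by (simp add: real_sqrt_mult)
  then show ?thesis
    using assms by (simp add: normal_density_def ln_mult ln_div ln_sqrt)
qed

lemma cauchy3:
  fixes a b c u v w :: real
  shows "(a * u + b * v + c * w)\<^sup>2 \<le> (a\<^sup>2 + b\<^sup>2 + c\<^sup>2) * (u\<^sup>2 + v\<^sup>2 + w\<^sup>2)"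
proof -
  have "0 \<le> (a * v - b * u)\<^sup>2 + (a * w - c * u)\<^sup>2 + (b * w - c * v)\<^sup>2" by simp
  then show ?thesis by (simp add: power2_eq_square algebra_simps)
qed

text \<open>Cauchy-Schwarz with the inputs measured in units of \<open>sqrt P\<close>. The cross
  term of the inputs has to be bounded, as cooperation may correlate them.\<close>

lemma received_power:
  fixes hD hC P x1 x2 z :: real
  assumes P: "0 < P"
  shows "(hD * x1 + hC * x2 + z)\<^sup>2 \<le> (hD\<^sup>2 * P + hC\<^sup>2 * P + 1) * (x1\<^sup>2 / P + x2\<^sup>2 / P + z\<^sup>2)"
proof -
  have s: "sqrt P * sqrt P = P" "sqrt P \<noteq> 0" "(sqrt P)\<^sup>2 = P" using P by auto
  have "(hD * sqrt P * (x1 / sqrt P) + hC * sqrt P * (x2 / sqrt P) + 1 * z)\<^sup>2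
     \<le> ((hD * sqrt P)\<^sup>2 + (hC * sqrt P)\<^sup>2 + 1\<^sup>2) * ((x1 / sqrt P)\<^sup>2 + (x2 / sqrt P)\<^sup>2 + z\<^sup>2)"
    by (rule cauchy3)
  then show ?thesis using s by (simp add: power_mult_distrib power_divide)
qed

lemma cancel_factor4: "0 < A \<Longrightarrow> A * B / (2 * (2 * A)) = B / (4::real)"
  by (simp add: field_simps)

text \<open>The reference deviation for both receivers. The factor 2 halves the noise share of the
  exponent: in \<open>two_letter_bound\<close> the available \<open>z1\<^sup>2 / 2\<close> must pay
  for two quadratic forms.\<close>

definition rsd :: "real \<Rightarrow> real \<Rightarrow> real \<Rightarrow> real" where
  "rsd hD hC P = sqrt (2 * (hD\<^sup>2 * P + hC\<^sup>2 * P + 1))"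

lemma rsd: assumes "0 < P" shows "1 \<le> rsd hD hC P" "(rsd hD hC P)\<^sup>2 = 2 * (hD\<^sup>2 * P + hC\<^sup>2 * P + 1)"
proof -
  have "0 \<le> hD\<^sup>2 * P" "0 \<le> hC\<^sup>2 * P" using assms by auto
  then show "1 \<le> rsd hD hC P" "(rsd hD hC P)\<^sup>2 = 2 * (hD\<^sup>2 * P + hC\<^sup>2 * P + 1)"
    unfolding rsd_def by auto
qed

lemma received_power_rsd:
  assumes P: "0 < P"
  shows "(hD * x1 + hC * x2 + z)\<^sup>2 / (2 * (rsd hD hC P)\<^sup>2) \<le> (x1\<^sup>2 + x2\<^sup>2) / (4 * P) + z\<^sup>2 / 4"
proof -
  have S: "0 < hD\<^sup>2 * P + hC\<^sup>2 * P + 1"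
    using P by (intro add_nonneg_pos add_nonneg_nonneg) auto
  have "(hD * x1 + hC * x2 + z)\<^sup>2 / (2 * (rsd hD hC P)\<^sup>2)
     \<le> (hD\<^sup>2 * P + hC\<^sup>2 * P + 1) * (x1\<^sup>2 / P + x2\<^sup>2 / P + z\<^sup>2) / (2 * (rsd hD hC P)\<^sup>2)"
    by (intro divide_right_mono received_power P) auto
  also have "\<dots> = (x1\<^sup>2 / P + x2\<^sup>2 / P + z\<^sup>2) / 4"
    unfolding rsd(2)[OF P] using S by (rule cancel_factor4)
  also have "\<dots> = (x1\<^sup>2 + x2\<^sup>2) / (4 * P) + z\<^sup>2 / 4"
    using P by (simp add: field_simps)
  finally show ?thesis .
qed

text \<open>The reference is wide enough that its noise term \<open>z\<^sup>2 / 4\<close> is covered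
  by the \<open>z\<^sup>2 / 2\<close> of the true density. Only input energies remain, and these are
  what the power constraint controls in expectation.\<close>

lemma single_letter_bound:
  assumes P: "0 < P" and y: "y = hD * x1 + hC * x2 + z" and e: "e = hD * x1 + hC * x2"
  shows "- ln (rsd hD hC P) - (x1\<^sup>2 + x2\<^sup>2) / (4 * P)
     \<le> ln (normal_density 0 (rsd hD hC P) y) - ln (normal_density e 1 y)"
proof -
  have "0 < rsd hD hC P" using rsd(1)[OF P, of hD hC] by linarith
  then have "ln (normal_density 0 (rsd hD hC P) y) - ln (normal_density e 1 y)
     = - ln (rsd hD hC P) - y\<^sup>2 / (2 * (rsd hD hC P)\<^sup>2) + z\<^sup>2 / 2"
    by (simp add: ln_normal_density y e)
  then show ?thesis
    using received_power_rsd[OF P, of hD x1 hC x2 z] zero_le_power2[of z] unfolding y by linarith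
qed

text \<open>Scaled by \<open>hD / hC\<close>, the observation \<open>s\<close> misses
  \<open>y2\<close> by \<open>z2 - hD / hC * z1\<close>, of variance
  \<open>1 + (hD / hC)\<^sup>2\<close>. As \<open>\<tau>\<close> doubles this variance, the
  quadratic form at receiver 2 uses at most \<open>(z1\<^sup>2 + z2\<^sup>2) / 4\<close> and that at
  receiver 1 another \<open>z1\<^sup>2 / 4\<close>, all covered by the exponents of the true
  densities.\<close>

lemma two_letter_bound:
  assumes P: "0 < P" and hC: "hC \<noteq> 0"
    and y1: "y1 = hD * x1 + hC * x2 + z1" and e1: "e1 = hD * x1 + hC * x2"
    and y2: "y2 = hD * x2 + z2" and e2: "e2 = hD * x2" and s: "s = hC * x2 + z1"
    and tau: "\<tau> = sqrt (2 * (1 + (hD / hC)\<^sup>2))"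
  shows "- ln (rsd hD hC P) - ln \<tau> - (x1\<^sup>2 + x2\<^sup>2) / (4 * P)
     \<le> ln (normal_density 0 (rsd hD hC P) y1) + ln (normal_density (hD / hC * s) \<tau> y2)
       - ln (normal_density e1 1 y1) - ln (normal_density e2 1 y2)"
proof -
  have r: "0 < rsd hD hC P" using rsd(1)[OF P, of hD hC] by linarith
  have pos: "0 < 1 + (hD / hC)\<^sup>2" by (intro add_pos_nonneg) auto
  have tau0: "0 < \<tau>" "\<tau>\<^sup>2 = 2 * (1 + (hD / hC)\<^sup>2)" unfolding tau using pos by auto
  have "y2 - hD / hC * s = z2 - hD / hC * z1"
    using hC by (simp add: y2 s field_simps)
  moreover have "(z2 - hD / hC * z1)\<^sup>2 \<le> (1 + (hD / hC)\<^sup>2) * (z1\<^sup>2 + z2\<^sup>2)"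
    using cauchy3[of 1 z2 "- (hD / hC)" z1 0 0] by (simp add: algebra_simps)
  then have "(z2 - hD / hC * z1)\<^sup>2 / (2 * \<tau>\<^sup>2) \<le> (1 + (hD / hC)\<^sup>2) * (z1\<^sup>2 + z2\<^sup>2) / (2 * \<tau>\<^sup>2)"
    by (intro divide_right_mono) auto
  moreover have "(1 + (hD / hC)\<^sup>2) * (z1\<^sup>2 + z2\<^sup>2) / (2 * \<tau>\<^sup>2) = (z1\<^sup>2 + z2\<^sup>2) / 4"
    unfolding tau0(2) using pos by (rule cancel_factor4)
  ultimately have k: "(y2 - hD / hC * s)\<^sup>2 / (2 * \<tau>\<^sup>2) \<le> (z1\<^sup>2 + z2\<^sup>2) / 4" by simp
  have q: "0 \<le> z1\<^sup>2" "0 \<le> z2\<^sup>2" by simp_all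
  have "0 \<le> z2\<^sup>2 / 4" by simp
  have d: "y1 - e1 = z1" "y2 - e2 = z2" by (simp_all add: y1 e1 y2 e2)
  have "ln (normal_density 0 (rsd hD hC P) y1) + ln (normal_density (hD / hC * s) \<tau> y2)
       - ln (normal_density e1 1 y1) - ln (normal_density e2 1 y2)
     = - ln (rsd hD hC P) - ln \<tau> - y1\<^sup>2 / (2 * (rsd hD hC P)\<^sup>2) - (y2 - hD / hC * s)\<^sup>2 / (2 * \<tau>\<^sup>2)
       + z1\<^sup>2 / 2 + z2\<^sup>2 / 2"
    using r tau0(1) by (simp add: ln_normal_density d)
  moreover have "y1\<^sup>2 / (2 * (rsd hD hC P)\<^sup>2) \<le> (x1\<^sup>2 + x2\<^sup>2) / (4 * P) + z1\<^sup>2 / 4"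
    unfolding y1 by (rule received_power_rsd[OF P])
  moreover have "a - b - X \<le> L" if "L = a - b - Y - K + p / 2 + q / 2" "Y \<le> X + p / 4" "K \<le> (p + q) / 4" "0 \<le> q"
    for a b L X Y K p q :: real
    using that by (simp add: field_simps)
  ultimately show ?thesis using k q(2) by blast
qed

section \<open>Removing the input of transmitter 1 and predicting the output at receiver 2\<close>

context cooperative_code
begin

definition Sv :: "nat \<times> nat \<times> real \<times> real \<times> (nat \<Rightarrow> real) \<times> (nat \<Rightarrow> real) \<Rightarrow> nat \<Rightarrow> real" where
  "Sv \<omega> = shift N (es (ib \<omega>)) (iz1 \<omega>)"

definition fs :: "(nat \<Rightarrow> real) \<Rightarrow> real" where
  "fs = mixd A2 N 1 es"

lemma measurable_es0: "(\<lambda>b. es b t) \<in> borel_measurable A2"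
  by (rule measurable_es) simp

lemma fs_pos: "y \<in> space OUT \<Longrightarrow> 0 < fs y"
  unfolding fs_def by (rule mixd_pos[OF prob_A2 order_refl measurable_es0])

lemma measurable_fs [measurable]: "fs \<in> borel_measurable OUT"
  unfolding fs_def by (rule measurable_mixd[OF prob_A2 order_refl measurable_es0])

lemma ennreal_fs: "y \<in> space OUT \<Longrightarrow> ennreal (fs y) = (\<integral>\<^sup>+b. ennreal (nd N (es b) 1 y) \<partial>A2)"
  unfolding fs_def by (rule ennreal_mixd[OF prob_A2 order_refl measurable_es0])

lemma measurable_nd_es: "y \<in> space OUT \<Longrightarrow> (\<lambda>b. ennreal (nd N (es b) 1 y)) \<in> borel_measurable A2"
  by (rule measurable_compose[OF measurable_nd[OF measurable_es0 measurable_const] measurable_ennreal])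

lemma nn_integral_fs_1: "(\<integral>\<^sup>+y. ennreal (fs y) \<partial>lam N) = 1"
  unfolding fs_def by (rule nn_integral_mixd_1[OF prob_A2 order_refl measurable_es0])

lemma measurable_Sv: "Sv \<in> measurable Om OUT"
  unfolding Sv_def[abs_def]
  by (rule measurable_shift[OF measurable_es[OF measurable_inputs(2)] measurable_inputs(3)])

lemma measurable_fs_Sv: "(\<lambda>\<omega>. fs (Sv \<omega>)) \<in> borel_measurable Om"
  by (rule measurable_compose[OF measurable_Sv measurable_fs])

text \<open>For fixed data of transmitter 1 and a fixed link word, the interference observation is a
  translate of \<open>Y1\<close> by a known vector.\<close>

lemma Sv_Y1: "Sv \<omega> = shift N (\<lambda>t. - (h_d * x1 (fst (ia \<omega>)) (snd (ia \<omega>)) t (\<lambda>s. lnk (fst (ib \<omega>)) (snd (ib \<omega>)) s))) (Y1 \<omega>)"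
  by (auto simp: Sv_def Y1_def shift_def e1_def es_def fun_eq_iff)

text \<open>If the link word were fixed, averaging over transmitter 2 would turn the density of the
  translated output into \<open>fs\<close>, which cancels the denominator. The word depends on
  transmitter 2, so one sums over all possible words; their number is the factor
  \<open>\<Prod>t<N. Lk t\<close> in the denominator.\<close>

lemma link_term:
  assumes g1[measurable]: "g1 \<in> measurable OUT (count_space UNIV)"
    and Lk: "\<And>w u t. t < N \<Longrightarrow> lnk w u t < Lk t"
  shows "(\<integral>\<^sup>+\<omega>. ennreal (Ms g1 m1 (W1 \<omega>) (Y1 \<omega>) * pbar (Y1 \<omega>) / (fs (Sv \<omega>) * (\<Prod>t<N. real (Lk t)))) \<partial>Om) \<le> 1"
proof -
  define c where "c = (\<Prod>t<N. real (Lk t))"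
  have Lk0: "0 < Lk t" if "t < N" for t using Lk[OF that, of 0 0] by simp
  have c: "0 < c" unfolding c_def using Lk0 by (intro prod_pos) auto
  define V where "V = Pi\<^sub>E {..<N} (\<lambda>t. {..<Lk t})"
  have finV: "finite V" unfolding V_def by (intro finite_PiE) auto
  have cardV: "real (card V) = c" unfolding V_def c_def by (simp add: card_PiE)
  define D where "D a ls t = - (h_d * x1 (fst a) (snd a) t ls)" for a :: "nat \<times> real" and ls t
  define G where "G a y = Ms g1 m1 (fst a) y * pbar y" for a :: "nat \<times> real" and y
  define K where "K a b y = ennreal (G a y / (fs (shift N (D a (lnk (fst b) (snd b))) y) * c))" for a b y
  have Gnn: "0 \<le> G a y" if "y \<in> space OUT" for a y
    using pbar_pos[OF that] by (simp add: G_def)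
  have MG[measurable]: "G a \<in> borel_measurable OUT" for a unfolding G_def[abs_def] by measurable
  have Mf[measurable]: "(\<lambda>y. fs (shift N d y)) \<in> borel_measurable OUT" for d
    by (rule measurable_compose[OF _ measurable_fs]) measurable
  have "(\<integral>\<^sup>+\<omega>. ennreal (Ms g1 m1 (W1 \<omega>) (Y1 \<omega>) * pbar (Y1 \<omega>) / (fs (Sv \<omega>) * c)) \<partial>Om)
     = (\<integral>\<^sup>+\<omega>. K (ia \<omega>) (ib \<omega>) (shift N (e1 (ia \<omega>) (ib \<omega>)) (iz1 \<omega>)) \<partial>Om)"
    unfolding Sv_Y1 by (simp add: K_def G_def D_def[abs_def] W1_def Y1_def)
  also have "\<dots> = (\<integral>\<^sup>+a. \<integral>\<^sup>+b. \<integral>\<^sup>+y1. ennreal (nd N (e1 a b) 1 y1) * K a b y1 \<partial>lam N \<partial>A2 \<partial>A1)"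
  proof (rule nn_integral_output1)
    show "K a b \<in> borel_measurable OUT" for a b unfolding K_def by measurable
    have "(\<lambda>\<omega>. ennreal (Ms g1 m1 (W1 \<omega>) (Y1 \<omega>) * pbar (Y1 \<omega>) / (fs (Sv \<omega>) * c))) \<in> borel_measurable Om"
      by (rule measurable_compose[OF borel_measurable_divide[OF borel_measurable_times[OF
          measurable_Ms[OF measurable_W(1) measurable_Y(1) g1] measurable_pbar_Y1]
          borel_measurable_times[OF measurable_fs_Sv borel_measurable_const]] measurable_ennreal])
    moreover have "(\<lambda>\<omega>. ennreal (Ms g1 m1 (W1 \<omega>) (Y1 \<omega>) * pbar (Y1 \<omega>) / (fs (Sv \<omega>) * c)))
       = (\<lambda>\<omega>. K (ia \<omega>) (ib \<omega>) (shift N (e1 (ia \<omega>) (ib \<omega>)) (iz1 \<omega>)))"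
      unfolding Sv_Y1 by (simp add: K_def G_def D_def[abs_def] W1_def Y1_def fun_eq_iff)
    ultimately show "(\<lambda>\<omega>. K (ia \<omega>) (ib \<omega>) (shift N (e1 (ia \<omega>) (ib \<omega>)) (iz1 \<omega>))) \<in> borel_measurable Om"
      by (simp only:)
  qed
  also have "\<dots> \<le> (\<integral>\<^sup>+a. \<integral>\<^sup>+y. ennreal (G a y) \<partial>lam N \<partial>A1)"
  proof (rule nn_integral_mono)
    fix a
    define R where "R v b y = ennreal (nd N (es b) 1 (shift N (D a v) y)) *
        ennreal (G a y / (fs (shift N (D a v) y) * c))" for v b y
    have RM: "(\<lambda>(b, y). R v b y) \<in> borel_measurable (A2 \<Otimes>\<^sub>M lam N)" for v
      unfolding R_def by measurable
    have RMb: "(\<lambda>b. \<integral>\<^sup>+y. R v b y \<partial>lam N) \<in> borel_measurable A2" for v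
      by (rule LA.borel_measurable_nn_integral) (rule RM)
    \<comment> \<open>The term of the actual link word is bounded by the sum over all words in
      \<open>V\<close>. In each summand the translation is independent of \<open>b\<close>, which is
      what makes the exchange of integrals produce \<open>fs\<close>.\<close>
    have "(\<integral>\<^sup>+b. \<integral>\<^sup>+y1. ennreal (nd N (e1 a b) 1 y1) * K a b y1 \<partial>lam N \<partial>A2)
       \<le> (\<integral>\<^sup>+b. (\<Sum>v\<in>V. \<integral>\<^sup>+y. R v b y \<partial>lam N) \<partial>A2)"
    proof (rule nn_integral_mono)
      fix b :: "nat \<times> real"
      define v where "v = restrict (lnk (fst b) (snd b)) {..<N}"
      have v: "v \<in> V" unfolding v_def V_def using Lk by auto
      \<comment> \<open>By causality the symbols from time \<open>N\<close> on do not influence the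
        block, so the word may be cut to \<open>{..<N}\<close> and lies in a finite set.\<close>
      have Dv: "D a (lnk (fst b) (snd b)) t = D a v t" if "t < N" for t
        unfolding D_def v_def using that by (intro arg_cong[where f="\<lambda>x. - (h_d * x)"] causal) auto
      then have sh: "shift N (D a (lnk (fst b) (snd b))) y = shift N (D a v) y" for y
        by (auto simp: shift_def fun_eq_iff)
      have nde: "nd N (e1 a b) 1 y = nd N (es b) 1 (shift N (D a v) y)" for y
      proof -
        have "e1 a b = (\<lambda>t. es b t + - D a (lnk (fst b) (snd b)) t)"
          by (auto simp: e1_def es_def D_def fun_eq_iff)
        then have "nd N (e1 a b) 1 y = nd N (es b) 1 (shift N (\<lambda>t. - (- D a (lnk (fst b) (snd b)) t)) y)"
          by (simp only: nd_translate)
        then show ?thesis by (simp add: sh)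
      qed
      have "(\<integral>\<^sup>+y1. ennreal (nd N (e1 a b) 1 y1) * K a b y1 \<partial>lam N) = (\<integral>\<^sup>+y. R v b y \<partial>lam N)"
        by (simp add: R_def K_def nde sh)
      also have "\<dots> \<le> (\<Sum>v\<in>V. \<integral>\<^sup>+y. R v b y \<partial>lam N)"
        by (rule member_le_sum[OF v _ finV]) simp
      finally show "(\<integral>\<^sup>+y1. ennreal (nd N (e1 a b) 1 y1) * K a b y1 \<partial>lam N) \<le> (\<Sum>v\<in>V. \<integral>\<^sup>+y. R v b y \<partial>lam N)" .
    qed
    also have "\<dots> = (\<Sum>v\<in>V. \<integral>\<^sup>+b. \<integral>\<^sup>+y. R v b y \<partial>lam N \<partial>A2)"
      by (rule nn_integral_sum) (rule RMb)
    also have "\<dots> = (\<Sum>v\<in>V. \<integral>\<^sup>+y. ennreal (G a y / c) \<partial>lam N)"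
    proof (rule sum.cong[OF refl])
      fix v
      interpret P: pair_sigma_finite A2 "lam N" ..
      have "(\<integral>\<^sup>+b. \<integral>\<^sup>+y. R v b y \<partial>lam N \<partial>A2) = (\<integral>\<^sup>+y. \<integral>\<^sup>+b. R v b y \<partial>A2 \<partial>lam N)"
        by (rule P.Fubini'[symmetric]) (rule RM)
      also have "\<dots> = (\<integral>\<^sup>+y. ennreal (fs (shift N (D a v) y)) * ennreal (G a y / (fs (shift N (D a v) y) * c)) \<partial>lam N)"
        unfolding R_def ennreal_fs[OF shift_space]
        by (intro nn_integral_cong nn_integral_multc measurable_nd_es shift_space)
      also have "\<dots> = (\<integral>\<^sup>+y. ennreal (G a y / c) \<partial>lam N)"
      proof (rule nn_integral_cong)
        fix y assume "y \<in> space (lam N)"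
        then have y: "y \<in> space OUT" by (simp add: space_lam)
        have "ennreal (fs (shift N (D a v) y)) * ennreal (G a y / c / fs (shift N (D a v) y)) = ennreal (G a y / c)"
          using Gnn[OF y, of a] c by (intro ennreal_mult_divide_cancel fs_pos shift_space) auto
        then show "ennreal (fs (shift N (D a v) y)) * ennreal (G a y / (fs (shift N (D a v) y) * c)) = ennreal (G a y / c)"
          by (simp add: mult.commute)
      qed
      finally show "(\<integral>\<^sup>+b. \<integral>\<^sup>+y. R v b y \<partial>lam N \<partial>A2) = (\<integral>\<^sup>+y. ennreal (G a y / c) \<partial>lam N)" .
    qed
    also have "\<dots> = ennreal c * (\<integral>\<^sup>+y. ennreal (G a y / c) \<partial>lam N)"
      by (simp add: ennreal_of_nat_eq_real_of_nat cardV)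
    also have "\<dots> = (\<integral>\<^sup>+y. ennreal c * ennreal (G a y / c) \<partial>lam N)"
      by (rule nn_integral_cmult[symmetric]) measurable
    also have "\<dots> = (\<integral>\<^sup>+y. ennreal (G a y) \<partial>lam N)"
      using c by (intro nn_integral_cong ennreal_mult_divide_cancel) (auto simp: space_lam intro: Gnn)
    finally show "(\<integral>\<^sup>+b. \<integral>\<^sup>+y1. ennreal (nd N (e1 a b) 1 y1) * K a b y1 \<partial>lam N \<partial>A2)
       \<le> (\<integral>\<^sup>+y. ennreal (G a y) \<partial>lam N)" .
  qed
  also have "\<dots> = (\<integral>\<^sup>+w. \<integral>\<^sup>+y. ennreal (Ms g1 m1 w y * pbar y) \<partial>lam N \<partial>p1)"
    unfolding G_def by (rule nn_integral_A1_fst)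
  also have "\<dots> \<le> 1"
  proof (rule avg_Ms_le)
    show "0 \<le> pbar y" if "y \<in> space OUT" for y using pbar_pos[OF that] by (rule less_imp_le)
    show "(\<integral>\<^sup>+y. ennreal (pbar y) \<partial>lam N) \<le> 1" by (simp add: nn_integral_pbar_1)
  qed (use m1_pos g1 measurable_pbar in auto)
  finally show ?thesis unfolding c_def .
qed

text \<open>The law of \<open>\<rho>\<close> times the interference observation plus independent
  Gaussian noise of deviation \<open>\<tau>\<close>: a reference for \<open>Y2\<close> generated
  from what receiver 1 sees.\<close>

definition r2 :: "real \<Rightarrow> real \<Rightarrow> (nat \<Rightarrow> real) \<Rightarrow> real" where
  "r2 \<rho> \<tau> = mixd (density (lam N) (\<lambda>s. ennreal (fs s))) N \<tau> (\<lambda>s t. \<rho> * s t)"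

lemma prob_fs: "prob_space (density (lam N) (\<lambda>s. ennreal (fs s)))"
  by (rule prob_spaceI) (simp add: emeasure_density nn_integral_fs_1 cong: nn_integral_cong)

lemma measurable_scale: "t < N \<Longrightarrow> (\<lambda>s. \<rho> * s t) \<in> borel_measurable (density (lam N) (\<lambda>s. ennreal (fs s)))"
  by measurable

lemma r2_props:
  assumes "1 \<le> \<tau>"
  shows "\<And>y. y \<in> space OUT \<Longrightarrow> 0 < r2 \<rho> \<tau> y" and "r2 \<rho> \<tau> \<in> borel_measurable OUT"
    and "(\<integral>\<^sup>+y. ennreal (r2 \<rho> \<tau> y) \<partial>lam N) = 1"
    and "\<And>y. y \<in> space OUT \<Longrightarrow> (\<integral>\<^sup>+s. ennreal (fs s) * ennreal (nd N (\<lambda>t. \<rho> * s t) \<tau> y) \<partial>lam N) = ennreal (r2 \<rho> \<tau> y)"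
proof -
  show "\<And>y. y \<in> space OUT \<Longrightarrow> 0 < r2 \<rho> \<tau> y"
    unfolding r2_def by (rule mixd_pos[OF prob_fs assms measurable_scale])
  show "r2 \<rho> \<tau> \<in> borel_measurable OUT"
    unfolding r2_def by (rule measurable_mixd[OF prob_fs assms measurable_scale])
  show "(\<integral>\<^sup>+y. ennreal (r2 \<rho> \<tau> y) \<partial>lam N) = 1"
    unfolding r2_def by (rule nn_integral_mixd_1[OF prob_fs assms measurable_scale])
  fix y assume y: "y \<in> space OUT"
  have "(\<lambda>s. ennreal (nd N (\<lambda>t. \<rho> * s t) \<tau> y)) \<in> borel_measurable (lam N)"
    by (rule measurable_compose[OF measurable_nd measurable_ennreal]) (use y in measurable)
  then have "(\<integral>\<^sup>+s. ennreal (nd N (\<lambda>t. \<rho> * s t) \<tau> y) \<partial>density (lam N) (\<lambda>s. ennreal (fs s)))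
     = (\<integral>\<^sup>+s. ennreal (fs s) * ennreal (nd N (\<lambda>t. \<rho> * s t) \<tau> y) \<partial>lam N)"
    by (intro nn_integral_density) auto
  moreover have "ennreal (r2 \<rho> \<tau> y) = (\<integral>\<^sup>+s. ennreal (nd N (\<lambda>t. \<rho> * s t) \<tau> y) \<partial>density (lam N) (\<lambda>s. ennreal (fs s)))"
    unfolding r2_def by (rule ennreal_mixd[OF prob_fs assms _ y]) (rule measurable_scale)
  ultimately show "(\<integral>\<^sup>+s. ennreal (fs s) * ennreal (nd N (\<lambda>t. \<rho> * s t) \<tau> y) \<partial>lam N) = ennreal (r2 \<rho> \<tau> y)"
    by simp
qed

lemma measurable_k_out: "(\<lambda>\<omega>. nd N (\<lambda>t. \<rho> * Sv \<omega> t) \<tau> (Y2 \<omega>)) \<in> borel_measurable Om"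
  by (rule measurable_nd[OF borel_measurable_times[OF borel_measurable_const
      measurable_compose[OF measurable_Sv measurable_out_space_component]] measurable_Y(2)])

text \<open>By Bayes' rule \<open>fs s * nd N (\<lambda>t. \<rho> * s t) \<tau> y / r2 \<rho> \<tau>
  y\<close> is a posterior density in \<open>s\<close>. Given transmitter 2 the observation and
  \<open>Y2\<close> are independent, so the true densities cancel or integrate to 1 and the
  posterior integrates to 1 for each \<open>y\<close>.\<close>

lemma smoothing_term:
  assumes tau: "1 \<le> \<tau>"
  shows "(\<integral>\<^sup>+\<omega>. ennreal (fs (Sv \<omega>) * nd N (\<lambda>t. \<rho> * Sv \<omega> t) \<tau> (Y2 \<omega>) /
     (r2 \<rho> \<tau> (Y2 \<omega>) * nd N (es (ib \<omega>)) 1 (Sv \<omega>))) \<partial>Om) \<le> 1"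
proof -
  note r2p = r2_props[OF tau, where \<rho>=\<rho>]
  note r2p(2)[measurable]
  let ?K = "\<lambda>(a::nat \<times> real) b s y. ennreal (fs s * nd N (\<lambda>t. \<rho> * s t) \<tau> y / (r2 \<rho> \<tau> y * nd N (es b) 1 s))"
  have kM[measurable]: "(\<lambda>(s, y). nd N (\<lambda>t. \<rho> * s t) \<tau> y) \<in> borel_measurable (OUT \<Otimes>\<^sub>M OUT)"
    by measurable
  have "(\<integral>\<^sup>+\<omega>. ennreal (fs (Sv \<omega>) * nd N (\<lambda>t. \<rho> * Sv \<omega> t) \<tau> (Y2 \<omega>) /
     (r2 \<rho> \<tau> (Y2 \<omega>) * nd N (es (ib \<omega>)) 1 (Sv \<omega>))) \<partial>Om)
    = (\<integral>\<^sup>+\<omega>. ?K (ia \<omega>) (ib \<omega>) (shift N ((\<lambda>a b. es b) (ia \<omega>) (ib \<omega>)) (iz1 \<omega>)) (Y2 \<omega>) \<partial>Om)"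
    by (simp add: Sv_def)
  also have "\<dots> = (\<integral>\<^sup>+a. \<integral>\<^sup>+b. \<integral>\<^sup>+s. \<integral>\<^sup>+y2. ennreal (nd N ((\<lambda>a b. es b) a b) 1 s) * (ennreal (nd N (e2 b) 1 y2) * ?K a b s y2)
        \<partial>lam N \<partial>lam N \<partial>A2 \<partial>A1)"
  proof (rule nn_integral_outputs)
    show "(\<lambda>p. ?K a b (fst p) (snd p)) \<in> borel_measurable (OUT \<Otimes>\<^sub>M OUT)" for a b by measurable
    have "(\<lambda>\<omega>. ennreal (fs (Sv \<omega>) * nd N (\<lambda>t. \<rho> * Sv \<omega> t) \<tau> (Y2 \<omega>) /
       (r2 \<rho> \<tau> (Y2 \<omega>) * nd N (es (ib \<omega>)) 1 (Sv \<omega>)))) \<in> borel_measurable Om"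
      by (rule measurable_compose[OF borel_measurable_divide[OF borel_measurable_times[OF
          measurable_fs_Sv measurable_k_out] borel_measurable_times[OF measurable_compose[OF measurable_Y(2) r2p(2)]
            measurable_nd[OF measurable_es[OF measurable_inputs(2)] measurable_Sv]]] measurable_ennreal])
    from this[unfolded Sv_def] show "(\<lambda>\<omega>. ?K (ia \<omega>) (ib \<omega>) (shift N ((\<lambda>a b. es b) (ia \<omega>) (ib \<omega>)) (iz1 \<omega>)) (Y2 \<omega>)) \<in> borel_measurable Om" .
  qed
  also have "\<dots> = (\<integral>\<^sup>+a. \<integral>\<^sup>+b. 1 \<partial>A2 \<partial>A1)"
  proof (intro nn_integral_cong)
    fix b :: "nat \<times> real"
    interpret P: pair_sigma_finite "lam N" "lam N" ..
    have "(\<integral>\<^sup>+s. \<integral>\<^sup>+y2. ennreal (nd N ((\<lambda>a b. es b) undefined b) 1 s) * (ennreal (nd N (e2 b) 1 y2) * ?K undefined b s y2) \<partial>lam N \<partial>lam N)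
       = (\<integral>\<^sup>+s. \<integral>\<^sup>+y2. ennreal (nd N (e2 b) 1 y2 / r2 \<rho> \<tau> y2) * (ennreal (fs s) * ennreal (nd N (\<lambda>t. \<rho> * s t) \<tau> y2)) \<partial>lam N \<partial>lam N)"
    proof (intro nn_integral_cong)
      fix s y2 assume "s \<in> space (lam N)" "y2 \<in> space (lam N)"
      then have sy: "s \<in> space OUT" "y2 \<in> space OUT" by (simp_all add: space_lam)
      have n: "0 < nd N (es b) 1 s" "0 \<le> nd N (e2 b) 1 y2" "0 < r2 \<rho> \<tau> y2" "0 < fs s" "0 \<le> nd N (\<lambda>t. \<rho> * s t) \<tau> y2"
        using nd_pos r2p(1)[OF sy(2)] fs_pos[OF sy(1)] by auto
      have "ennreal (nd N (es b) 1 s) * (ennreal (nd N (e2 b) 1 y2) * ?K undefined b s y2)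
         = ennreal (nd N (es b) 1 s * (nd N (e2 b) 1 y2 * (fs s * nd N (\<lambda>t. \<rho> * s t) \<tau> y2 / (r2 \<rho> \<tau> y2 * nd N (es b) 1 s))))"
        using n by (subst ennreal_mult, simp, simp, subst ennreal_mult) auto
      also have "nd N (es b) 1 s * (nd N (e2 b) 1 y2 * (fs s * nd N (\<lambda>t. \<rho> * s t) \<tau> y2 / (r2 \<rho> \<tau> y2 * nd N (es b) 1 s)))
         = (nd N (e2 b) 1 y2 / r2 \<rho> \<tau> y2) * (fs s * nd N (\<lambda>t. \<rho> * s t) \<tau> y2)"
        using n by (simp add: field_simps)
      also have "ennreal \<dots> = ennreal (nd N (e2 b) 1 y2 / r2 \<rho> \<tau> y2) * (ennreal (fs s) * ennreal (nd N (\<lambda>t. \<rho> * s t) \<tau> y2))"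
        using n by (subst ennreal_mult, simp, simp, subst ennreal_mult) auto
      finally show "ennreal (nd N ((\<lambda>a b. es b) undefined b) 1 s) * (ennreal (nd N (e2 b) 1 y2) * ?K undefined b s y2)
        = ennreal (nd N (e2 b) 1 y2 / r2 \<rho> \<tau> y2) * (ennreal (fs s) * ennreal (nd N (\<lambda>t. \<rho> * s t) \<tau> y2))" .
    qed
    also have "\<dots> = (\<integral>\<^sup>+y2. \<integral>\<^sup>+s. ennreal (nd N (e2 b) 1 y2 / r2 \<rho> \<tau> y2) * (ennreal (fs s) * ennreal (nd N (\<lambda>t. \<rho> * s t) \<tau> y2)) \<partial>lam N \<partial>lam N)"
      by (rule P.Fubini'[symmetric]) measurable
    also have "\<dots> = (\<integral>\<^sup>+y2. ennreal (nd N (e2 b) 1 y2) \<partial>lam N)"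
    proof (rule nn_integral_cong)
      fix y2 assume "y2 \<in> space (lam N)"
      then have y2: "y2 \<in> space OUT" by (simp add: space_lam)
      have [measurable]: "(\<lambda>s. nd N (\<lambda>t. \<rho> * s t) \<tau> y2) \<in> borel_measurable OUT"
        by (rule measurable_nd) (use y2 in measurable)
      have "(\<integral>\<^sup>+s. ennreal (nd N (e2 b) 1 y2 / r2 \<rho> \<tau> y2) * (ennreal (fs s) * ennreal (nd N (\<lambda>t. \<rho> * s t) \<tau> y2)) \<partial>lam N)
         = ennreal (nd N (e2 b) 1 y2 / r2 \<rho> \<tau> y2) * (\<integral>\<^sup>+s. ennreal (fs s) * ennreal (nd N (\<lambda>t. \<rho> * s t) \<tau> y2) \<partial>lam N)"
        by (rule nn_integral_cmult) measurable
      also have "\<dots> = ennreal (nd N (e2 b) 1 y2)"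
        unfolding r2p(4)[OF y2] using ennreal_mult_divide_cancel[OF r2p(1)[OF y2] nd_nonneg[of N "e2 b" 1 y2]]
        by (simp add: mult.commute)
      finally show "(\<integral>\<^sup>+s. ennreal (nd N (e2 b) 1 y2 / r2 \<rho> \<tau> y2) * (ennreal (fs s) * ennreal (nd N (\<lambda>t. \<rho> * s t) \<tau> y2)) \<partial>lam N)
         = ennreal (nd N (e2 b) 1 y2)" .
    qed
    also have "\<dots> = 1" by (rule nn_integral_nd) simp
    finally show "(\<integral>\<^sup>+s. \<integral>\<^sup>+y2. ennreal (nd N ((\<lambda>a b. es b) undefined b) 1 s) * (ennreal (nd N (e2 b) 1 y2) * ?K undefined b s y2) \<partial>lam N \<partial>lam N) = 1" .
  qed
  also have "\<dots> = 1" by (simp add: A1.emeasure_space_1 A2.emeasure_space_1)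
  finally show ?thesis by simp
qed

end

text \<open>Integrability is demanded of \<open>F\<close> alone, the explicit lower bound of the
  logarithms; the logarithms of the individual ratios are never integrated.\<close>

lemma (in prob_space) expectation_nonpos_of_log_bound:
  fixes F G :: "'a \<Rightarrow> real"
  assumes F: "integrable M F" and G: "G \<in> borel_measurable M" "\<And>\<omega>. \<omega> \<in> space M \<Longrightarrow> 0 \<le> G \<omega>"
    and G1: "(\<integral>\<^sup>+\<omega>. ennreal (G \<omega>) \<partial>M) \<le> ennreal k" "0 \<le> k"
    and le: "\<And>\<omega>. \<omega> \<in> space M \<Longrightarrow> F \<omega> \<le> G \<omega> - k"
  shows "expectation F \<le> 0"
proof -
  note GI = nn_integral_bound_real[OF G G1]
  have "expectation F \<le> expectation (\<lambda>\<omega>. G \<omega> - k)"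
    using F GI le by (intro integral_mono) auto
  also have "\<dots> = expectation G - k" using GI by (simp add: prob_space)
  finally show ?thesis using GI by simp
qed

lemma nn_integral_add3:
  fixes f g h :: "'a \<Rightarrow> real"
  assumes [measurable]: "f \<in> borel_measurable M" "g \<in> borel_measurable M" "h \<in> borel_measurable M"
    and "\<And>x. x \<in> space M \<Longrightarrow> 0 \<le> f x" "\<And>x. x \<in> space M \<Longrightarrow> 0 \<le> g x" "\<And>x. x \<in> space M \<Longrightarrow> 0 \<le> h x"
  shows "(\<integral>\<^sup>+x. ennreal (f x + g x + h x) \<partial>M) = (\<integral>\<^sup>+x. ennreal (f x) \<partial>M) + (\<integral>\<^sup>+x. ennreal (g x) \<partial>M) + (\<integral>\<^sup>+x. ennreal (h x) \<partial>M)"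
proof -
  have "(\<integral>\<^sup>+x. ennreal (f x + g x + h x) \<partial>M) = (\<integral>\<^sup>+x. ennreal (f x) + ennreal (g x) + ennreal (h x) \<partial>M)"
    using assms by (intro nn_integral_cong) (simp add: ennreal_plus)
  then show ?thesis by (simp add: nn_integral_add)
qed

section \<open>Converse bounds for a fixed code\<close>

context cooperative_code
begin

definition "X1f \<omega> t = x1 (fst (ia \<omega>)) (snd (ia \<omega>)) t (\<lambda>s. lnk (fst (ib \<omega>)) (snd (ib \<omega>)) s)"
definition "X2f \<omega> t = x2 (fst (ib \<omega>)) (snd (ib \<omega>)) t"

text \<open>For \<open>m = 1\<close> the weight \<open>Ms\<close> is 1 at a correct decision and one
  half at an error, so measurability of the weight is measurability of the event.\<close>

lemma error_event_measurable:
  assumes "(\<lambda>\<omega>. Ms g 1 (W \<omega>) (Y \<omega>)) \<in> borel_measurable Om"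
  shows "{\<omega> \<in> space Om. g (Y \<omega>) \<noteq> W \<omega>} \<in> sets Om"
proof -
  have "{\<omega> \<in> space Om. g (Y \<omega>) \<noteq> W \<omega>} = {\<omega> \<in> space Om. Ms g 1 (W \<omega>) (Y \<omega>) < 1}"
    by (auto simp: Ms_def)
  also have "\<dots> \<in> sets Om" by (rule borel_measurable_less[OF assms borel_measurable_const])
  finally show ?thesis .
qed

context
  fixes g1 g2 :: "(nat \<Rightarrow> real) \<Rightarrow> nat" and P eps :: real
  assumes g1: "g1 \<in> measurable OUT (count_space UNIV)"
    and g2: "g2 \<in> measurable OUT (count_space UNIV)"
    and P: "0 < P"
    and pow1: "\<And>t. t < N \<Longrightarrow> integrable Om (\<lambda>\<omega>. (X1f \<omega> t)\<^sup>2)" "\<And>t. t < N \<Longrightarrow> integral\<^sup>L Om (\<lambda>\<omega>. (X1f \<omega> t)\<^sup>2) \<le> P"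
    and pow2: "\<And>t. t < N \<Longrightarrow> integrable Om (\<lambda>\<omega>. (X2f \<omega> t)\<^sup>2)" "\<And>t. t < N \<Longrightarrow> integral\<^sup>L Om (\<lambda>\<omega>. (X2f \<omega> t)\<^sup>2) \<le> P"
    and err1: "measure Om {\<omega> \<in> space Om. g1 (Y1 \<omega>) \<noteq> W1 \<omega>} \<le> eps"
    and err2: "measure Om {\<omega> \<in> space Om. g2 (Y2 \<omega>) \<noteq> W2 \<omega>} \<le> eps"
begin

definition "E1 = {\<omega> \<in> space Om. g1 (Y1 \<omega>) \<noteq> W1 \<omega>}"
definition "E2 = {\<omega> \<in> space Om. g2 (Y2 \<omega>) \<noteq> W2 \<omega>}"
definition "En \<omega> = (\<Sum>t<N. ((X1f \<omega> t)\<^sup>2 + (X2f \<omega> t)\<^sup>2) / (4 * P))"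

lemma E_sets: "E1 \<in> sets Om" "E2 \<in> sets Om"
  unfolding E1_def E2_def
  by (rule error_event_measurable[OF measurable_Ms[OF measurable_W(1) measurable_Y(1) g1]])
     (rule error_event_measurable[OF measurable_Ms[OF measurable_W(2) measurable_Y(2) g2]])

lemma En_integrable: "integrable Om En"
  unfolding En_def[abs_def]
  by (intro Bochner_Integration.integrable_sum Bochner_Integration.integrable_divide Bochner_Integration.integrable_add)
     (auto intro: pow1(1) pow2(1))

lemma ind_integrable: "integrable Om (\<lambda>\<omega>. 1 - indicator E1 \<omega> :: real)" "integrable Om (\<lambda>\<omega>. 1 - indicator E2 \<omega> :: real)"
  using E_sets by (auto intro!: Bochner_Integration.integrable_diff integrable_real_indicator simp: less_top[symmetric])

lemma ind_integral:
  "integral\<^sup>L Om (\<lambda>\<omega>. 1 - indicator E1 \<omega>) = 1 - measure Om E1"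
  "integral\<^sup>L Om (\<lambda>\<omega>. 1 - indicator E2 \<omega>) = 1 - measure Om E2"
  using E_sets by (auto simp: Om.prob_space less_top[symmetric] integrable_real_indicator)

lemma En_integral: "integral\<^sup>L Om En \<le> N / 2"
proof -
  have "integral\<^sup>L Om En = (\<Sum>t<N. (integral\<^sup>L Om (\<lambda>\<omega>. (X1f \<omega> t)\<^sup>2) + integral\<^sup>L Om (\<lambda>\<omega>. (X2f \<omega> t)\<^sup>2)) / (4 * P))"
    unfolding En_def[abs_def] using pow1(1) pow2(1)
    by (subst Bochner_Integration.integral_sum) (auto intro!: sum.cong)
  also have "\<dots> \<le> (\<Sum>t<N. (P + P) / (4 * P))"
    using P pow1(2) pow2(2) by (intro sum_mono divide_right_mono add_mono) auto
  also have "\<dots> = N / 2" using P by simp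
  finally show ?thesis .
qed

abbreviation "\<sigma> \<equiv> rsd h_d h_c P"

lemma \<sigma>: "1 \<le> \<sigma>" "0 < \<sigma>" using rsd(1)[OF P, of h_d h_c] by auto

lemma measurable_r_out:
  "(\<lambda>\<omega>. nd N (\<lambda>_. 0) \<sigma> (Y1 \<omega>)) \<in> borel_measurable Om"
  "(\<lambda>\<omega>. nd N (\<lambda>_. 0) \<sigma> (Y2 \<omega>)) \<in> borel_measurable Om"
  by (rule measurable_nd[OF borel_measurable_const measurable_Y(1)])
     (rule measurable_nd[OF borel_measurable_const measurable_Y(2)])

lemma measurable_r: "nd N (\<lambda>_. 0) \<sigma> \<in> borel_measurable OUT"
  by (rule measurable_nd) auto

lemma Y1_coord: "t < N \<Longrightarrow> Y1 \<omega> t = h_d * X1f \<omega> t + h_c * X2f \<omega> t + iz1 \<omega> t"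
  by (simp add: Y1_def shift_def e1_def X1f_def X2f_def)

lemma Y2_coord: "t < N \<Longrightarrow> Y2 \<omega> t = h_d * X2f \<omega> t + iz2 \<omega> t"
  by (simp add: Y2_def shift_def e2_def X2f_def)

lemma Sv_coord: "t < N \<Longrightarrow> Sv \<omega> t = h_c * X2f \<omega> t + iz1 \<omega> t"
  by (simp add: Sv_def shift_def es_def X2f_def)

text \<open>\<open>?F\<close> bounds \<open>ln ?G\<close> from below and contains only the decoding
  event and the transmit energy, whose expectations are known; \<open>ln ?G \<le> ?G - 1\<close> and
  \<open>single_user1\<close> bound it from above.\<close>

lemma converse_user1: "(1 - eps) * ln m1 \<le> ln 2 + N * (ln \<sigma> + 1 / 2)"
proof -
  let ?F = "\<lambda>\<omega>. ln m1 * (1 - indicator E1 \<omega>) - ln 2 - N * ln \<sigma> - En \<omega>"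
  let ?G = "\<lambda>\<omega>. Ms g1 m1 (W1 \<omega>) (Y1 \<omega>) * nd N (\<lambda>_. 0) \<sigma> (Y1 \<omega>) / nd N (e1 (ia \<omega>) (ib \<omega>)) 1 (Y1 \<omega>)"
  have FI: "integrable Om ?F" using ind_integrable En_integrable by (intro Bochner_Integration.integrable_diff) auto
  have "Om.expectation ?F \<le> 0"
  proof (rule Om.expectation_nonpos_of_log_bound[OF FI, of ?G 1])
    show "?G \<in> borel_measurable Om"
      by (rule borel_measurable_divide[OF borel_measurable_times[OF
          measurable_Ms[OF measurable_W(1) measurable_Y(1) g1] measurable_r_out(1)] measurable_eout(1)])
    show "(\<integral>\<^sup>+\<omega>. ennreal (?G \<omega>) \<partial>Om) \<le> ennreal 1"
      using single_user1[OF g1 g2 measurable_r] \<sigma> by (simp add: nn_integral_nd)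
    fix \<omega> assume w: "\<omega> \<in> space Om"
    have n: "0 < nd N (\<lambda>_. 0) \<sigma> (Y1 \<omega>)" "0 < nd N (e1 (ia \<omega>) (ib \<omega>)) 1 (Y1 \<omega>)"
      using \<sigma> by (auto intro: nd_pos)
    show "0 \<le> ?G \<omega>" by (intro divide_nonneg_nonneg mult_nonneg_nonneg Ms_nonneg nd_nonneg)
    have "- real N * ln \<sigma> - En \<omega> = (\<Sum>t<N. - ln \<sigma> - ((X1f \<omega> t)\<^sup>2 + (X2f \<omega> t)\<^sup>2) / (4 * P))"
      by (simp add: En_def sum_subtractf)
    also have "\<dots> \<le> (\<Sum>t<N. ln (normal_density 0 \<sigma> (Y1 \<omega> t)) - ln (normal_density (e1 (ia \<omega>) (ib \<omega>) t) 1 (Y1 \<omega> t)))"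
      by (intro sum_mono single_letter_bound[OF P]) (auto simp: Y1_coord e1_def X1f_def X2f_def)
    also have "\<dots> = ln (nd N (\<lambda>_. 0) \<sigma> (Y1 \<omega>)) - ln (nd N (e1 (ia \<omega>) (ib \<omega>)) 1 (Y1 \<omega>))"
      using \<sigma> by (simp add: ln_nd sum_subtractf)
    finally have 1: "- real N * ln \<sigma> - En \<omega> \<le> \<dots>" .
    have 2: "ln m1 * (1 - indicator E1 \<omega>) - ln 2 \<le> ln (Ms g1 m1 (W1 \<omega>) (Y1 \<omega>))"
      using ln_Ms[OF m1_pos, of g1 "Y1 \<omega>" "W1 \<omega>"] w by (auto simp: E1_def indicator_def split: if_splits)
    have "ln (?G \<omega>) = ln (Ms g1 m1 (W1 \<omega>) (Y1 \<omega>)) + ln (nd N (\<lambda>_. 0) \<sigma> (Y1 \<omega>)) - ln (nd N (e1 (ia \<omega>) (ib \<omega>)) 1 (Y1 \<omega>))"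
      using n Ms_pos[of g1 m1 "W1 \<omega>" "Y1 \<omega>"] by (simp add: ln_mult ln_div)
    moreover have "ln (?G \<omega>) \<le> ?G \<omega> - 1"
      by (intro ln_le_minus_one divide_pos_pos mult_pos_pos n Ms_pos)
    ultimately show "?F \<omega> \<le> ?G \<omega> - 1" using 1 2 by linarith
  qed simp
  moreover have "Om.expectation ?F = ln m1 * (1 - measure Om E1) - ln 2 - N * ln \<sigma> - integral\<^sup>L Om En"
    using ind_integrable En_integrable by (simp add: Om.prob_space ind_integral)
  moreover have "ln m1 * (1 - eps) \<le> ln m1 * (1 - measure Om E1)"
    using err1 m1_pos unfolding E1_def by (intro mult_left_mono) auto
  ultimately have "ln m1 * (1 - eps) \<le> ln 2 + N * ln \<sigma> + N / 2" using En_integral by linarith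
  then show ?thesis by (simp add: algebra_simps)
qed

lemma converse_user2: "(1 - eps) * ln m2 \<le> ln 2 + N * (ln \<sigma> + 1 / 2)"
proof -
  let ?F = "\<lambda>\<omega>. ln m2 * (1 - indicator E2 \<omega>) - ln 2 - N * ln \<sigma> - En \<omega>"
  let ?G = "\<lambda>\<omega>. Ms g2 m2 (W2 \<omega>) (Y2 \<omega>) * nd N (\<lambda>_. 0) \<sigma> (Y2 \<omega>) / nd N (e2 (ib \<omega>)) 1 (Y2 \<omega>)"
  have FI: "integrable Om ?F" using ind_integrable En_integrable by (intro Bochner_Integration.integrable_diff) auto
  have "Om.expectation ?F \<le> 0"
  proof (rule Om.expectation_nonpos_of_log_bound[OF FI, of ?G 1])
    show "?G \<in> borel_measurable Om"
      by (rule borel_measurable_divide[OF borel_measurable_times[OF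
          measurable_Ms[OF measurable_W(2) measurable_Y(2) g2] measurable_r_out(2)] measurable_eout(2)])
    show "(\<integral>\<^sup>+\<omega>. ennreal (?G \<omega>) \<partial>Om) \<le> ennreal 1"
      using single_user2[OF g1 g2 measurable_r] \<sigma> by (simp add: nn_integral_nd)
    fix \<omega> assume w: "\<omega> \<in> space Om"
    have n: "0 < nd N (\<lambda>_. 0) \<sigma> (Y2 \<omega>)" "0 < nd N (e2 (ib \<omega>)) 1 (Y2 \<omega>)"
      using \<sigma> by (auto intro: nd_pos)
    show "0 \<le> ?G \<omega>" by (intro divide_nonneg_nonneg mult_nonneg_nonneg Ms_nonneg nd_nonneg)
    have "- real N * ln \<sigma> - En \<omega> = (\<Sum>t<N. - ln \<sigma> - ((X1f \<omega> t)\<^sup>2 + (X2f \<omega> t)\<^sup>2) / (4 * P))"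
      by (simp add: En_def sum_subtractf)
    \<comment> \<open>Receiver 2 hears only transmitter 2. Dropping the other energy lets
      \<open>single_letter_bound\<close> apply with second input 0 while \<open>\<sigma>\<close> and
      \<open>En\<close> are shared with user 1.\<close>
    also have "\<dots> \<le> (\<Sum>t<N. - ln \<sigma> - ((X2f \<omega> t)\<^sup>2 + 0\<^sup>2) / (4 * P))"
      using P by (intro sum_mono diff_left_mono divide_right_mono) auto
    also have "\<dots> \<le> (\<Sum>t<N. ln (normal_density 0 \<sigma> (Y2 \<omega> t)) - ln (normal_density (e2 (ib \<omega>) t) 1 (Y2 \<omega> t)))"
      by (intro sum_mono single_letter_bound[OF P]) (auto simp: Y2_coord e2_def X2f_def)
    also have "\<dots> = ln (nd N (\<lambda>_. 0) \<sigma> (Y2 \<omega>)) - ln (nd N (e2 (ib \<omega>)) 1 (Y2 \<omega>))"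
      using \<sigma> by (simp add: ln_nd sum_subtractf)
    finally have 1: "- real N * ln \<sigma> - En \<omega> \<le> \<dots>" .
    have 2: "ln m2 * (1 - indicator E2 \<omega>) - ln 2 \<le> ln (Ms g2 m2 (W2 \<omega>) (Y2 \<omega>))"
      using ln_Ms[OF m2_pos, of g2 "Y2 \<omega>" "W2 \<omega>"] w by (auto simp: E2_def indicator_def split: if_splits)
    have "ln (?G \<omega>) = ln (Ms g2 m2 (W2 \<omega>) (Y2 \<omega>)) + ln (nd N (\<lambda>_. 0) \<sigma> (Y2 \<omega>)) - ln (nd N (e2 (ib \<omega>)) 1 (Y2 \<omega>))"
      using n Ms_pos[of g2 m2 "W2 \<omega>" "Y2 \<omega>"] by (simp add: ln_mult ln_div)
    moreover have "ln (?G \<omega>) \<le> ?G \<omega> - 1"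
      by (intro ln_le_minus_one divide_pos_pos mult_pos_pos n Ms_pos)
    ultimately show "?F \<omega> \<le> ?G \<omega> - 1" using 1 2 by linarith
  qed simp
  moreover have "Om.expectation ?F = ln m2 * (1 - measure Om E2) - ln 2 - N * ln \<sigma> - integral\<^sup>L Om En"
    using ind_integrable En_integrable by (simp add: Om.prob_space ind_integral)
  moreover have "ln m2 * (1 - eps) \<le> ln m2 * (1 - measure Om E2)"
    using err2 m2_pos unfolding E2_def by (intro mult_left_mono) auto
  ultimately have "ln m2 * (1 - eps) \<le> ln 2 + N * ln \<sigma> + N / 2" using En_integral by linarith
  then show ?thesis by (simp add: algebra_simps)
qed

text \<open>The unknown output densities cancel in the product of the three ratios, so that its
  logarithm is explicit; only the leakage term survives.\<close>

lemma converse_sum: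
  assumes hc: "h_c \<noteq> 0" and Lk: "\<And>w u t. t < N \<Longrightarrow> lnk w u t < Lk t"
    and tau: "\<tau> = sqrt (2 * (1 + (h_d / h_c)\<^sup>2))"
  shows "(1 - eps) * (ln m1 + ln m2)
     \<le> 2 * ln 2 + leakage * ln 2 + N * (ln \<sigma> + ln \<tau> + 1 / 2) + (\<Sum>t<N. ln (Lk t))"
proof -
  define \<rho> where "\<rho> = h_d / h_c"
  have "1 \<le> sqrt (2 * (1 + \<rho>\<^sup>2))" using zero_le_power2[of \<rho>] by (auto simp: field_simps)
  then have tau1: "1 \<le> \<tau>" by (simp add: tau \<rho>_def)
  then have tau0: "0 < \<tau>" by simp
  have Lk0: "0 < Lk t" if "t < N" for t using Lk[OF that, of 0 0] by simp
  define c where "c = (\<Prod>t<N. real (Lk t))"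
  have c: "0 < c" unfolding c_def using Lk0 by (intro prod_pos) auto
  have lnc: "ln c = (\<Sum>t<N. ln (Lk t))"
    unfolding c_def using Lk0 by (intro ln_prod) auto
  note r2p = r2_props[OF tau1, where \<rho>=\<rho>]
  let ?R1 = "\<lambda>\<omega>. nd N (\<lambda>_. 0) \<sigma> (Y1 \<omega>)" and ?R2 = "\<lambda>\<omega>. r2 \<rho> \<tau> (Y2 \<omega>)"
    and ?F1 = "\<lambda>\<omega>. Ms g1 m1 (W1 \<omega>) (Y1 \<omega>)" and ?F2 = "\<lambda>\<omega>. Ms g2 m2 (W2 \<omega>) (Y2 \<omega>)"
    and ?p = "\<lambda>\<omega>. pd (W2 \<omega>) (Y1 \<omega>)" and ?pb = "\<lambda>\<omega>. pbar (Y1 \<omega>)"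
    and ?k = "\<lambda>\<omega>. nd N (\<lambda>t. \<rho> * Sv \<omega> t) \<tau> (Y2 \<omega>)"
    and ?n1 = "\<lambda>\<omega>. nd N (es (ib \<omega>)) 1 (Sv \<omega>)" and ?n2 = "\<lambda>\<omega>. nd N (e2 (ib \<omega>)) 1 (Y2 \<omega>)"
  \<comment> \<open>In the product of \<open>?A\<close>, \<open>?B\<close>, \<open>?C\<close> both
    \<open>fs\<close> and \<open>r2\<close> drop out: it is
    \<open>?F1 * ?F2 * ?R1 * ?k / (?n1 * ?n2 * c)\<close> times \<open>?pb / ?p\<close>, the
    reciprocal of the leakage ratio.\<close>
  let ?A = "\<lambda>\<omega>. ?F2 \<omega> * ?R2 \<omega> / ?n2 \<omega> * (?R1 \<omega> / ?p \<omega>)"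
    and ?B = "\<lambda>\<omega>. ?F1 \<omega> * ?pb \<omega> / (fs (Sv \<omega>) * c)"
    and ?C = "\<lambda>\<omega>. fs (Sv \<omega>) * ?k \<omega> / (?R2 \<omega> * ?n1 \<omega>)"
  let ?F = "\<lambda>\<omega>. ln m1 * (1 - indicator E1 \<omega>) + ln m2 * (1 - indicator E2 \<omega>) - 2 * ln 2
     - ln (?p \<omega> / ?pb \<omega>) - N * (ln \<sigma> + ln \<tau>) - En \<omega> - ln c"
  have R2M: "?R2 \<in> borel_measurable Om" by (rule measurable_compose[OF measurable_Y(2) r2p(2)])
  have F1M: "?F1 \<in> borel_measurable Om" by (rule measurable_Ms[OF measurable_W(1) measurable_Y(1) g1])
  have F2M: "?F2 \<in> borel_measurable Om" by (rule measurable_Ms[OF measurable_W(2) measurable_Y(2) g2])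
  have n1M: "?n1 \<in> borel_measurable Om" by (rule measurable_nd[OF measurable_es[OF measurable_inputs(2)] measurable_Sv])
  have AM: "?A \<in> borel_measurable Om"
    by (rule borel_measurable_times[OF borel_measurable_divide[OF borel_measurable_times[OF F2M R2M] measurable_eout(2)]
          borel_measurable_divide[OF measurable_r_out(1) measurable_pd_W2_Y1]])
  have BM: "?B \<in> borel_measurable Om"
    by (rule borel_measurable_divide[OF borel_measurable_times[OF F1M measurable_pbar_Y1]
          borel_measurable_times[OF measurable_fs_Sv borel_measurable_const]])
  have CM: "?C \<in> borel_measurable Om"
    by (rule borel_measurable_divide[OF borel_measurable_times[OF measurable_fs_Sv measurable_k_out]
          borel_measurable_times[OF R2M n1M]])
  have pos: "0 < ?F1 \<omega>" "0 < ?F2 \<omega>" "0 < ?R1 \<omega>" "0 < ?R2 \<omega>" "0 < ?p \<omega>" "0 < ?pb \<omega>" "0 < ?k \<omega>"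
     "0 < ?n1 \<omega>" "0 < ?n2 \<omega>" "0 < fs (Sv \<omega>)" if "\<omega> \<in> space Om" for \<omega>
    using \<sigma> tau0 by (auto intro!: Ms_pos nd_pos r2p(1) pd_pos pbar_pos fs_pos Y1_space[OF that] Y2_space[OF that]
       measurable_space[OF measurable_Sv that])
  have posA: "0 < ?A \<omega>" and posB: "0 < ?B \<omega>" and posC: "0 < ?C \<omega>" if "\<omega> \<in> space Om" for \<omega>
    by (intro mult_pos_pos divide_pos_pos pos[OF that] c)+
  have FI: "integrable Om ?F"
    using ind_integrable En_integrable integrable_ln_ratio
    by (intro Bochner_Integration.integrable_diff Bochner_Integration.integrable_add) auto
  have "Om.expectation ?F \<le> 0"
  proof (rule Om.expectation_nonpos_of_log_bound[OF FI, of "\<lambda>\<omega>. ?A \<omega> + ?B \<omega> + ?C \<omega>" 3])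
    show "(\<lambda>\<omega>. ?A \<omega> + ?B \<omega> + ?C \<omega>) \<in> borel_measurable Om"
      by (intro borel_measurable_add AM BM CM)
    have "(\<integral>\<^sup>+\<omega>. ennreal (?A \<omega> + ?B \<omega> + ?C \<omega>) \<partial>Om)
       = (\<integral>\<^sup>+\<omega>. ennreal (?A \<omega>) \<partial>Om) + (\<integral>\<^sup>+\<omega>. ennreal (?B \<omega>) \<partial>Om) + (\<integral>\<^sup>+\<omega>. ennreal (?C \<omega>) \<partial>Om)"
      by (rule nn_integral_add3[OF AM BM CM]) (intro less_imp_le posA posB posC, assumption)+
    also have "\<dots> \<le> 1 + 1 + 1"
    proof (intro add_mono)
      show "(\<integral>\<^sup>+\<omega>. ennreal (?A \<omega>) \<partial>Om) \<le> 1"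
        using r2p \<sigma> by (intro secrecy_term[OF g1 g2 measurable_r]) (auto simp: nn_integral_nd less_imp_le)
      show "(\<integral>\<^sup>+\<omega>. ennreal (?B \<omega>) \<partial>Om) \<le> 1"
        unfolding c_def by (rule link_term[OF g1 Lk])
      show "(\<integral>\<^sup>+\<omega>. ennreal (?C \<omega>) \<partial>Om) \<le> 1"
        by (rule smoothing_term[OF tau1])
    qed
    finally show "(\<integral>\<^sup>+\<omega>. ennreal (?A \<omega> + ?B \<omega> + ?C \<omega>) \<partial>Om) \<le> ennreal 3" by simp
    fix \<omega> assume w: "\<omega> \<in> space Om"
    note p = pos[OF w]
    show "0 \<le> ?A \<omega> + ?B \<omega> + ?C \<omega>" using posA[OF w] posB[OF w] posC[OF w] by simp
    \<comment> \<open>\<open>Y1\<close> and \<open>Sv\<close> carry the same noise, each around its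
      own mean, so both conditional densities equal the centred density at that noise.\<close>
    have n1: "?n1 \<omega> = nd N (e1 (ia \<omega>) (ib \<omega>)) 1 (Y1 \<omega>)" unfolding Sv_def Y1_def nd_shift ..
    have "- real N * (ln \<sigma> + ln \<tau>) - En \<omega> = (\<Sum>t<N. - ln \<sigma> - ln \<tau> - ((X1f \<omega> t)\<^sup>2 + (X2f \<omega> t)\<^sup>2) / (4 * P))"
      by (simp add: En_def sum_subtractf sum.distrib algebra_simps)
    also have "\<dots> \<le> (\<Sum>t<N. ln (normal_density 0 \<sigma> (Y1 \<omega> t)) + ln (normal_density (\<rho> * Sv \<omega> t) \<tau> (Y2 \<omega> t))
        - ln (normal_density (e1 (ia \<omega>) (ib \<omega>) t) 1 (Y1 \<omega> t)) - ln (normal_density (e2 (ib \<omega>) t) 1 (Y2 \<omega> t)))"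
      unfolding \<rho>_def
      by (intro sum_mono two_letter_bound[OF P hc])
         (auto simp: Y1_coord Y2_coord Sv_coord e1_def e2_def X1f_def[symmetric] X2f_def[symmetric] tau)
    also have "\<dots> = ln (?R1 \<omega>) + ln (?k \<omega>) - ln (?n1 \<omega>) - ln (?n2 \<omega>)"
      using \<sigma> tau0 by (simp add: n1 ln_nd sum_subtractf sum.distrib)
    finally have 1: "- real N * (ln \<sigma> + ln \<tau>) - En \<omega> \<le> \<dots>" .
    have 2: "ln m1 * (1 - indicator E1 \<omega>) - ln 2 \<le> ln (?F1 \<omega>)"
      using ln_Ms[OF m1_pos, of g1 "Y1 \<omega>" "W1 \<omega>"] w by (auto simp: E1_def indicator_def split: if_splits)
    have 3: "ln m2 * (1 - indicator E2 \<omega>) - ln 2 \<le> ln (?F2 \<omega>)"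
      using ln_Ms[OF m2_pos, of g2 "Y2 \<omega>" "W2 \<omega>"] w by (auto simp: E2_def indicator_def split: if_splits)
    have a: "ln (?A \<omega>) = ln (?F2 \<omega>) + ln (?R2 \<omega>) - ln (?n2 \<omega>) + (ln (?R1 \<omega>) - ln (?p \<omega>))"
      using p by (simp add: ln_mult ln_div)
    have b: "ln (?B \<omega>) = ln (?F1 \<omega>) + ln (?pb \<omega>) - (ln (fs (Sv \<omega>)) + ln c)"
      using p c by (simp add: ln_mult ln_div)
    have cc: "ln (?C \<omega>) = ln (fs (Sv \<omega>)) + ln (?k \<omega>) - (ln (?R2 \<omega>) + ln (?n1 \<omega>))"
      using p by (simp add: ln_mult ln_div)
    have d: "ln (?p \<omega> / ?pb \<omega>) = ln (?p \<omega>) - ln (?pb \<omega>)" using p by (simp add: ln_div)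
    have "ln (?A \<omega>) \<le> ?A \<omega> - 1" "ln (?B \<omega>) \<le> ?B \<omega> - 1" "ln (?C \<omega>) \<le> ?C \<omega> - 1"
      using posA[OF w] posB[OF w] posC[OF w] by (auto intro: ln_le_minus_one)
    then show "?F \<omega> \<le> ?A \<omega> + ?B \<omega> + ?C \<omega> - 3"
      using 1 2 3 unfolding a b cc d by linarith
  qed simp
  moreover have "Om.expectation ?F = ln m1 * (1 - measure Om E1) + ln m2 * (1 - measure Om E2) - 2 * ln 2
     - leakage * ln 2 - N * (ln \<sigma> + ln \<tau>) - integral\<^sup>L Om En - ln c"
    using ind_integrable En_integrable integrable_ln_ratio by (simp add: Om.prob_space ind_integral integral_ln_ratio)
  moreover have "ln m1 * (1 - eps) \<le> ln m1 * (1 - measure Om E1)"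
    using err1 m1_pos unfolding E1_def by (intro mult_left_mono) auto
  moreover have "ln m2 * (1 - eps) \<le> ln m2 * (1 - measure Om E2)"
    using err2 m2_pos unfolding E2_def by (intro mult_left_mono) auto
  ultimately have "ln m1 * (1 - eps) + ln m2 * (1 - eps) \<le> 2 * ln 2 + leakage * ln 2 + N * (ln \<sigma> + ln \<tau>) + N / 2 + ln c"
    using En_integral by linarith
  then show ?thesis unfolding lnc by (simp add: algebra_simps)
qed

end

end

lemma secure_code_converse:
  assumes code: "secure_code h_d h_c P CG N m1 m2 eps lk"
    and m: "1 \<le> m1" "1 \<le> m2" and P: "0 < P"
  shows "(1 - eps) * ln m1 \<le> ln 2 + N * (ln (rsd h_d h_c P) + 1 / 2)"
    and "(1 - eps) * ln m2 \<le> ln 2 + N * (ln (rsd h_d h_c P) + 1 / 2)"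
    and "h_c \<noteq> 0 \<Longrightarrow> (1 - eps) * (ln m1 + ln m2) \<le> 2 * ln 2 + lk * ln 2
       + N * (ln (rsd h_d h_c P) + ln (sqrt (2 * (1 + (h_d / h_c)\<^sup>2))) + 1 / 2) + N * CG * ln 2"
proof -
  obtain \<mu>1 \<mu>2 :: "real measure" and x1 x2 lnk Lk g1 g2 where
    \<mu>: "prob_space \<mu>1" "sets \<mu>1 = sets borel" "prob_space \<mu>2" "sets \<mu>2 = sets borel"
    and x: "\<forall>w t ls. (\<lambda>u. x1 w u t ls) \<in> borel_measurable borel"
      "\<forall>w t. (\<lambda>u. x2 w u t) \<in> borel_measurable borel"
      "\<forall>w t. (\<lambda>u. lnk w u t) \<in> measurable borel (count_space UNIV)"
    and causal: "\<forall>w u t ls ls'. (\<forall>s\<le>t. ls s = ls' s) \<longrightarrow> x1 w u t ls = x1 w u t ls'"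
    and Lk: "\<forall>w u t. t < N \<longrightarrow> lnk w u t < Lk t"
    and rate: "(\<Sum>t<N. log 2 (real (Lk t))) \<le> real N * CG"
    and g: "g1 \<in> measurable (out_space N) (count_space UNIV)" "g2 \<in> measurable (out_space N) (count_space UNIV)"
    and pow: "\<forall>t<N. integrable (block_space N m1 m2 \<mu>1 \<mu>2) (\<lambda>\<omega>. ((\<lambda>(w1, w2, u1, u2, z1, z2). x1 w1 u1 t (\<lambda>s. lnk w2 u2 s)) \<omega>)\<^sup>2) \<and>
        integral\<^sup>L (block_space N m1 m2 \<mu>1 \<mu>2) (\<lambda>\<omega>. ((\<lambda>(w1, w2, u1, u2, z1, z2). x1 w1 u1 t (\<lambda>s. lnk w2 u2 s)) \<omega>)\<^sup>2) \<le> P"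
      "\<forall>t<N. integrable (block_space N m1 m2 \<mu>1 \<mu>2) (\<lambda>\<omega>. ((\<lambda>(w1, w2, u1, u2, z1, z2). x2 w2 u2 t) \<omega>)\<^sup>2) \<and>
        integral\<^sup>L (block_space N m1 m2 \<mu>1 \<mu>2) (\<lambda>\<omega>. ((\<lambda>(w1, w2, u1, u2, z1, z2). x2 w2 u2 t) \<omega>)\<^sup>2) \<le> P"
    and err: "measure (block_space N m1 m2 \<mu>1 \<mu>2) {\<omega> \<in> space (block_space N m1 m2 \<mu>1 \<mu>2).
        g1 (restrict (\<lambda>t. h_d * (\<lambda>(w1, w2, u1, u2, z1, z2). x1 w1 u1 t (\<lambda>s. lnk w2 u2 s)) \<omega> +
           h_c * (\<lambda>(w1, w2, u1, u2, z1, z2). x2 w2 u2 t) \<omega> +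
           (case \<omega> of (w1, w2, u1, u2, z1, z2) \<Rightarrow> z1 t)) {..<N}) \<noteq> (\<lambda>(w1, w2, u1, u2, z1, z2). w1) \<omega>} \<le> eps"
      "measure (block_space N m1 m2 \<mu>1 \<mu>2) {\<omega> \<in> space (block_space N m1 m2 \<mu>1 \<mu>2).
        g2 (restrict (\<lambda>t. h_d * (\<lambda>(w1, w2, u1, u2, z1, z2). x2 w2 u2 t) \<omega> +
           (case \<omega> of (w1, w2, u1, u2, z1, z2) \<Rightarrow> z2 t)) {..<N}) \<noteq> (\<lambda>(w1, w2, u1, u2, z1, z2). w2) \<omega>} \<le> eps"
    and leak: "prob_space.mutual_information (block_space N m1 m2 \<mu>1 \<mu>2) 2 (count_space UNIV) (out_space N)
        (\<lambda>(w1, w2, u1, u2, z1, z2). w2)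
        (\<lambda>\<omega>. restrict (\<lambda>t. h_d * (\<lambda>(w1, w2, u1, u2, z1, z2). x1 w1 u1 t (\<lambda>s. lnk w2 u2 s)) \<omega> +
           h_c * (\<lambda>(w1, w2, u1, u2, z1, z2). x2 w2 u2 t) \<omega> +
           (case \<omega> of (w1, w2, u1, u2, z1, z2) \<Rightarrow> z1 t)) {..<N}) \<le> lk"
    using code unfolding secure_code_def Let_def by (elim exE conjE) (rule that; assumption)
  interpret C: cooperative_code h_d h_c N m1 m2 \<mu>1 \<mu>2 x1 x2 lnk
    using m \<mu> x causal by (intro cooperative_code.intro) blast+
  have X1: "(\<lambda>(w1, w2, u1, u2, z1, z2). x1 w1 u1 t (\<lambda>s. lnk w2 u2 s)) = (\<lambda>\<omega>. C.X1f \<omega> t)" for t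
    by (auto simp: C.X1f_def)
  have X2: "(\<lambda>(w1, w2, u1, u2, z1, z2). x2 w2 u2 t) = (\<lambda>\<omega>. C.X2f \<omega> t)" for t
    by (auto simp: C.X2f_def)
  have W: "(\<lambda>(w1, w2, u1, u2, z1, z2). w1) = C.W1" "(\<lambda>(w1, w2, u1, u2, z1, z2). w2) = C.W2"
    by (auto simp: C.W1_def C.W2_def fun_eq_iff)
  have Z: "(case \<omega> of (w1, w2, u1, u2, z1, z2) \<Rightarrow> z1 t) = C.iz1 \<omega> t"
    "(case \<omega> of (w1, w2, u1, u2, z1, z2) \<Rightarrow> z2 t) = C.iz2 \<omega> t" for \<omega> t
    by (auto split: prod.split)
  have Y1: "restrict (\<lambda>t. h_d * C.X1f \<omega> t + h_c * C.X2f \<omega> t + C.iz1 \<omega> t) {..<N} = C.Y1 \<omega>" for \<omega>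
    by (simp add: C.Y1_def shift_def C.e1_def C.X1f_def C.X2f_def)
  have Y2: "restrict (\<lambda>t. h_d * C.X2f \<omega> t + C.iz2 \<omega> t) {..<N} = C.Y2 \<omega>" for \<omega>
    by (simp add: C.Y2_def shift_def C.e2_def C.X2f_def)
  note eqs = X1 X2 W Z Y1 Y2 C.Om_def[symmetric]
  note err' = err[unfolded eqs] and pow' = pow[unfolded eqs] and leak' = leak[unfolded eqs]
  have pow1: "\<And>t. t < N \<Longrightarrow> integrable C.Om (\<lambda>\<omega>. (C.X1f \<omega> t)\<^sup>2)" "\<And>t. t < N \<Longrightarrow> integral\<^sup>L C.Om (\<lambda>\<omega>. (C.X1f \<omega> t)\<^sup>2) \<le> P"
    and pow2: "\<And>t. t < N \<Longrightarrow> integrable C.Om (\<lambda>\<omega>. (C.X2f \<omega> t)\<^sup>2)" "\<And>t. t < N \<Longrightarrow> integral\<^sup>L C.Om (\<lambda>\<omega>. (C.X2f \<omega> t)\<^sup>2) \<le> P"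
    using pow' by auto
  note facts = g P pow1 pow2 err'
  show "(1 - eps) * ln m1 \<le> ln 2 + N * (ln (rsd h_d h_c P) + 1 / 2)"
    by (rule C.converse_user1[OF facts])
  show "(1 - eps) * ln m2 \<le> ln 2 + N * (ln (rsd h_d h_c P) + 1 / 2)"
    by (rule C.converse_user2[OF facts])
  assume hc: "h_c \<noteq> 0"
  have "C.leakage * ln 2 \<le> lk * ln 2"
    using leak' by (simp add: C.leakage_def)
  moreover have "(\<Sum>t<N. ln (real (Lk t))) \<le> N * CG * ln 2"
  proof -
    have "(\<Sum>t<N. log 2 (real (Lk t))) = (\<Sum>t<N. ln (real (Lk t))) / ln 2"
      by (simp add: log_def sum_divide_distrib)
    then show ?thesis using rate by (simp add: divide_le_eq)
  qed
  moreover have "\<And>w u t. t < N \<Longrightarrow> lnk w u t < Lk t" using Lk by blast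
  note C.converse_sum[OF facts hc this refl]
  ultimately show "(1 - eps) * (ln m1 + ln m2) \<le> 2 * ln 2 + lk * ln 2
       + N * (ln (rsd h_d h_c P) + ln (sqrt (2 * (1 + (h_d / h_c)\<^sup>2))) + 1 / 2) + N * CG * ln 2"
    by linarith
qed

section \<open>Averages over random codebooks\<close>

lemma sum_PiE_insert:
  fixes f :: "('i \<Rightarrow> 'x) \<Rightarrow> real"
  assumes "finite J" "finite X" "i \<notin> J"
  shows "(\<Sum>c\<in>Pi\<^sub>E (insert i J) (\<lambda>_. X). f c) = (\<Sum>x\<in>X. \<Sum>c\<in>Pi\<^sub>E J (\<lambda>_. X). f (c(i := x)))"
proof -
  have "(\<Sum>c\<in>Pi\<^sub>E (insert i J) (\<lambda>_. X). f c)
     = (\<Sum>p\<in>X \<times> Pi\<^sub>E J (\<lambda>_. X). f ((\<lambda>(y, g). g(i := y)) p))"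
    unfolding PiE_insert_eq using assms(3) by (intro sum.reindex[unfolded comp_def] inj_combinator)
  then show ?thesis by (simp add: sum.cartesian_product case_prod_beta)
qed

lemma sum_PiE_component:
  fixes F :: "'x \<Rightarrow> real"
  assumes I: "finite I" "i \<in> I" and X: "finite X"
  shows "card X * (\<Sum>c\<in>Pi\<^sub>E I (\<lambda>_. X). F (c i)) = card (Pi\<^sub>E I (\<lambda>_. X)) * (\<Sum>x\<in>X. F x)"
proof -
  define J where "J = I - {i}"
  have J: "I = insert i J" "finite J" "i \<notin> J" using I by (auto simp: J_def)
  have "(\<Sum>c\<in>Pi\<^sub>E I (\<lambda>_. X). F (c i)) = card (Pi\<^sub>E J (\<lambda>_. X)) * (\<Sum>x\<in>X. F x)"
    unfolding J(1) using J X by (subst sum_PiE_insert) (auto simp: sum_distrib_left)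
  moreover have "card (Pi\<^sub>E I (\<lambda>_. X)) = card X * card (Pi\<^sub>E J (\<lambda>_. X))"
    unfolding J(1) using J by (simp add: card_PiE)
  ultimately show ?thesis by simp
qed

text \<open>Pairwise independence of the entries of a uniformly random codebook, stated as a
  counting identity.\<close>

lemma sum_PiE_pair:
  fixes F :: "'x \<Rightarrow> 'x \<Rightarrow> real"
  assumes I: "finite I" "i \<in> I" "j \<in> I" "i \<noteq> j" and X: "finite X"
  shows "(card X)\<^sup>2 * (\<Sum>c\<in>Pi\<^sub>E I (\<lambda>_. X). F (c i) (c j))
       = card (Pi\<^sub>E I (\<lambda>_. X)) * (\<Sum>x\<in>X. \<Sum>x'\<in>X. F x x')"
proof -
  define J where "J = I - {i, j}"
  have J: "I = insert i (insert j J)" "finite J" "i \<notin> insert j J" "j \<notin> J" using I by (auto simp: J_def)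
  have "(\<Sum>c\<in>Pi\<^sub>E I (\<lambda>_. X). F (c i) (c j)) = (\<Sum>x\<in>X. \<Sum>c\<in>Pi\<^sub>E (insert j J) (\<lambda>_. X). F x (c j))"
    unfolding J(1) using J X I(4) by (subst sum_PiE_insert) (auto simp: fun_upd_def)
  also have "\<dots> = (\<Sum>x\<in>X. \<Sum>x'\<in>X. card (Pi\<^sub>E J (\<lambda>_. X)) * F x x')"
    using J X by (subst sum_PiE_insert) auto
  also have "\<dots> = card (Pi\<^sub>E J (\<lambda>_. X)) * (\<Sum>x\<in>X. \<Sum>x'\<in>X. F x x')"
    by (simp add: sum_distrib_left)
  finally have 1: "(\<Sum>c\<in>Pi\<^sub>E I (\<lambda>_. X). F (c i) (c j)) = \<dots>" .
  have "card (Pi\<^sub>E I (\<lambda>_. X)) = (card X)\<^sup>2 * card (Pi\<^sub>E J (\<lambda>_. X))"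
    unfolding J(1) using J by (simp add: card_PiE power2_eq_square)
  with 1 show ?thesis by (simp add: mult_ac)
qed

lemma exists_le_average:
  fixes f :: "'a \<Rightarrow> real" and b :: real
  assumes "finite A" "A \<noteq> {}" "(\<Sum>a\<in>A. f a) \<le> card A * b"
  obtains a where "a \<in> A" "f a \<le> b"
proof (rule ccontr)
  assume "\<not> thesis"
  then have "\<And>a. a \<in> A \<Longrightarrow> b < f a" using that by force
  then have "(\<Sum>a\<in>A. b) < (\<Sum>a\<in>A. f a)" using assms by (intro sum_strict_mono) auto
  then show False using assms by simp
qed

text \<open>An index is a pair of message and dummy index. Confusion between words of the same
  message is permitted, because the decoder reports the message only.\<close>

definition bad_index :: "nat \<Rightarrow> nat \<Rightarrow> ('x \<Rightarrow> 'x \<Rightarrow> bool) \<Rightarrow> (nat \<times> nat \<Rightarrow> 'x) \<Rightarrow> (nat \<times> nat) set" where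
  "bad_index m K conf c = {i \<in> {1..m} \<times> {..<K}. \<exists>j \<in> {1..m} \<times> {..<K}. fst j \<noteq> fst i \<and> conf (c i) (c j)}"

lemma card_bad_index_le:
  "real (card (bad_index m K conf c))
   \<le> (\<Sum>i\<in>{1..m} \<times> {..<K}. \<Sum>j\<in>{j \<in> {1..m} \<times> {..<K}. fst j \<noteq> fst i}. of_bool (conf (c i) (c j)))"
proof -
  let ?I = "{1..m} \<times> {..<K}"
  have "real (card (bad_index m K conf c)) = (\<Sum>i\<in>?I. of_bool (i \<in> bad_index m K conf c))"
    by (simp add: bad_index_def of_bool_def sum.If_cases Int_def)
  also have "\<dots> \<le> (\<Sum>i\<in>?I. \<Sum>j\<in>{j \<in> ?I. fst j \<noteq> fst i}. of_bool (conf (c i) (c j)))"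
  proof (rule sum_mono)
    fix i assume "i \<in> ?I"
    show "(of_bool (i \<in> bad_index m K conf c) :: real) \<le> (\<Sum>j\<in>{j \<in> ?I. fst j \<noteq> fst i}. of_bool (conf (c i) (c j)))"
    proof (cases "i \<in> bad_index m K conf c")
      case True
      then obtain j where j: "j \<in> {j \<in> ?I. fst j \<noteq> fst i}" "conf (c i) (c j)" by (auto simp: bad_index_def)
      have "(of_bool (conf (c i) (c j)) :: real) \<le> (\<Sum>j\<in>{j \<in> ?I. fst j \<noteq> fst i}. of_bool (conf (c i) (c j)))"
        by (rule member_le_sum[OF j(1)]) auto
      with True j show ?thesis by simp
    qed (auto intro: sum_nonneg)
  qed
  finally show ?thesis .
qed

text \<open>Only pairwise independence of the random codewords enters: through the expected number of
  confusable pairs, and through the second moment that is the chi-square leakage.\<close>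

lemma codebook_exists:
  fixes X :: "'x set" and conf :: "'x \<Rightarrow> 'x \<Rightarrow> bool" and G :: "'x \<Rightarrow> 'x \<Rightarrow> real"
  assumes X: "finite X" "X \<noteq> {}" and m: "1 \<le> m" and K: "1 \<le> K"
    and V: "\<And>x. x \<in> X \<Longrightarrow> real (card {x' \<in> X. conf x x'}) \<le> V"
    and Gavg: "(\<Sum>x\<in>X. \<Sum>x'\<in>X. G x x') \<le> (real (card X))\<^sup>2"
    and Gdiag: "\<And>x. x \<in> X \<Longrightarrow> G x x \<le> 1 + B"
  obtains c where "\<And>i. c i \<in> X"
    and "real (card (bad_index m K conf c)) / (m * K)
       + ((\<Sum>w=1..m. (\<Sum>l<K. \<Sum>l'<K. G (c (w, l)) (c (w, l'))) / (real K)\<^sup>2) / m)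
      \<le> (real m - 1) * K * V / card X + 1 + B / K"
proof -
  let ?I = "{1..m} \<times> {..<K}"
  define C where "C = Pi\<^sub>E ?I (\<lambda>_. X)"
  have finI: "finite ?I" by simp
  have finC: "finite C" unfolding C_def using X by (intro finite_PiE) auto
  have neC: "C \<noteq> {}" unfolding C_def using X by (auto simp: PiE_eq_empty_iff)
  have cX: "0 < real (card X)" using X by (simp add: card_gt_0_iff)
  have cC: "0 < real (card C)" using finC neC by (simp add: card_gt_0_iff)
  have mK: "0 < real m" "0 < real K" using m K by auto
  have V0: "0 \<le> V"
  proof -
    obtain x where "x \<in> X" using X by auto
    from V[OF this] show ?thesis by linarith
  qed
  have single: "(\<Sum>c\<in>C. F (c i)) = card C * ((\<Sum>x\<in>X. F x) / card X)" if "i \<in> ?I" for F :: "'x \<Rightarrow> real" and i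
    using sum_PiE_component[OF finI that X(1), of F] cX unfolding C_def by (simp add: field_simps)
  have pair: "(\<Sum>c\<in>C. F (c i) (c j)) = card C * ((\<Sum>x\<in>X. \<Sum>x'\<in>X. F x x') / (real (card X))\<^sup>2)"
    if "i \<in> ?I" "j \<in> ?I" "i \<noteq> j" for F :: "'x \<Rightarrow> 'x \<Rightarrow> real" and i j
    using sum_PiE_pair[OF finI that X(1), of F] cX unfolding C_def by (simp add: field_simps)
  have confs: "(\<Sum>x\<in>X. \<Sum>x'\<in>X. of_bool (conf x x')) \<le> card X * V"
  proof -
    have "(\<Sum>x\<in>X. \<Sum>x'\<in>X. of_bool (conf x x')) = (\<Sum>x\<in>X. real (card {x' \<in> X. conf x x'}))"
      using X by (intro sum.cong refl) (simp add: of_bool_def sum.If_cases Int_def)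
    also have "\<dots> \<le> (\<Sum>x\<in>X. V)" by (intro sum_mono V)
    finally show ?thesis by simp
  qed
  have bad: "(\<Sum>c\<in>C. real (card (bad_index m K conf c)) / (m * K)) \<le> card C * ((real m - 1) * K * V / card X)"
  proof -
    have "(\<Sum>c\<in>C. real (card (bad_index m K conf c)))
       \<le> (\<Sum>c\<in>C. \<Sum>i\<in>?I. \<Sum>j\<in>{j \<in> ?I. fst j \<noteq> fst i}. of_bool (conf (c i) (c j)))"
      by (intro sum_mono card_bad_index_le)
    also have "\<dots> = (\<Sum>i\<in>?I. \<Sum>j\<in>{j \<in> ?I. fst j \<noteq> fst i}. \<Sum>c\<in>C. of_bool (conf (c i) (c j)))"
      by (subst sum.swap, intro sum.cong refl, subst sum.swap, rule refl)
    also have "\<dots> \<le> (\<Sum>i\<in>?I. \<Sum>j\<in>{j \<in> ?I. fst j \<noteq> fst i}. card C * (V / card X))"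
    proof (intro sum_mono)
      fix i j assume i: "i \<in> ?I" and "j \<in> {j \<in> ?I. fst j \<noteq> fst i}"
      then have "j \<in> ?I" "i \<noteq> j" by auto
      from pair[OF i this, of "\<lambda>x x'. of_bool (conf x x')"]
      have "(\<Sum>c\<in>C. of_bool (conf (c i) (c j))) = card C * ((\<Sum>x\<in>X. \<Sum>x'\<in>X. of_bool (conf x x')) / (real (card X))\<^sup>2)" .
      also have "\<dots> \<le> card C * (card X * V / (real (card X))\<^sup>2)"
        using confs by (intro mult_left_mono divide_right_mono) auto
      also have "\<dots> = card C * (V / card X)" using cX by (simp add: power2_eq_square)
      finally show "(\<Sum>c\<in>C. of_bool (conf (c i) (c j))) \<le> card C * (V / card X)" .
    qed
    \<comment> \<open>The competitors belong to the other \<open>m - 1\<close> messages. Keeping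
      \<open>m - 1\<close> instead of \<open>m\<close> makes the bound 0 for a single message, which
      covers rate 0.\<close>
    also have "\<dots> = (\<Sum>i\<in>?I. ((real m - 1) * K) * (card C * (V / card X)))"
    proof (intro sum.cong refl)
      fix i assume "i \<in> ?I"
      then have "{j \<in> ?I. fst j \<noteq> fst i} = ({1..m} - {fst i}) \<times> {..<K}" "fst i \<in> {1..m}" by auto
      then have "real (card {j \<in> ?I. fst j \<noteq> fst i}) = (real m - 1) * K"
        using m by (simp add: card_cartesian_product of_nat_diff)
      then show "(\<Sum>j\<in>{j \<in> ?I. fst j \<noteq> fst i}. card C * (V / card X)) = ((real m - 1) * K) * (card C * (V / card X))"
        by (simp only: sum_constant)
    qed
    also have "\<dots> = (m * K) * (card C * ((real m - 1) * K * V / card X))"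
      by (simp add: card_cartesian_product)
    finally have "(\<Sum>c\<in>C. real (card (bad_index m K conf c))) \<le> (m * K) * (card C * ((real m - 1) * K * V / card X))" .
    then show ?thesis using mK by (simp add: sum_divide_distrib[symmetric] divide_le_eq mult_ac)
  qed
  have leak: "(\<Sum>c\<in>C. (\<Sum>w=1..m. (\<Sum>l<K. \<Sum>l'<K. G (c (w, l)) (c (w, l'))) / (real K)\<^sup>2) / m) \<le> card C * (1 + B / K)"
  proof -
    have "(\<Sum>c\<in>C. (\<Sum>w=1..m. (\<Sum>l<K. \<Sum>l'<K. G (c (w, l)) (c (w, l'))) / (real K)\<^sup>2) / m)
       = (\<Sum>w=1..m. (\<Sum>l<K. \<Sum>l'<K. \<Sum>c\<in>C. G (c (w, l)) (c (w, l'))) / (real K)\<^sup>2) / m"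
    proof -
      have "(\<Sum>c\<in>C. \<Sum>l<K. \<Sum>l'<K. G (c (w, l)) (c (w, l'))) = (\<Sum>l<K. \<Sum>l'<K. \<Sum>c\<in>C. G (c (w, l)) (c (w, l')))" for w
        by (subst sum.swap, intro sum.cong refl, subst sum.swap, rule refl)
      then show ?thesis
        by (simp add: sum_divide_distrib[symmetric] sum.swap[of _ _ C])
    qed
    \<comment> \<open>Different dummy indices contribute the average of \<open>G\<close>, at most 1;
      only the \<open>K\<close> diagonal pairs out of \<open>K\<^sup>2\<close> pay the excess
      \<open>B\<close>.\<close>
    also have "\<dots> \<le> (\<Sum>w=1..m. (\<Sum>l<K. \<Sum>l'<K. card C * (1 + (if l = l' then B else 0))) / (real K)\<^sup>2) / m"
    proof (intro divide_right_mono sum_mono)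
      fix w l l' assume wl: "w \<in> {1..m}" "l \<in> {..<K}" "l' \<in> {..<K}"
      show "(\<Sum>c\<in>C. G (c (w, l)) (c (w, l'))) \<le> card C * (1 + (if l = l' then B else 0))"
      proof (cases "l = l'")
        case True
        have "(\<Sum>c\<in>C. G (c (w, l)) (c (w, l))) \<le> (\<Sum>c\<in>C. 1 + B)"
          using wl by (intro sum_mono Gdiag) (auto simp: C_def)
        then show ?thesis using True by (simp add: mult.commute)
      next
        case False
        have "(\<Sum>c\<in>C. G (c (w, l)) (c (w, l'))) = card C * ((\<Sum>x\<in>X. \<Sum>x'\<in>X. G x x') / (real (card X))\<^sup>2)"
          using wl False by (intro pair) auto
        also have "\<dots> \<le> real (card C) * 1"
          using Gavg cX by (intro mult_left_mono) (auto simp: divide_le_eq)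
        finally show ?thesis using False by simp
      qed
    qed auto
    also have "\<dots> = card C * (1 + B / K)"
    proof -
      have "(\<Sum>l<K. \<Sum>l'<K. real (card C) * (1 + (if l = l' then B else 0))) = (\<Sum>l<K. card C * (K + B))"
        by (intro sum.cong refl) (simp add: sum_distrib_left[symmetric] sum.distrib)
      then show ?thesis using mK by (simp add: power2_eq_square field_simps)
    qed
    finally show ?thesis .
  qed
  \<comment> \<open>Both criteria are averaged as one sum, so a single codebook serves both. They
    can be separated later because the leakage average turns out to be at least 1.\<close>
  have "(\<Sum>c\<in>C. real (card (bad_index m K conf c)) / (m * K)
       + ((\<Sum>w=1..m. (\<Sum>l<K. \<Sum>l'<K. G (c (w, l)) (c (w, l'))) / (real K)\<^sup>2) / m))
      \<le> card C * ((real m - 1) * K * V / card X + 1 + B / K)"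
    using bad leak by (simp add: sum.distrib distrib_left)
  then obtain c where c: "c \<in> C" "real (card (bad_index m K conf c)) / (m * K)
       + ((\<Sum>w=1..m. (\<Sum>l<K. \<Sum>l'<K. G (c (w, l)) (c (w, l'))) / (real K)\<^sup>2) / m)
      \<le> (real m - 1) * K * V / card X + 1 + B / K"
    using exists_le_average[OF finC neC] by blast
  obtain x0 where x0: "x0 \<in> X" using X by auto
  \<comment> \<open>Encoders are defined for all message and key values, so the codebook is extended
    by a fixed word to indices that never occur in transmission.\<close>
  define c' where "c' i = (if i \<in> ?I then c i else x0)" for i
  have eq: "c' i = c i" if "i \<in> ?I" for i using that by (simp add: c'_def)
  have "bad_index m K conf c' = bad_index m K conf c"
    unfolding bad_index_def using eq by (intro Collect_cong) (metis (no_types, lifting))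
  moreover have "(\<Sum>w=1..m. (\<Sum>l<K. \<Sum>l'<K. G (c' (w, l)) (c' (w, l'))) / (real K)\<^sup>2)
     = (\<Sum>w=1..m. (\<Sum>l<K. \<Sum>l'<K. G (c (w, l)) (c (w, l'))) / (real K)\<^sup>2)"
    by (intro sum.cong arg_cong2[where f="(/)"] refl) (simp add: eq)
  ultimately have "real (card (bad_index m K conf c')) / (m * K)
       + ((\<Sum>w=1..m. (\<Sum>l<K. \<Sum>l'<K. G (c' (w, l)) (c' (w, l'))) / (real K)\<^sup>2) / m)
      \<le> (real m - 1) * K * V / card X + 1 + B / K" using c by simp
  moreover have "c' i \<in> X" for i using c(1) x0 by (auto simp: c'_def C_def)
  ultimately show ?thesis using that by blast
qed

section \<open>Hamming balls and noise outliers\<close>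

definition hamming :: "nat \<Rightarrow> (nat \<Rightarrow> nat) \<Rightarrow> (nat \<Rightarrow> nat) \<Rightarrow> nat" where
  "hamming N x y = card {t. t < N \<and> x t \<noteq> y t}"

lemma hamming_triangle: "hamming N x z \<le> hamming N x y + hamming N y z"
proof -
  have "{t. t < N \<and> x t \<noteq> z t} \<subseteq> {t. t < N \<and> x t \<noteq> y t} \<union> {t. t < N \<and> y t \<noteq> z t}" by auto
  then have "card {t. t < N \<and> x t \<noteq> z t} \<le> card ({t. t < N \<and> x t \<noteq> y t} \<union> {t. t < N \<and> y t \<noteq> z t})"
    by (intro card_mono) auto
  also have "\<dots> \<le> card {t. t < N \<and> x t \<noteq> y t} + card {t. t < N \<and> y t \<noteq> z t}" by (rule card_Un_le)
  finally show ?thesis by (simp add: hamming_def)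
qed

lemma hamming_commute: "hamming N x y = hamming N y x"
  unfolding hamming_def by (rule arg_cong[where f=card]) auto

text \<open>A word is determined by the set of positions where it differs from \<open>x\<close> and
  by its symbols there. Counting all \<open>2 ^ N\<close> sets costs one bit per channel use, a loss
  that does not grow with the alphabet.\<close>

lemma hamming_ball_card:
  assumes M: "1 \<le> M"
  shows "card {y \<in> Pi\<^sub>E {..<N} (\<lambda>_. {..<M}). hamming N x y \<le> k} \<le> 2 ^ N * M ^ k"
proof -
  let ?X = "Pi\<^sub>E {..<N} (\<lambda>_. {..<M})"
  have finX: "finite ?X" by (intro finite_PiE) auto
  let ?D = "\<lambda>S. {y \<in> ?X. {t. t < N \<and> x t \<noteq> y t} = S}"
  let ?S = "{S \<in> Pow {..<N}. card S \<le> k}"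
  have "{y \<in> ?X. hamming N x y \<le> k} \<subseteq> (\<Union>S\<in>?S. ?D S)"
  proof
    fix y assume "y \<in> {y \<in> ?X. hamming N x y \<le> k}"
    then have "y \<in> ?D {t. t < N \<and> x t \<noteq> y t}" "{t. t < N \<and> x t \<noteq> y t} \<in> ?S"
      by (simp_all add: hamming_def subset_iff)
    then show "y \<in> (\<Union>S\<in>?S. ?D S)" by (rule UN_I[rotated])
  qed
  then have "card {y \<in> ?X. hamming N x y \<le> k} \<le> card (\<Union>S\<in>?S. ?D S)"
    by (intro card_mono) (auto intro: finite_subset[OF _ finX])
  also have "\<dots> \<le> (\<Sum>S\<in>?S. card (?D S))" by (rule card_UN_le) auto
  also have "\<dots> \<le> (\<Sum>S\<in>?S. M ^ k)"
  proof (rule sum_mono)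
    fix S assume "S \<in> ?S"
    then have S: "S \<subseteq> {..<N}" "card S \<le> k" "finite S" by (auto intro: finite_subset)
    have "inj_on (\<lambda>y. restrict y S) (?D S)"
    proof (rule inj_onI)
      fix y z assume y: "y \<in> ?D S" and z: "z \<in> ?D S" and eq: "restrict y S = restrict z S"
      show "y = z"
      proof
        fix t
        consider "t \<in> S" | "t < N" "t \<notin> S" | "\<not> t < N" by blast
        then show "y t = z t"
        proof cases
          case 1 then show ?thesis using eq by (metis restrict_apply)
        next
          case 2 then show ?thesis using y z by fastforce
        next
          case 3 then show ?thesis using y z by (auto simp: PiE_def extensional_def)
        qed
      qed
    qed
    then have "card (?D S) = card ((\<lambda>y. restrict y S) ` ?D S)" by (rule card_image[symmetric])
    also have "\<dots> \<le> card (Pi\<^sub>E S (\<lambda>_. {..<M}))"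
    proof (intro card_mono finite_PiE S(3) image_subsetI)
      fix y assume "y \<in> ?D S"
      then have "\<forall>t\<in>S. y t \<in> {..<M}" using S(1) by (blast dest: PiE_mem)
      then show "restrict y S \<in> Pi\<^sub>E S (\<lambda>_. {..<M})" by simp
    qed simp
    also have "\<dots> = M ^ card S" using S by (simp add: card_PiE)
    also have "\<dots> \<le> M ^ k" using S M by (intro power_increasing) auto
    finally show "card (?D S) \<le> M ^ k" .
  qed
  also have "\<dots> \<le> card (Pow {..<N}) * M ^ k" by (simp only: sum_constant of_nat_id) (intro mult_right_mono card_mono, auto)
  also have "\<dots> = 2 ^ N * M ^ k" by (simp add: card_Pow)
  finally show ?thesis .
qed

lemma std_normal_tail:
  assumes "0 < e"
  obtains T where "0 \<le> T" "(\<integral>\<^sup>+x. ennreal (std_normal_density x) * indicator {x. T < \<bar>x\<bar>} x \<partial>lborel) \<le> ennreal e"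
proof -
  let ?D = "density lborel (\<lambda>x. ennreal (std_normal_density x))"
  interpret D: prob_space ?D by (rule prob_space_normal_density) simp
  let ?A = "\<lambda>n::nat. {x. real n < \<bar>x\<bar>}"
  have "(\<lambda>n. measure ?D (?A n)) \<longlonglongrightarrow> measure ?D (\<Inter>n. ?A n)"
    by (rule D.finite_Lim_measure_decseq) (auto simp: decseq_def)
  moreover have "(\<Inter>n. ?A n) = {}"
  proof safe
    fix x :: real assume x: "x \<in> (\<Inter>n. ?A n)"
    obtain n :: nat where "\<bar>x\<bar> \<le> n" using real_arch_simple by blast
    moreover have "real n < \<bar>x\<bar>" using x by auto
    ultimately show "x \<in> {}" by simp
  qed
  ultimately have "(\<lambda>n. measure ?D (?A n)) \<longlonglongrightarrow> 0" by simp
  then have "eventually (\<lambda>n. measure ?D (?A n) < e) sequentially"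
    using assms by (rule order_tendstoD)
  then obtain n where n: "measure ?D (?A n) < e" by (auto simp: eventually_sequentially)
  have "(\<integral>\<^sup>+x. ennreal (std_normal_density x) * indicator (?A n) x \<partial>lborel) = emeasure ?D (?A n)"
    by (rule emeasure_density[symmetric]) auto
  also have "\<dots> = ennreal (measure ?D (?A n))" by (rule D.emeasure_eq_measure)
  also have "\<dots> \<le> ennreal e" using n by (intro ennreal_leI) simp
  finally show ?thesis using that[of "real n"] by simp
qed

definition outliers :: "nat \<Rightarrow> real \<Rightarrow> (nat \<Rightarrow> real) \<Rightarrow> nat" where
  "outliers N T z = card {t. t < N \<and> T < \<bar>z t\<bar>}"

lemma outliers_sum: "outliers N T z = (\<Sum>t<N. if T < \<bar>z t\<bar> then 1 else 0)"
  by (simp add: outliers_def sum.If_cases Int_def lessThan_def)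

lemma measurable_outliers: "outliers N T \<in> measurable (out_space N) (count_space UNIV)"
proof -
  have "(\<lambda>z. (\<Sum>t<N. if T < \<bar>z t\<bar> then 1 else 0) :: nat) \<in> measurable (out_space N) (count_space UNIV)"
    by measurable
  then show ?thesis by (simp add: outliers_sum[abs_def])
qed

text \<open>A Chernoff bound with weight \<open>1 + K\<close> on outlying coordinates.
  \<open>T\<close> depends on \<open>\<delta>\<close> alone, so the symbol spacing derived from it
  is the same for all block lengths and all SNR.\<close>

lemma noise_outliers:
  fixes \<delta> :: real
  assumes d: "0 < \<delta>"
  obtains T where "0 \<le> T"
    "\<And>N. (\<integral>\<^sup>+z. indicator {z. \<delta> * real N < real (outliers N T z)} z \<partial>noise_vec N) \<le> ennreal ((1 / 2) ^ N)"
proof -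
  \<comment> \<open>Chosen so that \<open>K powr (\<delta> * N) = 4 ^ N\<close>. With tail mass at
    most \<open>1 / K\<close> the mean weight per coordinate is at most 2, and
    \<open>2 ^ N / 4 ^ N\<close> remains.\<close>
  define K :: real where "K = 4 powr (1 / \<delta>)"
  have K1: "1 \<le> K" unfolding K_def using d by (intro ge_one_powr_ge_zero) auto
  then have K0: "0 < K" by simp
  obtain T where T: "0 \<le> T"
    "(\<integral>\<^sup>+x. ennreal (std_normal_density x) * indicator {x. T < \<bar>x\<bar>} x \<partial>lborel) \<le> ennreal (1 / K)"
    using std_normal_tail[of "1 / K"] K0 by auto
  define f :: "real \<Rightarrow> ennreal" where "f x = 1 + ennreal K * indicator {x. T < \<bar>x\<bar>} x" for x
  have [measurable]: "f \<in> borel_measurable borel" unfolding f_def[abs_def] by measurable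
  have f1: "(\<integral>\<^sup>+x. ennreal (std_normal_density x) * f x \<partial>lborel) \<le> 2"
  proof -
    have "(\<integral>\<^sup>+x. ennreal (std_normal_density x) * f x \<partial>lborel)
       = (\<integral>\<^sup>+x. ennreal (std_normal_density x) + ennreal K * (ennreal (std_normal_density x) * indicator {x. T < \<bar>x\<bar>} x) \<partial>lborel)"
      by (intro nn_integral_cong) (simp add: f_def distrib_left mult_ac)
    also have "\<dots> = 1 + ennreal K * (\<integral>\<^sup>+x. ennreal (std_normal_density x) * indicator {x. T < \<bar>x\<bar>} x \<partial>lborel)"
      by (subst nn_integral_add) (auto simp: nn_integral_normal_density nn_integral_cmult)
    also have "\<dots> \<le> 1 + ennreal K * ennreal (1 / K)"
      using T(2) by (intro add_left_mono mult_left_mono) auto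
    also have "\<dots> = 2" using K0 by (simp flip: ennreal_mult)
    finally show ?thesis .
  qed
  show ?thesis
  proof (rule that[OF T(1)])
    fix N
    let ?E = "{z. \<delta> * real N < real (outliers N T z)}"
    have mE: "(\<lambda>z. indicator ?E z :: ennreal) \<in> borel_measurable (noise_vec N)"
    proof -
      have "(\<lambda>n::nat. indicator {n. \<delta> * real N < real n} n :: ennreal) \<in> borel_measurable (count_space UNIV)" by simp
      from measurable_compose[OF measurable_outliers[of N T] this]
      have "(\<lambda>z. indicator ?E z :: ennreal) \<in> borel_measurable (out_space N)" by (simp add: indicator_def)
      then show ?thesis by (subst measurable_cong_sets[OF sets_noise_vec refl])
    qed
    have le: "ennreal (4 ^ N) * indicator ?E z \<le> (\<Prod>t<N. f (z t))" for z
    proof (cases "z \<in> ?E")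
      case True
      have "(4::real) ^ N = 4 powr N" by (simp add: powr_realpow)
      also have "\<dots> \<le> 4 powr (1 / \<delta> * outliers N T z)"
        using True d by (intro powr_mono) (auto simp: field_simps)
      also have "\<dots> = K powr outliers N T z" by (simp add: K_def powr_powr)
      also have "\<dots> = K ^ outliers N T z" using K0 by (simp add: powr_realpow)
      also have "\<dots> = (\<Prod>t<N. if T < \<bar>z t\<bar> then K else 1)"
        by (simp add: outliers_def prod.If_cases Int_def lessThan_def)
      finally have "ennreal (4 ^ N) \<le> ennreal (\<Prod>t<N. if T < \<bar>z t\<bar> then K else 1)" by (rule ennreal_leI)
      also have "\<dots> = (\<Prod>t<N. ennreal (if T < \<bar>z t\<bar> then K else 1))"
        using K0 by (subst prod_ennreal) auto
      also have "\<dots> \<le> (\<Prod>t<N. f (z t))"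
        by (intro prod_mono_ennreal) (auto simp: f_def)
      finally show ?thesis using True by simp
    qed simp
    have "ennreal (4 ^ N) * (\<integral>\<^sup>+z. indicator ?E z \<partial>noise_vec N) = (\<integral>\<^sup>+z. ennreal (4 ^ N) * indicator ?E z \<partial>noise_vec N)"
      by (rule nn_integral_cmult[OF mE, symmetric])
    also have "\<dots> \<le> (\<integral>\<^sup>+z. (\<Prod>t<N. f (z t)) \<partial>noise_vec N)"
      by (intro nn_integral_mono le)
    also have "\<dots> = (\<Prod>t<N. \<integral>\<^sup>+x. ennreal (std_normal_density x) * f x \<partial>lborel)"
      by (rule nn_integral_noise_prod) measurable
    also have "\<dots> \<le> (\<Prod>t<N. 2)" by (intro prod_mono_ennreal) (use f1 in auto)
    also have "\<dots> = ennreal (2 ^ N)" using ennreal_power[of 2 N] by simp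
    finally have "ennreal (4 ^ N) * (\<integral>\<^sup>+z. indicator ?E z \<partial>noise_vec N) \<le> ennreal (2 ^ N)" .
    then have "ennreal (1 / 4 ^ N) * (ennreal (4 ^ N) * (\<integral>\<^sup>+z. indicator ?E z \<partial>noise_vec N)) \<le> ennreal (1 / 4 ^ N) * ennreal (2 ^ N)"
      by (intro mult_left_mono) auto
    moreover have "ennreal (1 / 4 ^ N) * ennreal (4 ^ N) = 1"
      by (subst ennreal_mult[symmetric]) auto
    moreover have "ennreal (1 / 4 ^ N) * ennreal (2 ^ N) = ennreal ((1 / 2) ^ N)"
    proof -
      have "(4::real) ^ N = 2 ^ N * 2 ^ N" by (simp flip: power_mult_distrib)
      then show ?thesis by (subst ennreal_mult[symmetric]) (auto simp: power_divide)
    qed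
    ultimately show "(\<integral>\<^sup>+z. indicator ?E z \<partial>noise_vec N) \<le> ennreal ((1 / 2) ^ N)"
      by (simp add: mult.assoc[symmetric])
  qed
qed

section \<open>Chi-square estimates for Gaussian mixtures\<close>

lemma integrable_nd:
  assumes "0 < \<sigma>" shows "integrable (lam N) (nd N c \<sigma>)" "integral\<^sup>L (lam N) (nd N c \<sigma>) = 1"
proof -
  have M: "nd N c \<sigma> \<in> borel_measurable (lam N)" by (rule measurable_nd) auto
  show I: "integrable (lam N) (nd N c \<sigma>)"
    by (rule nn_integral_bound_real[where c=1]) (use M in \<open>auto simp: nn_integral_nd[OF assms]\<close>)
  have "ennreal (integral\<^sup>L (lam N) (nd N c \<sigma>)) = (\<integral>\<^sup>+y. ennreal (nd N c \<sigma> y) \<partial>lam N)"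
    using I by (intro nn_integral_eq_integral[symmetric]) auto
  then show "integral\<^sup>L (lam N) (nd N c \<sigma>) = 1" unfolding nn_integral_nd[OF assms]
    by simp
qed

text \<open>Completing the square. Since the right-hand density has mass 1, integration gives the
  exponential of the squared distance of the means, the chi-square factor of two unit
  Gaussians.\<close>

lemma nd_sq_div:
  "(nd N a 1 y)\<^sup>2 / nd N b 1 y = exp (\<Sum>t<N. (a t - b t)\<^sup>2) * nd N (\<lambda>t. 2 * a t - b t) 1 y"
proof -
  have 1: "(normal_density \<alpha> 1 x)\<^sup>2 / normal_density \<beta> 1 x = exp ((\<alpha> - \<beta>)\<^sup>2) * normal_density (2 * \<alpha> - \<beta>) 1 x" for \<alpha> \<beta> x
  proof -
    define k where "k = 1 / sqrt (2 * pi)"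
    have k: "0 < k" by (simp add: k_def)
    have nd: "normal_density \<mu> 1 x = k * exp (- (x - \<mu>)\<^sup>2 / 2)" for \<mu> by (simp add: normal_density_def k_def)
    have "(normal_density \<alpha> 1 x)\<^sup>2 / normal_density \<beta> 1 x
       = k * (exp (- (x - \<alpha>)\<^sup>2 / 2) * exp (- (x - \<alpha>)\<^sup>2 / 2) / exp (- (x - \<beta>)\<^sup>2 / 2))"
      unfolding nd using k by (simp add: power2_eq_square)
    also have "\<dots> = k * exp (- (x - \<alpha>)\<^sup>2 / 2 + - (x - \<alpha>)\<^sup>2 / 2 - - (x - \<beta>)\<^sup>2 / 2)"
      by (simp only: exp_add exp_diff)
    also have "- (x - \<alpha>)\<^sup>2 / 2 + - (x - \<alpha>)\<^sup>2 / 2 - - (x - \<beta>)\<^sup>2 / 2 = (\<alpha> - \<beta>)\<^sup>2 + - (x - (2 * \<alpha> - \<beta>))\<^sup>2 / 2"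
      by (simp add: power2_eq_square field_simps)
    finally show ?thesis unfolding nd by (simp only: exp_add) simp
  qed
  have "(nd N a 1 y)\<^sup>2 / nd N b 1 y = (\<Prod>t<N. (normal_density (a t) 1 (y t))\<^sup>2 / normal_density (b t) 1 (y t))"
    by (simp add: nd_def prod_dividef prod_power_distrib)
  also have "\<dots> = exp (\<Sum>t<N. (a t - b t)\<^sup>2) * nd N (\<lambda>t. 2 * a t - b t) 1 y"
    by (simp add: 1 nd_def prod.distrib exp_sum)
  finally show ?thesis .
qed

text \<open>Joint convexity of \<open>p\<^sup>2 / q\<close>, from Cauchy-Schwarz. It moves averages
  out of the chi-square expression, both over reference words and over messages of user 1.\<close>

lemma sum_square_div_le:
  fixes p q :: "'a \<Rightarrow> real"
  assumes "finite J" "J \<noteq> {}" "\<And>j. j \<in> J \<Longrightarrow> 0 < q j"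
  shows "(\<Sum>j\<in>J. p j)\<^sup>2 / (\<Sum>j\<in>J. q j) \<le> (\<Sum>j\<in>J. (p j)\<^sup>2 / q j)"
proof -
  have Q: "0 < (\<Sum>j\<in>J. q j)" using assms by (intro sum_pos) auto
  have "(\<Sum>j\<in>J. (p j / sqrt (q j)) * sqrt (q j))\<^sup>2 \<le> (\<Sum>j\<in>J. (p j / sqrt (q j))\<^sup>2) * (\<Sum>j\<in>J. (sqrt (q j))\<^sup>2)"
    by (rule Cauchy_Schwarz_ineq_sum)
  moreover have "(\<Sum>j\<in>J. (p j / sqrt (q j)) * sqrt (q j)) = (\<Sum>j\<in>J. p j)"
    using assms(3) by (intro sum.cong) (auto simp: less_imp_neq[symmetric])
  moreover have "(\<Sum>j\<in>J. (p j / sqrt (q j))\<^sup>2) = (\<Sum>j\<in>J. (p j)\<^sup>2 / q j)"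
    using assms(3) by (intro sum.cong) (auto simp: power_divide less_imp_le)
  moreover have "(\<Sum>j\<in>J. (sqrt (q j))\<^sup>2) = (\<Sum>j\<in>J. q j)"
    using assms(3) by (intro sum.cong) (auto simp: less_imp_le)
  ultimately show ?thesis using Q by (simp add: divide_le_eq)
qed

context
  fixes X :: "'x set" and J :: "'j set" and a :: "'j \<Rightarrow> 'x \<Rightarrow> nat \<Rightarrow> real" and N :: nat
  assumes X: "finite X" "X \<noteq> {}" and J: "finite J" "J \<noteq> {}"
    and close: "\<And>j x x' t. t < N \<Longrightarrow> j \<in> J \<Longrightarrow> x \<in> X \<Longrightarrow> x' \<in> X \<Longrightarrow> \<bar>a j x t - a j x' t\<bar> \<le> 1"
begin

text \<open>Here \<open>j\<close> is a message of user 1 and \<open>x\<close> a word of user 2.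
  \<open>mixQ j\<close> is the ideal output density for given \<open>j\<close>, with the word of
  user 2 uniform over the whole set \<open>X\<close> instead of a codebook; \<open>mixq\<close> is
  the resulting reference for the leakage.\<close>

definition "mixQ j y = (\<Sum>x\<in>X. nd N (a j x) 1 y) / card X"
definition "mixq y = (\<Sum>j\<in>J. mixQ j y) / card J"
text \<open>The inner product with weight \<open>1 / mixQ j\<close> of two output densities,
  averaged over \<open>j\<close>. Conditioning on \<open>j\<close> is essential: for a fixed word of
  user 1 the means differ by at most 1 per coordinate, which is false across different
  \<open>j\<close>.\<close>

definition "corr x x' = (\<Sum>j\<in>J. (\<integral>y. nd N (a j x) 1 y * nd N (a j x') 1 y / mixQ j y \<partial>lam N)) / card J"

lemma cardX: "0 < real (card X)" and cardJ: "0 < real (card J)"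
  using X J by (auto simp: card_gt_0_iff)

lemma nd1: "0 < nd N c 1 y" by (rule nd_pos) simp

lemma ndM [measurable]: "nd N c 1 \<in> borel_measurable (out_space N)" by (rule measurable_nd) auto

lemma mixQ_pos: "0 < mixQ j y"
  unfolding mixQ_def using cardX X by (intro divide_pos_pos sum_pos nd1) auto

lemma mixq_pos: "0 < mixq y"
  unfolding mixq_def using cardJ J by (intro divide_pos_pos sum_pos mixQ_pos) auto

lemma mixQM [measurable]: "mixQ j \<in> borel_measurable (out_space N)"
  unfolding mixQ_def[abs_def] by measurable

lemma mixqM [measurable]: "mixq \<in> borel_measurable (out_space N)"
  unfolding mixq_def[abs_def] by measurable

lemma nd_le_mixQ: "x \<in> X \<Longrightarrow> nd N (a j x) 1 y \<le> card X * mixQ j y"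
  unfolding mixQ_def using cardX member_le_sum[of x X "\<lambda>x. nd N (a j x) 1 y"] X by simp

lemma mixQ_integrable: "integrable (lam N) (mixQ j)" "integral\<^sup>L (lam N) (mixQ j) = 1"
  unfolding mixQ_def[abs_def] using integrable_nd[of 1 N] cardX by simp_all

lemma mixq_integrable: "integrable (lam N) mixq" "integral\<^sup>L (lam N) mixq = 1"
  unfolding mixq_def[abs_def] using mixQ_integrable cardJ by simp_all

lemma nn_integral_mixq: "(\<integral>\<^sup>+y. ennreal (mixq y) \<partial>lam N) = 1"
  using mixq_integrable mixq_pos by (subst nn_integral_eq_integral) (auto intro: less_imp_le)

lemma corr_integrable:
  assumes "x' \<in> X"
  shows "integrable (lam N) (\<lambda>y. nd N (a j x) 1 y * nd N (a j x') 1 y / mixQ j y)"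
proof (rule Bochner_Integration.integrable_bound)
  show "integrable (lam N) (\<lambda>y. card X * nd N (a j x) 1 y)"
    using integrable_nd[of 1 N] by simp
  show "(\<lambda>y. nd N (a j x) 1 y * nd N (a j x') 1 y / mixQ j y) \<in> borel_measurable (lam N)"
    by measurable
  show "AE y in lam N. norm (nd N (a j x) 1 y * nd N (a j x') 1 y / mixQ j y) \<le> norm (card X * nd N (a j x) 1 y)"
  proof (rule AE_I2)
    fix y
    have "nd N (a j x) 1 y * nd N (a j x') 1 y / mixQ j y \<le> nd N (a j x) 1 y * (card X * mixQ j y) / mixQ j y"
      using mixQ_pos[of j y] by (intro divide_right_mono mult_left_mono nd_le_mixQ assms) auto
    also have "\<dots> = card X * nd N (a j x) 1 y" using mixQ_pos[of j y] by simp
    finally show "norm (nd N (a j x) 1 y * nd N (a j x') 1 y / mixQ j y) \<le> norm (card X * nd N (a j x) 1 y)"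
      using mixQ_pos[of j y] by (simp add: abs_mult less_imp_le)
  qed
qed

lemma corr_sum:
  assumes Y: "finite Y" and f: "\<And>l. l \<in> Y \<Longrightarrow> f l \<in> X"
  shows "(\<Sum>l\<in>Y. \<Sum>l'\<in>Y. corr (f l) (f l'))
       = (\<Sum>j\<in>J. (\<integral>y. (\<Sum>l\<in>Y. nd N (a j (f l)) 1 y)\<^sup>2 / mixQ j y \<partial>lam N)) / card J"
proof -
  have "(\<Sum>l\<in>Y. \<Sum>l'\<in>Y. corr (f l) (f l'))
     = (\<Sum>j\<in>J. \<Sum>l\<in>Y. \<Sum>l'\<in>Y. (\<integral>y. nd N (a j (f l)) 1 y * nd N (a j (f l')) 1 y / mixQ j y \<partial>lam N)) / card J"
    unfolding corr_def sum_divide_distrib[symmetric]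
    by (subst sum.swap[of _ J], intro arg_cong2[where f="(/)"] sum.cong refl, subst sum.swap, rule refl)
  also have "\<dots> = (\<Sum>j\<in>J. (\<integral>y. (\<Sum>l\<in>Y. nd N (a j (f l)) 1 y)\<^sup>2 / mixQ j y \<partial>lam N)) / card J"
  proof (intro arg_cong2[where f="(/)"] sum.cong refl)
    fix j
    have "(\<Sum>l\<in>Y. \<Sum>l'\<in>Y. (\<integral>y. nd N (a j (f l)) 1 y * nd N (a j (f l')) 1 y / mixQ j y \<partial>lam N))
       = (\<integral>y. (\<Sum>l\<in>Y. \<Sum>l'\<in>Y. nd N (a j (f l)) 1 y * nd N (a j (f l')) 1 y / mixQ j y) \<partial>lam N)"
      using corr_integrable f by (simp add: Bochner_Integration.integral_sum Bochner_Integration.integrable_sum)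
    also have "\<dots> = (\<integral>y. (\<Sum>l\<in>Y. nd N (a j (f l)) 1 y)\<^sup>2 / mixQ j y \<partial>lam N)"
      by (simp add: power2_eq_square sum_product sum_divide_distrib[symmetric])
    finally show "(\<Sum>l\<in>Y. \<Sum>l'\<in>Y. (\<integral>y. nd N (a j (f l)) 1 y * nd N (a j (f l')) 1 y / mixQ j y \<partial>lam N))
       = (\<integral>y. (\<Sum>l\<in>Y. nd N (a j (f l)) 1 y)\<^sup>2 / mixQ j y \<partial>lam N)" .
  qed
  finally show ?thesis .
qed

text \<open>Summed over \<open>X\<close> the densities reproduce \<open>card X * mixQ j\<close>, so
  the kernel averages to 1, the value without leakage. This is the average hypothesis of
  \<open>codebook_exists\<close>.\<close>

lemma corr_total: "(\<Sum>x\<in>X. \<Sum>x'\<in>X. corr x x') = (real (card X))\<^sup>2"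
proof -
  have "(\<Sum>x\<in>X. \<Sum>x'\<in>X. corr x x') = (\<Sum>j\<in>J. (\<integral>y. (\<Sum>x\<in>X. nd N (a j x) 1 y)\<^sup>2 / mixQ j y \<partial>lam N)) / card J"
    using corr_sum[of X "\<lambda>x. x"] X by simp
  also have "\<dots> = (\<Sum>j\<in>J. (\<integral>y. (real (card X))\<^sup>2 * mixQ j y \<partial>lam N)) / card J"
  proof (intro arg_cong2[where f="(/)"] sum.cong refl Bochner_Integration.integral_cong)
    fix j y
    have s: "(\<Sum>x\<in>X. nd N (a j x) 1 y) = card X * mixQ j y" using cardX by (simp add: mixQ_def)
    show "(\<Sum>x\<in>X. nd N (a j x) 1 y)\<^sup>2 / mixQ j y = (real (card X))\<^sup>2 * mixQ j y"
      unfolding s using mixQ_pos[of j y] by (simp add: power2_eq_square)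
  qed
  also have "\<dots> = (real (card X))\<^sup>2" using cardJ by (simp add: mixQ_integrable)
  finally show ?thesis .
qed

text \<open>Convexity splits the mixture in the denominator into single words; each contributes the
  chi-square factor of two means at distance at most 1 per coordinate, hence at most
  \<open>exp N\<close>.\<close>

lemma corr_diag:
  assumes x: "x \<in> X" shows "corr x x \<le> exp N"
proof -
  have "corr x x \<le> (\<Sum>j\<in>J. exp N) / card J"
    unfolding corr_def
  proof (intro divide_right_mono sum_mono)
    fix j assume j: "j \<in> J"
    let ?e = "\<lambda>x'. exp (\<Sum>t<N. (a j x t - a j x' t)\<^sup>2)"
    have I: "integrable (lam N) (\<lambda>y. (\<Sum>x'\<in>X. ?e x' * nd N (\<lambda>t. 2 * a j x t - a j x' t) 1 y) / card X)"
      using integrable_nd[of 1 N] by simp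
    have "(\<integral>y. nd N (a j x) 1 y * nd N (a j x) 1 y / mixQ j y \<partial>lam N)
       \<le> (\<integral>y. (\<Sum>x'\<in>X. ?e x' * nd N (\<lambda>t. 2 * a j x t - a j x' t) 1 y) / card X \<partial>lam N)"
    proof (rule integral_mono[OF corr_integrable[OF x] I])
      fix y
      define s where "s = nd N (a j x) 1 y"
      have "s * s / mixQ j y = (\<Sum>x'\<in>X. s)\<^sup>2 / (\<Sum>x'\<in>X. nd N (a j x') 1 y) / card X"
        using cardX by (simp add: mixQ_def power2_eq_square)
      also have "\<dots> \<le> (\<Sum>x'\<in>X. s\<^sup>2 / nd N (a j x') 1 y) / card X"
        using X by (intro divide_right_mono sum_square_div_le nd1) auto
      also have "\<dots> = (\<Sum>x'\<in>X. ?e x' * nd N (\<lambda>t. 2 * a j x t - a j x' t) 1 y) / card X"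
        unfolding s_def nd_sq_div ..
      finally show "nd N (a j x) 1 y * nd N (a j x) 1 y / mixQ j y \<le> \<dots>" unfolding s_def .
    qed
    also have "\<dots> = (\<Sum>x'\<in>X. ?e x') / card X"
      using integrable_nd[of 1 N] by simp
    also have "\<dots> \<le> (\<Sum>x'\<in>X. exp N) / card X"
    proof (intro divide_right_mono sum_mono)
      fix x' assume x': "x' \<in> X"
      have "(\<Sum>t<N. (a j x t - a j x' t)\<^sup>2) \<le> (\<Sum>t<N. 1)"
        using close[OF _ j x x'] by (intro sum_mono) (auto simp: abs_square_le_1)
      then show "?e x' \<le> exp N" by simp
    qed auto
    also have "\<dots> = exp N" using cardX by simp
    finally show "(\<integral>y. nd N (a j x) 1 y * nd N (a j x) 1 y / mixQ j y \<partial>lam N) \<le> exp N" .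
  qed auto
  also have "\<dots> = exp N" using cardJ by simp
  finally show ?thesis .
qed

text \<open>Convexity over \<open>j\<close> bounds the chi-square of the mixture by the average of
  the conditional ones: revealing the message of user 1 can only increase the bound. The conditional
  squares expand into the kernel \<open>corr\<close>.\<close>

lemma chi_square_le:
  fixes f :: "nat \<Rightarrow> 'x"
  assumes L: "1 \<le> L" and f: "\<And>l. l < L \<Longrightarrow> f l \<in> X"
    and p: "\<And>y. y \<in> space (out_space N) \<Longrightarrow> p y = (\<Sum>l<L. (\<Sum>j\<in>J. nd N (a j (f l)) 1 y) / card J) / L"
  shows "(\<integral>\<^sup>+y. ennreal ((p y)\<^sup>2 / mixq y) \<partial>lam N) \<le> ennreal ((\<Sum>l<L. \<Sum>l'<L. corr (f l) (f l')) / (real L)\<^sup>2)"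
proof -
  let ?P = "\<lambda>j y. (\<Sum>l<L. nd N (a j (f l)) 1 y)"
  let ?H = "\<lambda>y. (\<Sum>j\<in>J. (?P j y)\<^sup>2 / mixQ j y) / card J / (real L)\<^sup>2"
  have L0: "0 < real L" using L by simp
  have IJ: "integrable (lam N) (\<lambda>y. (?P j y)\<^sup>2 / mixQ j y)" for j
  proof -
    have "integrable (lam N) (\<lambda>y. (\<Sum>l<L. \<Sum>l'<L. nd N (a j (f l)) 1 y * nd N (a j (f l')) 1 y / mixQ j y))"
      using corr_integrable f by (intro Bochner_Integration.integrable_sum) auto
    then show ?thesis by (simp add: power2_eq_square sum_product sum_divide_distrib[symmetric])
  qed
  have IH: "integrable (lam N) ?H" using IJ by simp
  have Hnn: "0 \<le> ?H y" for y
    using mixQ_pos by (intro divide_nonneg_nonneg sum_nonneg) (auto intro: less_imp_le)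
  have "(\<integral>\<^sup>+y. ennreal ((p y)\<^sup>2 / mixq y) \<partial>lam N) \<le> (\<integral>\<^sup>+y. ennreal (?H y) \<partial>lam N)"
  proof (intro nn_integral_mono ennreal_leI)
    fix y assume "y \<in> space (lam N)"
    then have y: "y \<in> space (out_space N)" by (simp add: space_lam)
    have "p y = (\<Sum>j\<in>J. ?P j y) / card J / L"
      unfolding p[OF y] by (simp add: sum_divide_distrib[symmetric] sum.swap[of _ J])
    then have "(p y)\<^sup>2 / mixq y = (\<Sum>j\<in>J. ?P j y)\<^sup>2 / (\<Sum>j\<in>J. mixQ j y) / card J / (real L)\<^sup>2"
      using cardJ by (simp add: mixq_def power_divide power2_eq_square)
    also have "\<dots> \<le> ?H y"
      using J by (intro divide_right_mono sum_square_div_le mixQ_pos) auto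
    finally show "(p y)\<^sup>2 / mixq y \<le> ?H y" .
  qed
  also have "\<dots> = ennreal (integral\<^sup>L (lam N) ?H)"
    using IH Hnn by (intro nn_integral_eq_integral) auto
  also have "integral\<^sup>L (lam N) ?H = (\<Sum>l<L. \<Sum>l'<L. corr (f l) (f l')) / (real L)\<^sup>2"
    using IJ corr_sum[of "{..<L}" f] f by simp
  finally show ?thesis .
qed

text \<open>From \<open>(p - q)\<^sup>2 / q \<ge> 0\<close>, that is
  \<open>p\<^sup>2 / q + q \<ge> 2 * p\<close>, integrated with both masses equal to 1. It separates
  error and leakage in the joint codebook bound.\<close>

lemma chi_square_ge_1:
  fixes p :: "(nat \<Rightarrow> real) \<Rightarrow> real"
  assumes [measurable]: "p \<in> borel_measurable (out_space N)" and pnn: "\<And>y. y \<in> space (out_space N) \<Longrightarrow> 0 \<le> p y"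
    and p1: "(\<integral>\<^sup>+y. ennreal (p y) \<partial>lam N) = 1"
  shows "1 \<le> (\<integral>\<^sup>+y. ennreal ((p y)\<^sup>2 / mixq y) \<partial>lam N)"
proof -
  have "2 = (\<integral>\<^sup>+y. 2 * ennreal (p y) \<partial>lam N)" using p1 by (simp add: nn_integral_cmult)
  also have "\<dots> \<le> (\<integral>\<^sup>+y. ennreal ((p y)\<^sup>2 / mixq y) + ennreal (mixq y) \<partial>lam N)"
  proof (rule nn_integral_mono)
    fix y assume "y \<in> space (lam N)"
    then have p0: "0 \<le> p y" using pnn by (simp add: space_lam)
    have "0 \<le> (p y - mixq y)\<^sup>2 / mixq y" using mixq_pos[of y] by simp
    also have "\<dots> = (p y)\<^sup>2 / mixq y - 2 * p y + mixq y"
      using mixq_pos[of y] by (simp add: power2_eq_square field_simps)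
    finally have "2 * p y \<le> (p y)\<^sup>2 / mixq y + mixq y" by simp
    then have "ennreal (2 * p y) \<le> ennreal ((p y)\<^sup>2 / mixq y + mixq y)" by (rule ennreal_leI)
    then show "2 * ennreal (p y) \<le> ennreal ((p y)\<^sup>2 / mixq y) + ennreal (mixq y)"
      using p0 mixq_pos[of y] by (simp add: ennreal_mult ennreal_plus less_imp_le del: ennreal_leI)
  qed
  also have "\<dots> = (\<integral>\<^sup>+y. ennreal ((p y)\<^sup>2 / mixq y) \<partial>lam N) + 1"
    by (subst nn_integral_add) (auto simp: nn_integral_mixq)
  also have "\<dots> = 1 + (\<integral>\<^sup>+y. ennreal ((p y)\<^sup>2 / mixq y) \<partial>lam N)" by (rule add.commute)
  finally have "1 + 1 \<le> 1 + (\<integral>\<^sup>+y. ennreal ((p y)\<^sup>2 / mixq y) \<partial>lam N)" by (simp only: one_add_one)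
  then show ?thesis by (simp only: ennreal_add_left_cancel_le) auto
qed

end

section \<open>Pulse amplitude modulation: encoders, decoder and leakage\<close>

context cooperative_code
begin

lemma case_eqs:
  "(\<lambda>(w1, w2, u1, u2, z1, z2). x1 w1 u1 t (\<lambda>s. lnk w2 u2 s)) = (\<lambda>\<omega>. X1f \<omega> t)"
  "(\<lambda>(w1, w2, u1, u2, z1, z2). x2 w2 u2 t) = (\<lambda>\<omega>. X2f \<omega> t)"
  "(\<lambda>(w1, w2, u1, u2, z1, z2). w1) = W1" "(\<lambda>(w1, w2, u1, u2, z1, z2). w2) = W2"
  "(case \<omega> of (w1, w2, u1, u2, z1, z2) \<Rightarrow> z1 t) = iz1 \<omega> t"
  "(case \<omega> of (w1, w2, u1, u2, z1, z2) \<Rightarrow> z2 t) = iz2 \<omega> t"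
  "restrict (\<lambda>t. h_d * X1f \<omega> t + h_c * X2f \<omega> t + iz1 \<omega> t) {..<N} = Y1 \<omega>"
  "restrict (\<lambda>t. h_d * X2f \<omega> t + iz2 \<omega> t) {..<N} = Y2 \<omega>"
  by (auto simp: X1f_def X2f_def W1_def W2_def Y1_def Y2_def shift_def e1_def e2_def fun_eq_iff split: prod.split)

lemma secure_codeI:
  assumes "\<And>w u t. t < N \<Longrightarrow> lnk w u t < Lk t" and "\<And>t. t < N \<Longrightarrow> 1 \<le> Lk t"
    and "(\<Sum>t<N. log 2 (real (Lk t))) \<le> real N * CG"
    and "g1 \<in> measurable OUT (count_space UNIV)" "g2 \<in> measurable OUT (count_space UNIV)"
    and "\<And>t. t < N \<Longrightarrow> integrable Om (\<lambda>\<omega>. (X1f \<omega> t)\<^sup>2) \<and> integral\<^sup>L Om (\<lambda>\<omega>. (X1f \<omega> t)\<^sup>2) \<le> P"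
    and "\<And>t. t < N \<Longrightarrow> integrable Om (\<lambda>\<omega>. (X2f \<omega> t)\<^sup>2) \<and> integral\<^sup>L Om (\<lambda>\<omega>. (X2f \<omega> t)\<^sup>2) \<le> P"
    and "measure Om {\<omega> \<in> space Om. g1 (Y1 \<omega>) \<noteq> W1 \<omega>} \<le> eps"
    and "measure Om {\<omega> \<in> space Om. g2 (Y2 \<omega>) \<noteq> W2 \<omega>} \<le> eps"
    and "leakage \<le> lk"
  shows "secure_code h_d h_c P CG N m1 m2 eps lk"
  unfolding secure_code_def Let_def
  apply (rule exI[of _ \<mu>1], rule exI[of _ \<mu>2], rule exI[of _ x1], rule exI[of _ x2], rule exI[of _ lnk],
     rule exI[of _ Lk], rule exI[of _ g1], rule exI[of _ g2])
  unfolding case_eqs Om_def[symmetric]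
  apply (intro conjI)
                   apply (rule prob_\<mu>1, rule sets_\<mu>1, rule prob_\<mu>2, rule sets_\<mu>2)
               apply (rule allI, rule allI, rule allI, rule x1_meas)
              apply (rule allI, rule allI, rule x2_meas)
             apply (rule allI, rule allI, rule lnk_meas)
            apply (intro allI impI, rule causal, erule allE, erule mp, assumption)
           apply (intro allI impI, erule assms(1), intro allI impI, erule assms(2))
         apply (rule assms(3), rule assms(4), rule assms(5))
      apply (rule allI, rule impI, erule assms(6))
     apply (rule allI, rule impI, erule assms(7))
    apply (rule assms(8), rule assms(9), rule assms(10)[unfolded leakage_def])
  done

lemma nn_integral_parts:
  shows "F \<in> borel_measurable A1 \<Longrightarrow> (\<integral>\<^sup>+\<omega>. F (ia \<omega>) \<partial>Om) = (\<integral>\<^sup>+a. F a \<partial>A1)"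
    and "F \<in> borel_measurable A2 \<Longrightarrow> (\<integral>\<^sup>+\<omega>. F (ib \<omega>) \<partial>Om) = (\<integral>\<^sup>+a. F a \<partial>A2)"
    and "H \<in> borel_measurable OUT \<Longrightarrow> (\<integral>\<^sup>+\<omega>. H (iz1 \<omega>) \<partial>Om) = (\<integral>\<^sup>+z. H z \<partial>noise)"
    and "H \<in> borel_measurable OUT \<Longrightarrow> (\<integral>\<^sup>+\<omega>. H (iz2 \<omega>) \<partial>Om) = (\<integral>\<^sup>+z. H z \<partial>noise)"
  by (subst nn_integral_Om; simp add: NO.emeasure_space_1 A1.emeasure_space_1 A2.emeasure_space_1 measurable_compose[OF measurable_inputs(1)]
     measurable_compose[OF measurable_inputs(2)] measurable_compose[OF measurable_inputs(3)] measurable_compose[OF measurable_inputs(4)])+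

end

text \<open>Rounding to the nearest grid point. Values below the grid become 0 through
  \<open>nat\<close>, and values above the alphabet are not capped; such symbols merely count as
  Hamming errors.\<close>

definition demod :: "real \<Rightarrow> real \<Rightarrow> nat" where
  "demod D y = nat \<lfloor>y / D + 1 / 2\<rfloor>"

lemma measurable_demod [measurable]: "demod D \<in> measurable borel (count_space UNIV)"
  unfolding demod_def[abs_def] by measurable

lemma demod_eq:
  assumes "0 < D" "\<bar>y - real i * D\<bar> < D / 2" shows "demod D y = i"
proof -
  have "y - real i * D < D / 2" "- (D / 2) < y - real i * D"
    using assms(2) unfolding abs_less_iff by linarith+
  then have "(y - real i * D) / D < 1 / 2" "- 1 / 2 < (y - real i * D) / D"
    using assms(1) by (simp_all add: divide_less_eq less_divide_eq)
  moreover have "(y - real i * D) / D = y / D - real i" using assms(1) by (simp add: diff_divide_distrib)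
  ultimately have "\<bar>y / D - real i\<bar> < 1 / 2" unfolding abs_less_iff by linarith
  then have "\<lfloor>y / D + 1 / 2\<rfloor> = int i" unfolding floor_eq_iff of_int_of_nat_eq abs_less_iff by (intro conjI; linarith)
  then show ?thesis by (simp add: demod_def)
qed

text \<open>Half the spacing is \<open>T + 1\<close>, so a wrong symbol needs
  \<open>T + 1 \<le> \<bar>r t + z t\<bar>\<close>. With a residual of at most one half the noise
  exceeds \<open>T\<close>.\<close>

lemma hamming_demod_le:
  assumes D: "D = 2 * T + 2" "0 \<le> T"
    and y: "\<And>t. t < N \<Longrightarrow> y t = real (c t) * D + r t + z t" and r: "\<And>t. t < N \<Longrightarrow> \<bar>r t\<bar> \<le> 1 / 2"
  shows "hamming N (\<lambda>t. demod D (y t)) c \<le> outliers N T z"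
  unfolding hamming_def outliers_def
proof (intro card_mono subsetI)
  fix t assume "t \<in> {t. t < N \<and> demod D (y t) \<noteq> c t}"
  then have t: "t < N" "demod D (y t) \<noteq> c t" by auto
  then have "D / 2 \<le> \<bar>y t - real (c t) * D\<bar>" using demod_eq[of D "y t" "c t"] D by force
  then have "T + 1 \<le> \<bar>r t + z t\<bar>" using y[OF t(1)] D by simp
  then have "T < \<bar>z t\<bar>" using r[OF t(1)] by linarith
  with t show "t \<in> {t. t < N \<and> T < \<bar>z t\<bar>}" by simp
qed simp

text \<open>The decoder accepts a message if any of its dummy words is within distance
  \<open>d\<close> of the hard decisions. If there is none, \<open>LEAST\<close> is arbitrary; this
  case is covered by the outlier probability.\<close>

definition dec :: "nat \<Rightarrow> real \<Rightarrow> nat \<Rightarrow> nat \<Rightarrow> nat \<Rightarrow> (nat \<times> nat \<Rightarrow> nat \<Rightarrow> nat) \<Rightarrow> (nat \<Rightarrow> real) \<Rightarrow> nat" where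
  "dec N D d m K c y = (LEAST w. w \<in> {1..m} \<and> (\<exists>l<K. hamming N (\<lambda>t. demod D (y t)) (c (w, l)) \<le> d))"

lemma measurable_dec: "dec N D d m K c \<in> measurable (out_space N) (count_space UNIV)"
proof -
  have h: "(\<lambda>y. hamming N (\<lambda>t. demod D (y t)) x) \<in> measurable (out_space N) (count_space UNIV)" for x
  proof -
    have [measurable]: "(\<lambda>y. demod D (y t)) \<in> measurable (out_space N) (count_space UNIV)" if "t < N" for t
      by (rule measurable_compose[OF measurable_out_space_component[OF that] measurable_demod])
    have "(\<lambda>y. (\<Sum>t<N. if demod D (y t) = x t then 0 else 1) :: nat) \<in> measurable (out_space N) (count_space UNIV)"
      by measurable
    moreover have "hamming N (\<lambda>t. demod D (y t)) x = (\<Sum>t<N. if demod D (y t) = x t then 0 else 1)" for y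
      by (simp add: hamming_def sum.If_cases Int_def lessThan_def)
    ultimately show ?thesis by simp
  qed
  note h[measurable]
  show ?thesis unfolding dec_def[abs_def] by measurable
qed

abbreviation "confusable N d \<equiv> (\<lambda>x x'. hamming N x x' \<le> 2 * d)"

text \<open>Two accepted words of different messages would be within \<open>2 * d\<close> of each
  other by the triangle inequality, which a good index excludes; this is why
  \<open>confusable\<close> uses the doubled radius.\<close>

lemma dec_correct:
  assumes i: "w \<in> {1..m}" "l < K" and bad: "(w, l) \<notin> bad_index m K (confusable N d) c"
    and y: "hamming N (\<lambda>t. demod D (y t)) (c (w, l)) \<le> d"
  shows "dec N D d m K c y = w"
  unfolding dec_def
proof (rule Least_equality)
  show "w \<in> {1..m} \<and> (\<exists>l<K. hamming N (\<lambda>t. demod D (y t)) (c (w, l)) \<le> d)" using i y by blast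
  fix w' assume "w' \<in> {1..m} \<and> (\<exists>l<K. hamming N (\<lambda>t. demod D (y t)) (c (w', l)) \<le> d)"
  then obtain l' where w': "w' \<in> {1..m}" "l' < K" "hamming N (\<lambda>t. demod D (y t)) (c (w', l')) \<le> d" by blast
  have "hamming N (c (w, l)) (c (w', l')) \<le> d + d"
    using hamming_triangle[of N "c (w, l)" "c (w', l')" "\<lambda>t. demod D (y t)"] y w'(3)
    by (simp add: hamming_commute[of N "c (w, l)"])
  then have "w' = w" using bad i w' unfolding bad_index_def by force
  then show "w \<le> w'" by simp
qed

text \<open>Local randomness is real valued in the model, so the dummy index is embedded into the
  reals and read back by the floor function.\<close>

definition uniform_key :: "nat \<Rightarrow> real measure" where
  "uniform_key L = distr (measure_pmf (pmf_of_set {..<L})) borel real"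

lemma prob_uniform_key: "prob_space (uniform_key L)"
  unfolding uniform_key_def by (rule measure_pmf.prob_space_distr) simp

lemma nn_integral_uniform_key:
  assumes [measurable]: "F \<in> borel_measurable borel" and L: "1 \<le> L"
  shows "(\<integral>\<^sup>+u. F u \<partial>uniform_key L) = (\<Sum>l<L. F (real l)) / of_nat L"
proof -
  have "(\<integral>\<^sup>+u. F u \<partial>uniform_key L) = (\<integral>\<^sup>+l. F (real l) \<partial>measure_pmf (pmf_of_set {..<L}))"
    unfolding uniform_key_def by (subst nn_integral_distr) auto
  then show ?thesis using L by (simp add: nn_integral_pmf_of_set lessThan_empty_iff)
qed

lemma avg_ennreal:
  assumes "\<And>i. i \<in> A \<Longrightarrow> 0 \<le> f i" "1 \<le> n"
  shows "(\<Sum>i\<in>A. ennreal (f i)) / of_nat n = ennreal ((\<Sum>i\<in>A. f i) / real n)"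
  using assms by (simp add: sum_ennreal sum_nonneg divide_ennreal[symmetric] ennreal_of_nat_eq_real_of_nat)

lemma measurable_nat_floor: "(\<lambda>u::real. nat \<lfloor>u\<rfloor>) \<in> measurable borel (count_space UNIV)"
  by measurable

text \<open>The division by \<open>hD\<close> inverts the direct gain. The subtracted term is the
  coarse interference as receiver 1 will get it, known from the current link symbol. User 1 sends
  the words with dummy index 0.\<close>

definition pam_x1 :: "real \<Rightarrow> real \<Rightarrow> real \<Rightarrow> nat \<Rightarrow> (nat \<times> nat \<Rightarrow> nat \<Rightarrow> nat) \<Rightarrow> nat \<Rightarrow> real \<Rightarrow> nat \<Rightarrow> (nat \<Rightarrow> nat) \<Rightarrow> real" where
  "pam_x1 hD hC D Mf c w u t ls = (real (c (w, 0) t) * D - hC * (real (ls t * Mf) * D / hD)) / hD"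

definition pam_x2 :: "real \<Rightarrow> real \<Rightarrow> (nat \<times> nat \<Rightarrow> nat \<Rightarrow> nat) \<Rightarrow> nat \<Rightarrow> real \<Rightarrow> nat \<Rightarrow> real" where
  "pam_x2 hD D c w u t = real (c (w, nat \<lfloor>u\<rfloor>) t) * D / hD"

definition pam_link :: "nat \<Rightarrow> (nat \<times> nat \<Rightarrow> nat \<Rightarrow> nat) \<Rightarrow> nat \<Rightarrow> real \<Rightarrow> nat \<Rightarrow> nat" where
  "pam_link Mf c w u t = c (w, nat \<lfloor>u\<rfloor>) t div Mf"

definition words :: "nat \<Rightarrow> nat \<Rightarrow> (nat \<Rightarrow> nat) set" where
  "words N M = Pi\<^sub>E {..<N} (\<lambda>_. {..<M})"

text \<open>The noiseless signal at receiver 1 after cancellation: the symbol of user 1 plus the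
  remainder modulo \<open>Mf\<close> of the symbol of user 2.\<close>

definition pam_mean :: "real \<Rightarrow> real \<Rightarrow> real \<Rightarrow> nat \<Rightarrow> (nat \<times> nat \<Rightarrow> nat \<Rightarrow> nat) \<Rightarrow> nat \<Rightarrow> (nat \<Rightarrow> nat) \<Rightarrow> nat \<Rightarrow> real" where
  "pam_mean hD hC D Mf c w x t = real (c (w, 0) t) * D + hC * (real (x t mod Mf) * D / hD)"

lemma indicator_sum_less_1:
  assumes "\<not> (1::ennreal) \<le> indicator (- A) x + indicator B y"
  shows "x \<in> A" "y \<notin> B"
proof -
  have "(1::ennreal) \<le> 1 + c" "(1::ennreal) \<le> c + 1" for c
    by (rule add_increasing2[OF zero_le order_refl], rule add_increasing[OF zero_le order_refl])
  then show "x \<in> A" "y \<notin> B" using assms by (metis ComplI indicator_simps(1))+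
qed

text \<open>Transmitter 2 sends the symbol \<open>c2 (w, l) t\<close>, whose coarse part (the quotient by \<open>Mf\<close>) goes over the
  link and is cancelled at receiver 1; the fine part reaches receiver 1 below the noise level.
  The index \<open>l\<close> is a uniform dummy message.\<close>

locale pam_scheme =
  fixes h_d h_c P D T \<delta> :: real and N M1 Mf Mc L m1 m2 :: nat
    and c1 c2 :: "nat \<times> nat \<Rightarrow> nat \<Rightarrow> nat"
  assumes hd: "h_d \<noteq> 0" and P0: "0 < P" and D: "D = 2 * T + 2" and T: "0 \<le> T" and \<delta>: "0 \<le> \<delta>"
    and Mf: "1 \<le> Mf" and L: "1 \<le> L" and m1: "1 \<le> m1" and m2: "1 \<le> m2"
    and pow1: "real M1 * D \<le> \<bar>h_d\<bar> * sqrt P / 2"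
    and fine: "\<bar>h_c\<bar> * ((real Mf - 1) * D) / \<bar>h_d\<bar> \<le> 1 / 2"
    and pow2: "(real (Mf * Mc) - 1) * D \<le> \<bar>h_d\<bar> * sqrt P"
    and pow3: "\<bar>h_c\<bar> * ((real (Mf * Mc) - 1) * D) / \<bar>h_d\<bar> \<le> \<bar>h_d\<bar> * sqrt P / 2"
    and c1: "\<And>i. c1 i \<in> words N M1" and c2: "\<And>i. c2 i \<in> words N (Mf * Mc)"
    and noise_tail: "(\<integral>\<^sup>+z. indicator {z. \<delta> * N < outliers N T z} z \<partial>noise_vec N) \<le> ennreal ((1 / 2) ^ N)"
begin

lemma prob_\<mu>1: "prob_space (return borel (0::real))"
  by (rule prob_space_return) simp

sublocale cooperative_code h_d h_c N m1 m2 "return borel 0" "uniform_key L"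
  "pam_x1 h_d h_c D Mf c1" "pam_x2 h_d D c2" "pam_link Mf c2"
proof (rule cooperative_code.intro)
  show "(\<lambda>u. pam_x2 h_d D c2 w u t) \<in> borel_measurable borel" for w t
    unfolding pam_x2_def
    by (rule measurable_compose[OF measurable_nat_floor, of "\<lambda>l. real (c2 (w, l) t) * D / h_d"]) simp
  show "(\<lambda>u. pam_link Mf c2 w u t) \<in> measurable borel (count_space UNIV)" for w t
    unfolding pam_link_def
    by (rule measurable_compose[OF measurable_nat_floor, of "\<lambda>l. c2 (w, l) t div Mf"]) simp
  show "(\<lambda>u. pam_x1 h_d h_c D Mf c1 w u t ls) \<in> borel_measurable borel" for w t ls
    unfolding pam_x1_def by simp
  show "pam_x1 h_d h_c D Mf c1 w u t ls = pam_x1 h_d h_c D Mf c1 w u t ls'"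
    if "\<And>s. s \<le> t \<Longrightarrow> ls s = ls' s" for w u t ls ls'
    unfolding pam_x1_def using that[of t] by simp
qed (use m1 m2 prob_\<mu>1 prob_uniform_key in \<open>auto simp: uniform_key_def\<close>)

definition "Dd = nat \<lfloor>\<delta> * N\<rfloor>"

lemma D0: "0 < D" using D T by simp

lemma c1_less: "t < N \<Longrightarrow> c1 i t < M1" and c2_less: "t < N \<Longrightarrow> c2 i t < Mf * Mc"
  using c1[of i] c2[of i] by (auto simp: words_def)

text \<open>Division with remainder splits the symbol; the link is noiseless, so the coarse part
  cancels exactly.\<close>

lemma e1_pam: "e1 a b t = pam_mean h_d h_c D Mf c1 (fst a) (c2 (fst b, nat \<lfloor>snd b\<rfloor>)) t"
proof -
  define x where "x = c2 (fst b, nat \<lfloor>snd b\<rfloor>) t"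
  have "real x = real (x div Mf * Mf) + real (x mod Mf)"
    by (metis div_mult_mod_eq of_nat_add)
  then have "h_c * (real x * D / h_d) = h_c * (real (x div Mf * Mf) * D / h_d) + h_c * (real (x mod Mf) * D / h_d)"
    by (simp add: add_divide_distrib distrib_left distrib_right)
  then show ?thesis
    using hd by (simp add: e1_def pam_x1_def pam_x2_def pam_link_def pam_mean_def x_def)
qed

lemma fine_bound: "\<bar>h_c * (real (x mod Mf) * D / h_d)\<bar> \<le> 1 / 2"
proof -
  have "x mod Mf < Mf" using Mf by (intro mod_less_divisor) simp
  then have "real (x mod Mf) \<le> real Mf - 1" by linarith
  then have "\<bar>h_c\<bar> * (real (x mod Mf) * D) / \<bar>h_d\<bar> \<le> \<bar>h_c\<bar> * ((real Mf - 1) * D) / \<bar>h_d\<bar>"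
    using D0 by (intro divide_right_mono mult_left_mono mult_right_mono) auto
  moreover have "\<bar>h_c * (real (x mod Mf) * D / h_d)\<bar> = \<bar>h_c\<bar> * (real (x mod Mf) * D) / \<bar>h_d\<bar>"
    using D0 by (simp add: abs_mult)
  ultimately show ?thesis using fine by linarith
qed

lemma Y1_pam: "t < N \<Longrightarrow> Y1 \<omega> t = real (c1 (W1 \<omega>, 0) t) * D
     + h_c * (real (c2 (fst (ib \<omega>), nat \<lfloor>snd (ib \<omega>)\<rfloor>) t mod Mf) * D / h_d) + iz1 \<omega> t"
  by (simp add: Y1_def shift_def e1_pam pam_mean_def W1_def)

lemma Y2_pam: "t < N \<Longrightarrow> Y2 \<omega> t = real (c2 (fst (ib \<omega>), nat \<lfloor>snd (ib \<omega>)\<rfloor>) t) * D + 0 + iz2 \<omega> t"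
  using hd by (simp add: Y2_def shift_def e2_def pam_x2_def)

lemma small_outliers: "\<not> \<delta> * N < outliers N T z \<Longrightarrow> outliers N T z \<le> Dd"
  unfolding Dd_def by (simp add: le_nat_floor not_less)

abbreviation "g1 \<equiv> dec N D Dd m1 1 c1"
abbreviation "g2 \<equiv> dec N D Dd m2 L c2"
abbreviation "bad1 \<equiv> bad_index m1 1 (confusable N Dd) c1"
abbreviation "bad2 \<equiv> bad_index m2 L (confusable N Dd) c2"

lemma outlier_indicator_measurable:
  "(\<lambda>z. indicator {z. \<delta> * N < outliers N T z} z :: ennreal) \<in> borel_measurable OUT"
proof -
  have "(\<lambda>n::nat. indicator {n. \<delta> * real N < real n} n :: ennreal) \<in> borel_measurable (count_space UNIV)" by simp
  from measurable_compose[OF measurable_outliers[of N T] this] show ?thesis by (simp add: indicator_def)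
qed

lemma error_prob_le:
  assumes E: "E \<in> sets Om" and F: "(\<lambda>\<omega>. F \<omega>) \<in> borel_measurable Om" and H: "(\<lambda>\<omega>. H \<omega>) \<in> borel_measurable Om"
    and le: "\<And>\<omega>. \<omega> \<in> E \<Longrightarrow> (1::ennreal) \<le> F \<omega> + H \<omega>"
    and "(\<integral>\<^sup>+\<omega>. F \<omega> \<partial>Om) \<le> ennreal p" "(\<integral>\<^sup>+\<omega>. H \<omega> \<partial>Om) \<le> ennreal q" "0 \<le> p" "0 \<le> q"
  shows "measure Om E \<le> p + q"
proof -
  have "ennreal (measure Om E) = emeasure Om E" by (rule Om.emeasure_eq_measure[symmetric])
  also have "\<dots> = (\<integral>\<^sup>+\<omega>. indicator E \<omega> \<partial>Om)" using E by simp
  also have "\<dots> \<le> (\<integral>\<^sup>+\<omega>. F \<omega> + H \<omega> \<partial>Om)"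
    by (intro nn_integral_mono) (auto simp: indicator_def le)
  also have "\<dots> = (\<integral>\<^sup>+\<omega>. F \<omega> \<partial>Om) + (\<integral>\<^sup>+\<omega>. H \<omega> \<partial>Om)" by (rule nn_integral_add[OF F H])
  also have "\<dots> \<le> ennreal p + ennreal q" using assms by (intro add_mono) auto
  also have "\<dots> = ennreal (p + q)" using assms by (simp add: ennreal_plus)
  finally have "ennreal (measure Om E) \<le> ennreal (p + q)" .
  then show ?thesis using assms by (subst (asm) ennreal_le_iff) auto
qed

text \<open>An error requires a bad index or more than \<open>\<delta> * N\<close> outliers:
  otherwise the fine part and the noise together spoil at most \<open>Dd\<close> symbols and
  \<open>dec_correct\<close> applies.\<close>

lemma error1: "measure Om {\<omega> \<in> space Om. g1 (Y1 \<omega>) \<noteq> W1 \<omega>} \<le> card bad1 / m1 + (1 / 2) ^ N"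
proof (rule error_prob_le)
  let ?F = "\<lambda>a::nat \<times> real. indicator (- {w. w \<in> {1..m1} \<and> (w, 0) \<notin> bad1}) (fst a) :: ennreal"
  show "{\<omega> \<in> space Om. g1 (Y1 \<omega>) \<noteq> W1 \<omega>} \<in> sets Om"
    by (rule error_event_measurable[OF measurable_Ms[OF measurable_W(1) measurable_Y(1) measurable_dec]])
  have FM: "?F \<in> borel_measurable A1" by (rule measurable_compose[OF measurable_fst_A(1)]) simp
  show "(\<lambda>\<omega>. ?F (ia \<omega>)) \<in> borel_measurable Om" by (rule measurable_compose[OF measurable_inputs(1) FM])
  show "(\<lambda>\<omega>. indicator {z. \<delta> * N < outliers N T z} (iz1 \<omega>) :: ennreal) \<in> borel_measurable Om"
    by (rule measurable_compose[OF measurable_inputs(3) outlier_indicator_measurable])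
  show "(\<integral>\<^sup>+\<omega>. indicator {z. \<delta> * N < outliers N T z} (iz1 \<omega>) \<partial>Om) \<le> ennreal ((1 / 2) ^ N)"
    by (subst nn_integral_parts(3)[OF outlier_indicator_measurable]) (rule noise_tail)
  have "(\<integral>\<^sup>+\<omega>. ?F (ia \<omega>) \<partial>Om) = (\<Sum>w=1..m1. ennreal (indicator {w. (w, 0) \<in> bad1} w)) / of_nat m1"
    unfolding nn_integral_parts(1)[OF FM] nn_integral_A1_fst nn_integral_p1
    by (intro arg_cong2[where f="(/)"] sum.cong refl) (auto simp: indicator_def)
  also have "\<dots> = ennreal ((\<Sum>w=1..m1. indicator {w. (w, 0) \<in> bad1} w) / m1)"
    using m1 by (intro avg_ennreal) auto
  also have "(\<Sum>w=1..m1. indicator {w. (w, 0) \<in> bad1} w :: real) = card bad1"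
  proof -
    define B where "B = bad1"
    have "snd i = 0 \<and> fst i \<in> {1..m1}" if "i \<in> B" for i using that by (auto simp: B_def bad_index_def)
    then have "B = (\<lambda>w. (w, 0)) ` {w \<in> {1..m1}. (w, 0) \<in> B}" by force
    then have "bad1 = (\<lambda>w. (w, 0)) ` {w \<in> {1..m1}. (w, 0) \<in> bad1}" unfolding B_def .
    then have "card bad1 = card {w \<in> {1..m1}. (w, 0) \<in> bad1}"
      by (metis (no_types, lifting) card_image inj_on_def prod.inject)
    then show ?thesis by (simp add: indicator_def sum.If_cases Int_def)
  qed
  finally show "(\<integral>\<^sup>+\<omega>. ?F (ia \<omega>) \<partial>Om) \<le> ennreal (card bad1 / m1)" by simp
  fix \<omega> assume "\<omega> \<in> {\<omega> \<in> space Om. g1 (Y1 \<omega>) \<noteq> W1 \<omega>}"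
  then have ne: "g1 (Y1 \<omega>) \<noteq> W1 \<omega>" by simp
  show "1 \<le> ?F (ia \<omega>) + indicator {z. \<delta> * N < outliers N T z} (iz1 \<omega>)"
  proof (rule ccontr)
    assume neg: "\<not> 1 \<le> ?F (ia \<omega>) + indicator {z. \<delta> * N < outliers N T z} (iz1 \<omega>)"
    then have a: "W1 \<omega> \<in> {1..m1}" "(W1 \<omega>, 0) \<notin> bad1" and b: "\<not> \<delta> * N < outliers N T (iz1 \<omega>)"
      using indicator_sum_less_1[OF neg] by (simp_all add: W1_def)
    have "hamming N (\<lambda>t. demod D (Y1 \<omega> t)) (c1 (W1 \<omega>, 0)) \<le> outliers N T (iz1 \<omega>)"
      by (rule hamming_demod_le[OF D T Y1_pam fine_bound])
    also have "\<dots> \<le> Dd" by (rule small_outliers[OF b])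
    finally show False using ne dec_correct[OF a(1) _ a(2)] by simp
  qed
qed auto

text \<open>As for user 1, without residual interference. Message and key are independent and
  uniform, so the probability of a bad index is the relative size of \<open>bad2\<close>.\<close>

lemma error2: "measure Om {\<omega> \<in> space Om. g2 (Y2 \<omega>) \<noteq> W2 \<omega>} \<le> card bad2 / (m2 * L) + (1 / 2) ^ N"
proof (rule error_prob_le)
  let ?S = "{i. i \<in> {1..m2} \<times> {..<L} \<and> i \<notin> bad2}"
  let ?F = "\<lambda>b::nat \<times> real. indicator (- ?S) (fst b, nat \<lfloor>snd b\<rfloor>) :: ennreal"
  show "{\<omega> \<in> space Om. g2 (Y2 \<omega>) \<noteq> W2 \<omega>} \<in> sets Om"
    by (rule error_event_measurable[OF measurable_Ms[OF measurable_W(2) measurable_Y(2) measurable_dec]])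
  have Fw: "(\<lambda>u::real. indicator (- ?S) (w, nat \<lfloor>u\<rfloor>) :: ennreal) \<in> borel_measurable borel" for w
  proof -
    have "(\<lambda>l. indicator (- ?S) (w, l) :: ennreal) \<in> borel_measurable (count_space UNIV)" by simp
    from measurable_compose[OF measurable_nat_floor this] show ?thesis .
  qed
  have FM: "?F \<in> borel_measurable A2"
    unfolding A2_def by (rule measurable_pmf_pair) (subst measurable_cong_sets[OF sets_\<mu>2 refl], rule Fw)
  show "(\<lambda>\<omega>. ?F (ib \<omega>)) \<in> borel_measurable Om" by (rule measurable_compose[OF measurable_inputs(2) FM])
  show "(\<lambda>\<omega>. indicator {z. \<delta> * N < outliers N T z} (iz2 \<omega>) :: ennreal) \<in> borel_measurable Om"
    by (rule measurable_compose[OF measurable_inputs(4) outlier_indicator_measurable])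
  show "(\<integral>\<^sup>+\<omega>. indicator {z. \<delta> * N < outliers N T z} (iz2 \<omega>) \<partial>Om) \<le> ennreal ((1 / 2) ^ N)"
    by (subst nn_integral_parts(4)[OF outlier_indicator_measurable]) (rule noise_tail)
  have "(\<integral>\<^sup>+\<omega>. ?F (ib \<omega>) \<partial>Om) = (\<integral>\<^sup>+w. \<integral>\<^sup>+u. indicator (- ?S) (w, nat \<lfloor>u\<rfloor>) \<partial>uniform_key L \<partial>p2)"
    unfolding nn_integral_parts(2)[OF FM]
    using MU2.nn_integral_fst[OF FM[unfolded A2_def]] by (simp add: A2_def)
  also have "\<dots> = (\<Sum>w=1..m2. (\<Sum>l<L. ennreal (indicator bad2 (w, l))) / of_nat L) / of_nat m2"
    unfolding nn_integral_p2 nn_integral_uniform_key[OF Fw L]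
    by (intro arg_cong2[where f="(/)"] sum.cong refl) (auto simp: indicator_def)
  also have "\<dots> = ennreal ((\<Sum>w=1..m2. (\<Sum>l<L. indicator bad2 (w, l)) / real L) / real m2)"
    using L m2 by (subst avg_ennreal, simp, simp, subst avg_ennreal) (auto intro!: divide_nonneg_nonneg sum_nonneg)
  also have "(\<Sum>w=1..m2. (\<Sum>l<L. indicator bad2 (w, l)) / real L) / real m2 = card bad2 / (m2 * L)"
  proof -
    have "(\<Sum>w=1..m2. \<Sum>l<L. indicator bad2 (w, l) :: real) = (\<Sum>i\<in>{1..m2} \<times> {..<L}. indicator bad2 i)"
      by (simp add: sum.cartesian_product)
    also have "\<dots> = card bad2"
    proof -
      have "{1..m2} \<times> {..<L} \<inter> bad2 = bad2" by (auto simp: bad_index_def)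
      then show ?thesis by (simp add: indicator_def of_bool_def sum.If_cases Collect_mem_eq)
    qed
    finally show ?thesis by (simp add: sum_divide_distrib[symmetric] mult.commute)
  qed
  finally show "(\<integral>\<^sup>+\<omega>. ?F (ib \<omega>) \<partial>Om) \<le> ennreal (card bad2 / (m2 * L))" by simp
  fix \<omega> assume "\<omega> \<in> {\<omega> \<in> space Om. g2 (Y2 \<omega>) \<noteq> W2 \<omega>}"
  then have ne: "g2 (Y2 \<omega>) \<noteq> W2 \<omega>" by simp
  show "1 \<le> ?F (ib \<omega>) + indicator {z. \<delta> * N < outliers N T z} (iz2 \<omega>)"
  proof (rule ccontr)
    assume neg: "\<not> 1 \<le> ?F (ib \<omega>) + indicator {z. \<delta> * N < outliers N T z} (iz2 \<omega>)"
    define l where "l = nat \<lfloor>snd (ib \<omega>)\<rfloor>"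
    have a: "W2 \<omega> \<in> {1..m2}" "l < L" "(W2 \<omega>, l) \<notin> bad2" and b: "\<not> \<delta> * N < outliers N T (iz2 \<omega>)"
      using indicator_sum_less_1[OF neg] by (simp_all add: W2_def l_def)
    have "hamming N (\<lambda>t. demod D (Y2 \<omega> t)) (c2 (W2 \<omega>, l)) \<le> outliers N T (iz2 \<omega>)"
      unfolding W2_def l_def by (rule hamming_demod_le[OF D T Y2_pam]) auto
    also have "\<dots> \<le> Dd" by (rule small_outliers[OF b])
    finally show False using ne dec_correct[OF a] by simp
  qed
qed auto

lemma bounded_power:
  assumes M: "f \<in> borel_measurable Om" and b: "\<And>\<omega>. \<bar>f \<omega>\<bar> \<le> sqrt P"
  shows "integrable Om (\<lambda>\<omega>. (f \<omega>)\<^sup>2) \<and> integral\<^sup>L Om (\<lambda>\<omega>. (f \<omega>)\<^sup>2) \<le> P"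
proof -
  have sq: "(f \<omega>)\<^sup>2 \<le> P" for \<omega>
    using power_mono[OF b[of \<omega>], of 2] P0 by simp
  have I: "integrable Om (\<lambda>\<omega>. (f \<omega>)\<^sup>2)"
    by (rule Om.integrable_const_bound[of _ P]) (use sq M in \<open>auto intro: borel_measurable_power\<close>)
  moreover have "integral\<^sup>L Om (\<lambda>\<omega>. (f \<omega>)\<^sup>2) \<le> P"
    by (rule Om.integral_le_const[OF I]) (simp add: sq)
  ultimately show ?thesis ..
qed

lemma real_c2_le: "t < N \<Longrightarrow> real (c2 i t) \<le> real (Mf * Mc) - 1"
  using c2_less[of t i] by linarith

text \<open>The symbol of user 1 and the cancelling term each use at most half of the amplitude
  \<open>sqrt P\<close>, by \<open>pow1\<close> and \<open>pow3\<close>; the power constraint thus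
  holds for every realization.\<close>

lemma power1: "t < N \<Longrightarrow> integrable Om (\<lambda>\<omega>. (X1f \<omega> t)\<^sup>2) \<and> integral\<^sup>L Om (\<lambda>\<omega>. (X1f \<omega> t)\<^sup>2) \<le> P"
proof (rule bounded_power)
  assume t: "t < N"
  show "(\<lambda>\<omega>. X1f \<omega> t) \<in> borel_measurable Om"
    unfolding X1f_def by (rule x1_meas2[OF measurable_inputs(1,2)])
  fix \<omega>
  define x where "x = c2 (fst (ib \<omega>), nat \<lfloor>snd (ib \<omega>)\<rfloor>) t"
  define y where "y = c1 (fst (ia \<omega>), 0) t"
  have "real (x div Mf * Mf) \<le> real x" by (simp only: of_nat_le_iff div_times_less_eq_dividend)
  also have "\<dots> \<le> real (Mf * Mc) - 1" unfolding x_def by (rule real_c2_le[OF t])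
  finally have x: "real (x div Mf * Mf) * D \<le> (real (Mf * Mc) - 1) * D"
    using D0 by (intro mult_right_mono) auto
  have "\<bar>h_c * (real (x div Mf * Mf) * D / h_d)\<bar> = \<bar>h_c\<bar> * (real (x div Mf * Mf) * D) / \<bar>h_d\<bar>"
    using D0 by (simp add: abs_mult)
  also have "\<dots> \<le> \<bar>h_c\<bar> * ((real (Mf * Mc) - 1) * D) / \<bar>h_d\<bar>"
    using x by (intro divide_right_mono mult_left_mono) auto
  finally have 1: "\<bar>h_c * (real (x div Mf * Mf) * D / h_d)\<bar> \<le> \<bar>h_d\<bar> * sqrt P / 2" using pow3 by linarith
  have "real y * D \<le> real M1 * D"
    using c1_less[OF t, of "(fst (ia \<omega>), 0)"] D0 by (intro mult_right_mono) (auto simp: y_def)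
  moreover have "\<bar>real y * D\<bar> = real y * D" using D0 by simp
  ultimately have 2: "\<bar>real y * D\<bar> \<le> \<bar>h_d\<bar> * sqrt P / 2" using pow1 by linarith
  have "X1f \<omega> t = (real y * D - h_c * (real (x div Mf * Mf) * D / h_d)) / h_d"
    by (simp add: X1f_def pam_x1_def pam_link_def x_def y_def)
  then have "\<bar>X1f \<omega> t\<bar> = \<bar>real y * D - h_c * (real (x div Mf * Mf) * D / h_d)\<bar> / \<bar>h_d\<bar>"
    by (simp only: abs_divide)
  also have "\<dots> \<le> (\<bar>h_d\<bar> * sqrt P) / \<bar>h_d\<bar>"
    using order_trans[OF abs_triangle_ineq4 add_mono[OF 2 1]]
    by (intro divide_right_mono) (simp_all only: field_sum_of_halves abs_ge_zero)
  finally show "\<bar>X1f \<omega> t\<bar> \<le> sqrt P" using hd by simp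
qed

lemma power2: "t < N \<Longrightarrow> integrable Om (\<lambda>\<omega>. (X2f \<omega> t)\<^sup>2) \<and> integral\<^sup>L Om (\<lambda>\<omega>. (X2f \<omega> t)\<^sup>2) \<le> P"
proof (rule bounded_power)
  assume t: "t < N"
  show "(\<lambda>\<omega>. X2f \<omega> t) \<in> borel_measurable Om"
    unfolding X2f_def by (rule measurable_compose[OF measurable_inputs(2) x2_A2])
  fix \<omega>
  define x where "x = c2 (fst (ib \<omega>), nat \<lfloor>snd (ib \<omega>)\<rfloor>) t"
  have "real x * D \<le> (real (Mf * Mc) - 1) * D"
    using real_c2_le[OF t] D0 unfolding x_def by (intro mult_right_mono) auto
  then have "real x * D \<le> \<bar>h_d\<bar> * sqrt P" using pow2 by linarith
  then have "real x * D / \<bar>h_d\<bar> \<le> (\<bar>h_d\<bar> * sqrt P) / \<bar>h_d\<bar>" by (intro divide_right_mono) auto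
  moreover have "\<bar>X2f \<omega> t\<bar> = real x * D / \<bar>h_d\<bar>"
    using D0 by (simp add: X2f_def pam_x2_def x_def abs_mult)
  ultimately show "\<bar>X2f \<omega> t\<bar> \<le> sqrt P" using hd by simp
qed

abbreviation "mean \<equiv> pam_mean h_d h_c D Mf c1"
abbreviation "XX \<equiv> words N (Mf * Mc)"

text \<open>The density given the message of user 2 as a double average, over dummy indices and
  messages of user 1, in the form expected by \<open>chi_square_le\<close>.\<close>

lemma pd_pam:
  assumes y: "y \<in> space OUT"
  shows "pd w y = (\<Sum>l<L. (\<Sum>j\<in>{1..m1}. nd N (mean j (c2 (w, l))) 1 y) / card {1..m1}) / L"
proof -
  let ?h = "\<lambda>l. (\<Sum>j\<in>{1..m1}. nd N (mean j (c2 (w, l))) 1 y) / real m1"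
  have e1: "e1 a b = mean (fst a) (c2 (fst b, nat \<lfloor>snd b\<rfloor>))" for a b
    by (rule ext) (rule e1_pam)
  have M: "(\<lambda>ua. ennreal (nd N (e1 (snd ua) (w, fst ua)) 1 y)) \<in> borel_measurable (uniform_key L \<Otimes>\<^sub>M A1)"
    by (rule measurable_compose[OF measurable_nd[OF measurable_pd_mean] measurable_ennreal]) (use y in simp)
  have "ennreal (pd w y) = (\<integral>\<^sup>+ua. ennreal (nd N (e1 (snd ua) (w, fst ua)) 1 y) \<partial>(uniform_key L \<Otimes>\<^sub>M A1))"
    unfolding pd_def by (rule ennreal_mixd[OF prob_\<mu>2A1 order_refl _ y]) (rule measurable_pd_mean)
  also have "\<dots> = (\<integral>\<^sup>+u. \<integral>\<^sup>+a. ennreal (nd N (mean (fst a) (c2 (w, nat \<lfloor>u\<rfloor>))) 1 y) \<partial>A1 \<partial>uniform_key L)"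
    using A1.nn_integral_fst[OF M] by (simp add: e1)
  also have "\<dots> = (\<integral>\<^sup>+u. (\<Sum>j=1..m1. ennreal (nd N (mean j (c2 (w, nat \<lfloor>u\<rfloor>))) 1 y)) / of_nat m1 \<partial>uniform_key L)"
    by (intro nn_integral_cong) (simp only: nn_integral_A1_fst[of "\<lambda>j. ennreal (nd N (mean j _) 1 y)"] nn_integral_p1)
  also have "\<dots> = (\<integral>\<^sup>+u. ennreal (?h (nat \<lfloor>u\<rfloor>)) \<partial>uniform_key L)"
    using m1 by (intro nn_integral_cong avg_ennreal) auto
  also have "\<dots> = (\<Sum>l<L. ennreal (?h (nat \<lfloor>real l\<rfloor>))) / of_nat L"
  proof (rule nn_integral_uniform_key[OF _ L])
    have "(\<lambda>l. ennreal (?h l)) \<in> borel_measurable (count_space UNIV)" by simp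
    from measurable_compose[OF measurable_nat_floor this]
    show "(\<lambda>u::real. ennreal (?h (nat \<lfloor>u\<rfloor>))) \<in> borel_measurable borel" .
  qed
  also have "\<dots> = ennreal ((\<Sum>l<L. ?h l) / L)"
    using L by (subst avg_ennreal) (auto intro!: divide_nonneg_nonneg sum_nonneg)
  finally have "ennreal (pd w y) = ennreal ((\<Sum>l<L. ?h l) / L)" .
  then have "pd w y = (\<Sum>l<L. ?h l) / L"
    using pd_pos[OF y, of w] by (subst (asm) ennreal_inj) (auto intro!: divide_nonneg_nonneg sum_nonneg)
  then show ?thesis by simp
qed

lemma words_finite: "finite XX" "XX \<noteq> {}" and J_finite: "finite {1..m1}" "{1..m1} \<noteq> {}"
  using c2[of "(0, 0)"] m1 by (auto simp: words_def intro!: finite_PiE)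

text \<open>For equal \<open>j\<close> the symbol of user 1 drops out of the difference, and each
  fine part contributes at most one half.\<close>

lemma mean_close: "\<bar>mean j x t - mean j x' t\<bar> \<le> 1"
  using fine_bound[of "x t"] fine_bound[of "x' t"] unfolding pam_mean_def by linarith

abbreviation "co \<equiv> corr XX {1..m1} mean N"
abbreviation "mq \<equiv> mixq XX {1..m1} mean N"

lemmas chi_facts = words_finite J_finite mean_close

lemma chi_le: "(\<integral>\<^sup>+y. ennreal ((pd w y)\<^sup>2 / mq y) \<partial>lam N)
   \<le> ennreal ((\<Sum>l<L. \<Sum>l'<L. co (c2 (w, l)) (c2 (w, l'))) / (real L)\<^sup>2)"
  by (rule chi_square_le[OF chi_facts L, where f="\<lambda>l. c2 (w, l)"]) (rule c2, erule pd_pam)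

lemma chi_ge_1: "1 \<le> (\<Sum>l<L. \<Sum>l'<L. co (c2 (w, l)) (c2 (w, l'))) / (real L)\<^sup>2"
proof -
  have "1 \<le> (\<integral>\<^sup>+y. ennreal ((pd w y)\<^sup>2 / mq y) \<partial>lam N)"
    by (rule chi_square_ge_1[OF chi_facts measurable_pd1 _ nn_integral_pd_1]) (rule less_imp_le[OF pd_pos])
  also note chi_le
  finally show ?thesis by (simp only: ennreal_ge_1)
qed

lemma pam_secure_code:
  assumes Mc: "1 \<le> Mc" "log 2 Mc \<le> CG"
    and e1: "card bad1 / m1 + (1 / 2) ^ N \<le> eps" and e2: "card bad2 / (m2 * L) + (1 / 2) ^ N \<le> eps"
    and C: "(\<Sum>w=1..m2. (\<Sum>l<L. \<Sum>l'<L. co (c2 (w, l)) (c2 (w, l'))) / (real L)\<^sup>2) / m2 \<le> 1 + C"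
    and lk: "C / ln 2 \<le> lk"
  shows "secure_code h_d h_c P CG N m1 m2 eps lk"
proof (rule secure_codeI[where Lk="\<lambda>_. Mc" and ?g1.0=g1 and ?g2.0=g2])
  show "pam_link Mf c2 w u t < Mc" if "t < N" for w u t
    using c2_less[OF that] unfolding pam_link_def by (intro less_mult_imp_div_less) (simp add: mult.commute)
  show "(\<Sum>t<N. log 2 (real Mc)) \<le> real N * CG" using Mc by (simp add: mult_left_mono)
  show "g1 \<in> measurable OUT (count_space UNIV)" "g2 \<in> measurable OUT (count_space UNIV)"
    by (rule measurable_dec)+
  show "measure Om {\<omega> \<in> space Om. g1 (Y1 \<omega>) \<noteq> W1 \<omega>} \<le> eps" using error1 e1 by linarith
  show "measure Om {\<omega> \<in> space Om. g2 (Y2 \<omega>) \<noteq> W2 \<omega>} \<le> eps" using error2 e2 by linarith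
  have "leakage * ln 2 \<le> C"
  proof (rule leakage_le_chi_square[where q=mq])
    show "mq \<in> borel_measurable OUT" by (rule mixqM[OF chi_facts])
    show "0 < mq y" for y by (rule mixq_pos[OF chi_facts])
    show "(\<integral>\<^sup>+y. ennreal (mq y) \<partial>lam N) \<le> 1" by (simp only: nn_integral_mixq[OF chi_facts] order_refl)
    let ?S = "\<lambda>w. (\<Sum>l<L. \<Sum>l'<L. co (c2 (w, l)) (c2 (w, l'))) / (real L)\<^sup>2"
    have S: "0 \<le> ?S w" for w using chi_ge_1[of w] by linarith
    have "(\<integral>\<^sup>+w. \<integral>\<^sup>+y. ennreal ((pd w y)\<^sup>2 / mq y) \<partial>lam N \<partial>p2) \<le> (\<integral>\<^sup>+w. ennreal (?S w) \<partial>p2)"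
      by (intro nn_integral_mono chi_le)
    also have "\<dots> = (\<Sum>w=1..m2. ennreal (?S w)) / of_nat m2" by (rule nn_integral_p2)
    also have "\<dots> = ennreal ((\<Sum>w=1..m2. ?S w) / m2)" by (rule avg_ennreal[OF S m2])
    also have "\<dots> \<le> ennreal (1 + C)" by (rule ennreal_leI[OF C])
    finally show "(\<integral>\<^sup>+w. \<integral>\<^sup>+y. ennreal ((pd w y)\<^sup>2 / mq y) \<partial>lam N \<partial>p2) \<le> ennreal (1 + C)" .
    have "0 \<le> (\<Sum>w=1..m2. ?S w) / m2" by (intro divide_nonneg_nonneg[OF sum_nonneg[OF S]] of_nat_0_le_iff)
    then show "0 \<le> 1 + C" using C by linarith
  qed
  then have "leakage \<le> C / ln 2" by (simp add: le_divide_eq)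
  then show "leakage \<le> lk" using lk by linarith
qed (use Mc power1 power2 in blast)+

end

section \<open>Block codes of prescribed rates\<close>

lemma words_card: "finite (words N M)" "card (words N M) = M ^ N" "1 \<le> M \<Longrightarrow> words N M \<noteq> {}"
proof -
  show "finite (words N M)" unfolding words_def by (intro finite_PiE) auto
  show "card (words N M) = M ^ N" unfolding words_def by (simp add: card_PiE)
  then show "1 \<le> M \<Longrightarrow> words N M \<noteq> {}" by (metis card.empty not_one_le_zero power_eq_0_iff)
qed

lemma words_ball:
  assumes "1 \<le> M" "x \<in> words N M"
  shows "real (card {x' \<in> words N M. confusable N d x x'}) \<le> 2 ^ N * real M ^ (2 * d)"
proof -
  have "real (card {x' \<in> words N M. confusable N d x x'}) \<le> real (2 ^ N * M ^ (2 * d))"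
    unfolding words_def of_nat_le_iff by (rule hamming_ball_card[OF assms(1)])
  then show ?thesis by simp
qed

text \<open>The expected fraction of bad indices from \<open>codebook_exists\<close> for words over
  \<open>M\<close> symbols, with the Hamming ball of radius \<open>2 * d\<close> as confusion
  set.\<close>

definition collision :: "nat \<Rightarrow> nat \<Rightarrow> nat \<Rightarrow> nat \<Rightarrow> nat \<Rightarrow> real" where
  "collision N M d m K = (real m - 1) * K * (2 ^ N * real M ^ (2 * d)) / real M ^ N"

text \<open>The codebook of user 1 is chosen first, because the leakage kernel that guides the
  choice for user 2 is built from the means that \<open>c1\<close> produces.\<close>

lemma block_code_exists:
  fixes h_d h_c P D T \<delta> CG :: real and N M1 Mf Mc L m1 m2 :: nat
  assumes hd: "h_d \<noteq> 0" and P0: "0 < P" and D: "D = 2 * T + 2" and T: "0 \<le> T" and \<delta>: "0 \<le> \<delta>"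
    and M: "1 \<le> M1" "1 \<le> Mf" "1 \<le> Mc" and L: "1 \<le> L" and m1: "1 \<le> m1" and m2: "1 \<le> m2"
    and pow1: "real M1 * D \<le> \<bar>h_d\<bar> * sqrt P / 2"
    and fine: "\<bar>h_c\<bar> * ((real Mf - 1) * D) / \<bar>h_d\<bar> \<le> 1 / 2"
    and pow2: "(real (Mf * Mc) - 1) * D \<le> \<bar>h_d\<bar> * sqrt P"
    and pow3: "\<bar>h_c\<bar> * ((real (Mf * Mc) - 1) * D) / \<bar>h_d\<bar> \<le> \<bar>h_d\<bar> * sqrt P / 2"
    and CG: "log 2 Mc \<le> CG"
    and tail: "(\<integral>\<^sup>+z. indicator {z. \<delta> * N < outliers N T z} z \<partial>noise_vec N) \<le> ennreal ((1 / 2) ^ N)"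
    and eps1: "collision N M1 (nat \<lfloor>\<delta> * N\<rfloor>) m1 1 + (1 / 2) ^ N \<le> eps"
    and eps2: "collision N (Mf * Mc) (nat \<lfloor>\<delta> * N\<rfloor>) m2 L + exp N / L + (1 / 2) ^ N \<le> eps"
    and lk: "(collision N (Mf * Mc) (nat \<lfloor>\<delta> * N\<rfloor>) m2 L + exp N / L) / ln 2 \<le> lk"
  shows "secure_code h_d h_c P CG N m1 m2 eps lk"
proof -
  define d where "d = nat \<lfloor>\<delta> * N\<rfloor>"
  define X where "X = words N (Mf * Mc)"
  have M2: "1 \<le> Mf * Mc" using M by simp
  obtain c1 where c1: "\<And>i. c1 i \<in> words N M1"
    and b1: "real (card (bad_index m1 1 (confusable N d) c1)) / (real m1 * real 1)
       + ((\<Sum>w=1..m1. (\<Sum>l<1. \<Sum>l'<(1::nat). (\<lambda>_ _. 1) (c1 (w, l)) (c1 (w, l'))) / (real 1)\<^sup>2) / m1)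
      \<le> (real m1 - 1) * real 1 * (2 ^ N * real M1 ^ (2 * d)) / card (words N M1) + 1 + 0 / real 1"
  \<comment> \<open>No secrecy is asked for user 1: the constant kernel 1 with excess 0 reduces the
    bound to the error criterion.\<close>
  proof (rule codebook_exists[OF words_card(1) words_card(3)[OF M(1)] m1 order_refl,
        where conf="confusable N d" and V="2 ^ N * real M1 ^ (2 * d)" and G="\<lambda>_ _. 1" and B=0])
    show "real (card {x' \<in> words N M1. confusable N d x x'}) \<le> 2 ^ N * real M1 ^ (2 * d)" if "x \<in> words N M1" for x
      by (rule words_ball[OF M(1) that])
  qed (auto simp: power2_eq_square)
  have bad1: "card (bad_index m1 1 (confusable N d) c1) / m1 \<le> collision N M1 d m1 1"
    using b1 m1 by (simp add: collision_def words_card(2))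
  obtain x0 where x0: "x0 \<in> X" using words_card(3)[OF M2] unfolding X_def by blast
  \<comment> \<open>A provisional codebook for user 2: the closeness of the means involves only
    \<open>c1\<close>, but it is proved inside the locale and is needed before \<open>c2\<close>
    exists.\<close>
  interpret A: pam_scheme h_d h_c P D T \<delta> N M1 Mf Mc L m1 m2 c1 "\<lambda>_. x0"
    by (rule pam_scheme.intro) (fact | simp only: x0[unfolded X_def])+
  have xf: "finite X" "X \<noteq> {}" unfolding X_def by (rule words_card(1), rule words_card(3)[OF M2])
  have jf: "finite {1..m1}" "{1..m1} \<noteq> {}" using m1 by auto
  let ?co = "corr X {1..m1} (pam_mean h_d h_c D Mf c1) N"
  note facts = xf jf A.mean_close
  obtain c2 where c2: "\<And>i. c2 i \<in> X"
    and b2: "real (card (bad_index m2 L (confusable N d) c2)) / real (m2 * L)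
       + ((\<Sum>w=1..m2. (\<Sum>l<L. \<Sum>l'<L. ?co (c2 (w, l)) (c2 (w, l'))) / (real L)\<^sup>2) / m2)
      \<le> (real m2 - 1) * real L * (2 ^ N * real (Mf * Mc) ^ (2 * d)) / card X + 1 + exp N / real L"
  proof (rule codebook_exists[OF xf m2 L,
        where conf="confusable N d" and V="2 ^ N * real (Mf * Mc) ^ (2 * d)" and G="?co" and B="exp N"])
    show "real (card {x' \<in> X. confusable N d x x'}) \<le> 2 ^ N * real (Mf * Mc) ^ (2 * d)" if "x \<in> X" for x
      unfolding X_def by (rule words_ball[OF M2 that[unfolded X_def]])
    show "(\<Sum>x\<in>X. \<Sum>x'\<in>X. ?co x x') \<le> (real (card X))\<^sup>2"
      by (simp only: corr_total[OF facts] order_refl)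
    show "?co x x \<le> 1 + exp (real N)" if "x \<in> X" for x
    proof -
      have "?co x x \<le> exp N" by (rule corr_diag[OF xf jf _ that]) (rule A.mean_close)
      then show ?thesis by simp
    qed
  qed (rule that; assumption)
  interpret B: pam_scheme h_d h_c P D T \<delta> N M1 Mf Mc L m1 m2 c1 c2
    by (rule pam_scheme.intro) (fact | simp only: c2[unfolded X_def])+
  have Dd: "B.Dd = d" by (simp add: B.Dd_def d_def)
  define S where "S w = (\<Sum>l<L. \<Sum>l'<L. ?co (c2 (w, l)) (c2 (w, l'))) / (real L)\<^sup>2" for w
  have S1: "1 \<le> S w" for w unfolding S_def X_def by (rule B.chi_ge_1)
  \<comment> \<open>The joint bound controls bad fraction plus leakage average. Subtracting this
    lower bound 1 isolates the former; nonnegativity of the bad fraction isolates the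
    latter.\<close>
  have Sav: "1 \<le> (\<Sum>w=1..m2. S w) / m2"
  proof -
    have "(\<Sum>w=1..m2. (1::real)) \<le> (\<Sum>w=1..m2. S w)" by (intro sum_mono S1)
    then show ?thesis using m2 by (simp add: le_divide_eq)
  qed
  have b2': "card (bad_index m2 L (confusable N d) c2) / (m2 * L) + (\<Sum>w=1..m2. S w) / m2
     \<le> collision N (Mf * Mc) d m2 L + 1 + exp N / L"
    using b2 by (simp add: collision_def S_def X_def words_card(2))
  have bad0: "0 \<le> real (card (bad_index m2 L (confusable N d) c2)) / (m2 * L)" by simp
  show ?thesis
  proof (rule B.pam_secure_code[where C="collision N (Mf * Mc) d m2 L + exp N / L"])
    show "1 \<le> Mc" "log 2 (real Mc) \<le> CG" using M CG by auto
    show "card (bad_index m1 1 (confusable N B.Dd) c1) / m1 + (1 / 2) ^ N \<le> eps"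
      using bad1 eps1 unfolding Dd d_def by linarith
    show "card (bad_index m2 L (confusable N B.Dd) c2) / (m2 * L) + (1 / 2) ^ N \<le> eps"
      using b2' Sav eps2 unfolding Dd d_def by linarith
    show "(\<Sum>w=1..m2. (\<Sum>l<L. \<Sum>l'<L. corr (words N (Mf * Mc)) {1..m1} (pam_mean h_d h_c D Mf c1) N (c2 (w, l)) (c2 (w, l'))) / (real L)\<^sup>2) / m2
       \<le> 1 + (collision N (Mf * Mc) d m2 L + exp N / L)"
      using b2' bad0 unfolding S_def X_def by linarith
    show "(collision N (Mf * Mc) d m2 L + exp N / L) / ln 2 \<le> lk" using lk unfolding d_def .
  qed
qed

lemma num_msgs_bounds:
  assumes "0 \<le> R"
  shows "1 \<le> num_msgs N R" "real (num_msgs N R) - 1 \<le> 2 powr (N * R)" "2 powr (N * R) \<le> num_msgs N R"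
proof -
  have "1 \<le> 2 powr (real N * R)" using assms by (intro ge_one_powr_ge_zero) auto
  then have p: "0 < \<lceil>2 powr (real N * R)\<rceil>" by simp
  then show "1 \<le> num_msgs N R" unfolding num_msgs_def by linarith
  have eq: "real (num_msgs N R) = of_int \<lceil>2 powr (real N * R)\<rceil>" unfolding num_msgs_def using p by simp
  show "real (num_msgs N R) - 1 \<le> 2 powr (N * R)" unfolding eq by linarith
  show "2 powr (N * R) \<le> num_msgs N R" unfolding eq by linarith
qed

lemma num_msgs_0: "num_msgs N 0 = 1"
  by (simp add: num_msgs_def)

text \<open>Of the 2 bits in the rate condition one pays for the factor \<open>2 ^ N\<close> of the
  Hamming ball and one yields the decay; \<open>k\<close> bits pay for the dummy index and
  \<open>2 * \<delta> * log 2 M\<close> for the ball radius. At rate 0 there is one message and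
  nothing to collide with.\<close>

lemma collision_le:
  assumes M: "1 \<le> M" and \<delta>: "0 \<le> \<delta>" and R: "0 \<le> R" and k: "0 \<le> k"
    and rate: "R = 0 \<or> R \<le> (1 - 2 * \<delta>) * log 2 M - 2 - k"
    and K: "real K = 2 powr (k * N)"
  shows "collision N M (nat \<lfloor>\<delta> * N\<rfloor>) (num_msgs N R) K \<le> (1 / 2) ^ N"
proof (cases "R = 0")
  case True
  then show ?thesis by (simp add: collision_def num_msgs_0)
next
  case False
  then have rate: "R \<le> (1 - 2 * \<delta>) * log 2 M - 2 - k" using rate by simp
  define d where "d = nat \<lfloor>\<delta> * N\<rfloor>"
  have M0: "0 < real M" using M by simp
  have d: "real (2 * d) \<le> 2 * \<delta> * N" unfolding d_def using \<delta> by simp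
  have Mp: "real M powr x = 2 powr (x * log 2 M)" for x
    using M0 by (simp add: powr_def log_def)
  have lM: "0 \<le> log 2 M" using M by simp
  have "real M ^ (2 * d) = real M powr real (2 * d)" using M0 by (simp only: powr_realpow)
  also have "\<dots> \<le> 2 powr (2 * \<delta> * N * log 2 M)"
    unfolding Mp using d lM by (intro powr_mono mult_right_mono) auto
  finally have 1: "real M ^ (2 * d) \<le> 2 powr (2 * \<delta> * N * log 2 M)" .
  have 2: "real M ^ N = 2 powr (N * log 2 M)" using M0 Mp[of "real N"] by (simp add: powr_realpow)
  have "collision N M d (num_msgs N R) K \<le> 2 powr (N * R) * 2 powr (k * N) * (2 powr N * 2 powr (2 * \<delta> * N * log 2 M)) / 2 powr (N * log 2 M)"
    unfolding collision_def K 2 using 1 num_msgs_bounds(2)[OF R, of N]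
    by (intro divide_right_mono mult_mono) (auto simp: powr_realpow)
  also have "\<dots> = 2 powr (N * (R + k + 1 + 2 * \<delta> * log 2 M - log 2 M))"
    by (simp add: powr_add[symmetric] powr_diff[symmetric] algebra_simps)
  also have "\<dots> \<le> 2 powr (N * (- 1))"
  proof -
    have "R + k + 1 + 2 * \<delta> * log 2 M - log 2 M \<le> - 1" using rate by (simp add: algebra_simps)
    from mult_left_mono[OF this, of "real N"] show ?thesis by (intro powr_mono) auto
  qed
  also have "\<dots> = (1 / 2) ^ N" by (simp add: powr_minus powr_realpow power_one_over inverse_eq_divide)
  finally show ?thesis unfolding d_def .
qed

text \<open>The dummy index has \<open>4 ^ N\<close> values. Since \<open>exp 1 < 4\<close>, the
  diagonal excess \<open>exp N / 4 ^ N\<close> vanishes, even before division by \<open>N\<close>.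
  These 2 bits per channel use turn the loss 2 of user 1 into 4 for user 2.\<close>

lemma achievable:
  fixes h_d h_c P D T \<delta> CG R1 R2 :: real and M1 Mf Mc :: nat
  assumes hd: "h_d \<noteq> 0" and P0: "0 < P" and D: "D = 2 * T + 2" and T: "0 \<le> T" and \<delta>: "0 \<le> \<delta>"
    and M: "1 \<le> M1" "1 \<le> Mf" "1 \<le> Mc"
    and pow1: "real M1 * D \<le> \<bar>h_d\<bar> * sqrt P / 2"
    and fine: "\<bar>h_c\<bar> * ((real Mf - 1) * D) / \<bar>h_d\<bar> \<le> 1 / 2"
    and pow2: "(real (Mf * Mc) - 1) * D \<le> \<bar>h_d\<bar> * sqrt P"
    and pow3: "\<bar>h_c\<bar> * ((real (Mf * Mc) - 1) * D) / \<bar>h_d\<bar> \<le> \<bar>h_d\<bar> * sqrt P / 2"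
    and CG: "log 2 Mc \<le> CG"
    and tail: "\<And>N. (\<integral>\<^sup>+z. indicator {z. \<delta> * real N < real (outliers N T z)} z \<partial>noise_vec N) \<le> ennreal ((1 / 2) ^ N)"
    and R: "0 \<le> R1" "0 \<le> R2"
    and R1: "R1 = 0 \<or> R1 \<le> (1 - 2 * \<delta>) * log 2 M1 - 2"
    and R2: "R2 = 0 \<or> R2 \<le> (1 - 2 * \<delta>) * log 2 (real (Mf * Mc)) - 4"
  shows "securely_achievable h_d h_c P CG R1 R2"
proof -
  define eps :: "nat \<Rightarrow> real" where "eps N = 2 * (1 / 2) ^ N + (exp 1 / 4) ^ N" for N
  define lk :: "nat \<Rightarrow> real" where "lk N = ((1 / 2) ^ N + (exp 1 / 4) ^ N) / ln 2" for N
  have e4: "(\<lambda>N. (exp 1 / 4 :: real) ^ N) \<longlonglongrightarrow> 0"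
    using exp_le by (intro LIMSEQ_power_zero) simp
  have h2: "(\<lambda>N. (1 / 2 :: real) ^ N) \<longlonglongrightarrow> 0" by (intro LIMSEQ_power_zero) simp
  have "eps \<longlonglongrightarrow> 2 * 0 + 0" unfolding eps_def by (intro tendsto_intros h2 e4)
  then have eps: "eps \<longlonglongrightarrow> 0" by simp
  have "lk \<longlonglongrightarrow> (0 + 0) / ln 2" unfolding lk_def by (intro tendsto_intros h2 e4) simp
  then have "(\<lambda>N. lk N * (1 / real N)) \<longlonglongrightarrow> 0 * 0" by (intro tendsto_mult lim_1_over_n) simp
  then have lkN: "(\<lambda>N. lk N / real N) \<longlonglongrightarrow> 0" by simp
  have code: "secure_code h_d h_c P CG N (num_msgs N R1) (num_msgs N R2) (eps N) (lk N)" for N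
  proof (rule block_code_exists[OF hd P0 D T \<delta> M _ _ _ pow1 fine pow2 pow3 CG tail, of "4 ^ N"])
    show "1 \<le> (4::nat) ^ N" by simp
    show "1 \<le> num_msgs N R1" "1 \<le> num_msgs N R2" by (rule num_msgs_bounds(1)[OF R(1)], rule num_msgs_bounds(1)[OF R(2)])
    have c1: "collision N M1 (nat \<lfloor>\<delta> * N\<rfloor>) (num_msgs N R1) 1 \<le> (1 / 2) ^ N"
      by (rule collision_le[OF M(1) \<delta> R(1), of 0]) (use R1 in auto)
    have "1 \<le> Mf * Mc" using M by simp
    then have c2: "collision N (Mf * Mc) (nat \<lfloor>\<delta> * N\<rfloor>) (num_msgs N R2) (4 ^ N) \<le> (1 / 2) ^ N"
    proof (rule collision_le[OF _ \<delta> R(2), of _ 2])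
      have "(2::real) powr (2 * real N) = (2 powr 2) powr N" by (simp only: powr_powr)
      moreover have "(2::real) powr 2 = 4" by simp
      ultimately show "real (4 ^ N) = 2 powr (2 * real N)" by (simp only: of_nat_power) (simp add: powr_realpow)
    qed (use R2 in auto)
    have ex: "exp (real N) / real (4 ^ N) = (exp 1 / 4) ^ N"
      by (simp add: power_divide exp_of_nat_mult[symmetric])
    have e0: "0 \<le> (exp 1 / 4 :: real) ^ N" by simp
    show "collision N M1 (nat \<lfloor>\<delta> * N\<rfloor>) (num_msgs N R1) 1 + (1 / 2) ^ N \<le> eps N"
      using c1 e0 unfolding eps_def by linarith
    show "collision N (Mf * Mc) (nat \<lfloor>\<delta> * N\<rfloor>) (num_msgs N R2) (4 ^ N) + exp (real N) / real (4 ^ N) + (1 / 2) ^ N \<le> eps N"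
      using c2 unfolding eps_def ex by linarith
    show "(collision N (Mf * Mc) (nat \<lfloor>\<delta> * N\<rfloor>) (num_msgs N R2) (4 ^ N) + exp (real N) / real (4 ^ N)) / ln 2 \<le> lk N"
      unfolding lk_def ex using c2 by (intro divide_right_mono) auto
  qed
  show ?thesis unfolding securely_achievable_def using R eps lkN code by blast
qed

section \<open>From block bounds to capacity bounds\<close>

text \<open>Divide by \<open>N\<close> and let it grow. Eventually \<open>eps N < 1\<close>, so the
  lower bound on \<open>l N\<close> may be multiplied by the positive factor
  \<open>1 - eps N\<close>.\<close>

lemma limit_of_rate_bounds:
  fixes eps a :: "nat \<Rightarrow> real"
  assumes eps: "eps \<longlonglongrightarrow> 0" and a: "(\<lambda>N. a N / N) \<longlonglongrightarrow> 0"
    and le: "\<And>N. (1 - eps N) * l N \<le> a N + N * b" and l: "\<And>N. N * r \<le> l N"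
  shows "r \<le> b"
proof -
  have "(\<lambda>N. (1 - eps N) * r) \<longlonglongrightarrow> (1 - 0) * r" by (intro tendsto_intros eps)
  moreover have "(\<lambda>N. a N / N + b) \<longlonglongrightarrow> 0 + b" by (intro tendsto_intros a)
  moreover have "\<forall>\<^sub>F N in sequentially. (1 - eps N) * r \<le> a N / N + b"
    using order_tendstoD(2)[OF eps zero_less_one] eventually_gt_at_top[of 0]
  proof eventually_elim
    fix N :: nat assume e: "eps N < 1" and N: "0 < N"
    have "(1 - eps N) * (N * r) \<le> (1 - eps N) * l N" using e l by (intro mult_left_mono) auto
    also have "\<dots> \<le> a N + N * b" by (rule le)
    also have "\<dots> = (a N / N + b) * N" using N by (simp add: distrib_right)
    finally have "((1 - eps N) * r) * N \<le> (a N / N + b) * N" by (simp only: mult_ac)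
    then show "(1 - eps N) * r \<le> a N / N + b" using N by (simp add: mult_le_cancel_right)
  qed
  ultimately have "(1 - 0) * r \<le> 0 + b" by (intro tendsto_le[OF sequentially_bot])
  then show ?thesis by simp
qed

lemma ln_num_msgs: "0 \<le> R \<Longrightarrow> N * (R * ln 2) \<le> ln (num_msgs N R)"
proof -
  assume R: "0 \<le> R"
  have "ln (2 powr (N * R)) \<le> ln (real (num_msgs N R))"
    using num_msgs_bounds[OF R, of N] by (subst ln_le_cancel_iff) auto
  then show ?thesis by (simp add: ln_powr mult.assoc)
qed

lemma half_le_ln2: "1 / 2 \<le> ln (2::real)"
proof -
  have "ln (1 / 2) \<le> 1 / 2 - (1::real)" by (rule ln_le_minus_one) simp
  moreover have "ln (1 / 2) = - ln (2::real)" by (simp add: ln_div)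
  ultimately show ?thesis by linarith
qed

lemma rate_converse:
  assumes ach: "securely_achievable h_d h_c P CG R1 R2" and P: "0 < P"
  shows "R1 + R2 \<le> 2 * log 2 (rsd h_d h_c P) + 2"
    and "h_c \<noteq> 0 \<Longrightarrow> R1 + R2 \<le> log 2 (rsd h_d h_c P) + log 2 (sqrt (2 * (1 + (h_d / h_c)\<^sup>2))) + CG + 1"
proof -
  obtain eps lk where R: "0 \<le> R1" "0 \<le> R2" and eps: "eps \<longlonglongrightarrow> 0" and lk: "(\<lambda>N. lk N / real N) \<longlonglongrightarrow> 0"
    and code: "\<And>N. secure_code h_d h_c P CG N (num_msgs N R1) (num_msgs N R2) (eps N) (lk N)"
    using ach unfolding securely_achievable_def by blast
  note conv = secure_code_converse[OF code num_msgs_bounds(1)[OF R(1)] num_msgs_bounds(1)[OF R(2)] P]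
  have c: "(\<lambda>N. k / real N) \<longlonglongrightarrow> 0" for k :: real
    using tendsto_mult[OF tendsto_const lim_1_over_n, of k] by simp
  have l0: "0 < ln (2::real)" by simp
  \<comment> \<open>Half a nat is at most one bit, which gives integer constants in base 2.\<close>
  have tolog: "r \<le> x / ln 2 + 1" if "r * ln 2 \<le> x + 1 / 2" for r x :: real
  proof -
    have "r * ln 2 \<le> (x / ln 2 + 1) * ln 2" using that half_le_ln2 by (simp add: distrib_right)
    then show ?thesis by (rule mult_right_le_imp_le) simp
  qed
  have "R1 * ln 2 \<le> ln (rsd h_d h_c P) + 1 / 2"
    by (rule limit_of_rate_bounds[OF eps c conv(1) ln_num_msgs[OF R(1)]])
  moreover have "R2 * ln 2 \<le> ln (rsd h_d h_c P) + 1 / 2"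
    by (rule limit_of_rate_bounds[OF eps c conv(2) ln_num_msgs[OF R(2)]])
  ultimately show "R1 + R2 \<le> 2 * log 2 (rsd h_d h_c P) + 2"
    using tolog[of R1 "ln (rsd h_d h_c P)"] tolog[of R2 "ln (rsd h_d h_c P)"] by (simp add: log_def)
  assume hc: "h_c \<noteq> 0"
  let ?t = "sqrt (2 * (1 + (h_d / h_c)\<^sup>2))"
  have "(R1 + R2) * ln 2 \<le> ln (rsd h_d h_c P) + ln ?t + 1 / 2 + CG * ln 2"
  proof (rule limit_of_rate_bounds[OF eps, of "\<lambda>N. 2 * ln 2 + lk N * ln 2"])
    have "(\<lambda>N. 2 * ln 2 / real N + lk N / real N * ln 2) \<longlonglongrightarrow> 0 + 0 * ln 2"
      by (intro tendsto_intros c lk)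
    then show "(\<lambda>N. (2 * ln 2 + lk N * ln 2) / real N) \<longlonglongrightarrow> 0"
      by (simp add: add_divide_distrib)
    show "(1 - eps N) * (ln (num_msgs N R1) + ln (num_msgs N R2))
      \<le> 2 * ln 2 + lk N * ln 2 + N * (ln (rsd h_d h_c P) + ln ?t + 1 / 2 + CG * ln 2)" for N
      using conv(3)[OF hc, of N] by (simp add: algebra_simps)
    show "N * ((R1 + R2) * ln 2) \<le> ln (num_msgs N R1) + ln (num_msgs N R2)" for N
      using ln_num_msgs[OF R(1), of N] ln_num_msgs[OF R(2), of N] by (simp add: distrib_right distrib_left)
  qed
  then have "R1 + R2 \<le> (ln (rsd h_d h_c P) + ln ?t + CG * ln 2) / ln 2 + 1"
    by (intro tolog) simp
  then show "R1 + R2 \<le> log 2 (rsd h_d h_c P) + log 2 ?t + CG + 1"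
    by (simp add: log_def add_divide_distrib)
qed

text \<open>The achievable pair shows that the set of sum rates is nonempty, without which its
  supremum could not be bounded from above; the converse bounds the set, as the lower estimate
  requires.\<close>

lemma C_sum_bounds:
  assumes P: "0 < P" and ach: "securely_achievable h_d h_c P CG R1 R2"
  shows "R1 + R2 \<le> C_sum h_d h_c P CG"
    and "C_sum h_d h_c P CG \<le> 2 * log 2 (rsd h_d h_c P) + 2"
    and "h_c \<noteq> 0 \<Longrightarrow> C_sum h_d h_c P CG \<le> log 2 (rsd h_d h_c P) + log 2 (sqrt (2 * (1 + (h_d / h_c)\<^sup>2))) + CG + 1"
proof -
  let ?A = "{R1 + R2 | R1 R2. securely_achievable h_d h_c P CG R1 R2}"
  have ne: "?A \<noteq> {}" and mem: "R1 + R2 \<in> ?A" using ach by blast+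
  have bdd: "bdd_above ?A" using rate_converse(1)[OF _ P] by (intro bdd_aboveI) blast
  show "R1 + R2 \<le> C_sum h_d h_c P CG" unfolding C_sum_def by (rule cSup_upper[OF mem bdd])
  show "C_sum h_d h_c P CG \<le> 2 * log 2 (rsd h_d h_c P) + 2"
    unfolding C_sum_def using rate_converse(1)[OF _ P] by (intro cSup_least[OF ne]) blast
  show "h_c \<noteq> 0 \<Longrightarrow> C_sum h_d h_c P CG \<le> log 2 (rsd h_d h_c P) + log 2 (sqrt (2 * (1 + (h_d / h_c)\<^sup>2))) + CG + 1"
    unfolding C_sum_def using rate_converse(2)[OF _ P] by (intro cSup_least[OF ne]) blast
qed

section \<open>Choice of the constellation and degrees of freedom\<close>

lemma log2_nat_floor: "0 < x \<Longrightarrow> log 2 x - 1 \<le> log 2 (max 1 (nat \<lfloor>x\<rfloor>))" for x :: real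
proof (cases "x < 1")
  case True
  assume "0 < x"
  with True have "log 2 x \<le> 0" by simp
  moreover have "0 \<le> log 2 (real (max 1 (nat \<lfloor>x\<rfloor>)))" by simp
  ultimately show ?thesis by linarith
next
  case False
  assume x: "0 < x"
  have f: "1 \<le> \<lfloor>x\<rfloor>" using False by simp
  then have "real (nat \<lfloor>x\<rfloor>) = of_int \<lfloor>x\<rfloor>" by simp
  moreover have "x < of_int \<lfloor>x\<rfloor> + 1" "1 \<le> (of_int \<lfloor>x\<rfloor> :: real)" using f by linarith+
  ultimately have "x / 2 \<le> real (nat \<lfloor>x\<rfloor>)" by linarith
  then have "x / 2 \<le> real (max 1 (nat \<lfloor>x\<rfloor>))" by simp
  then have "log 2 (x / 2) \<le> log 2 (real (max 1 (nat \<lfloor>x\<rfloor>)))" using x by (subst log_le_cancel_iff) auto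
  then show ?thesis using x by (simp add: log_divide)
qed

text \<open>\<open>s\<close> and \<open>i\<close> are the square roots of SNR and INR. The first
  logarithm is the rate of user 1; the minimum is that of user 2, limited by the link or by the
  amplitude. Each \<open>- 1\<close> stems from rounding a level count, and \<open>6 = 2 + 4\<close>
  from \<open>achievable\<close>.\<close>

lemma pam_sum_rate:
  fixes h_d h_c P D T \<delta> CG :: real
  defines "s \<equiv> \<bar>h_d\<bar> * sqrt P" and "i \<equiv> \<bar>h_c\<bar> * sqrt P"
  defines "J \<equiv> max 1 i"
  assumes P0: "0 < P" and D: "D = 2 * T + 2" and T: "0 \<le> T" and \<delta>: "0 \<le> \<delta>" "\<delta> \<le> 1 / 2"
    and s: "2 * D \<le> s" and CG: "0 \<le> CG"
    and tail: "\<And>N. (\<integral>\<^sup>+z. indicator {z. \<delta> * real N < real (outliers N T z)} z \<partial>noise_vec N) \<le> ennreal ((1 / 2) ^ N)"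
  shows "\<exists>R1 R2. securely_achievable h_d h_c P CG R1 R2 \<and>
     (1 - 2 * \<delta>) * ((log 2 (s / (2 * D)) - 1) +
        min (log 2 (s / (2 * D * J)) + CG - 1) (log 2 (s * min 1 (s / (2 * J)) / D) - 1)) - 6 \<le> R1 + R2"
proof -
  have D2: "2 \<le> D" using D T by simp
  have s1: "4 \<le> s" using s D2 by simp
  have J: "1 \<le> J" "i \<le> J" by (simp_all add: J_def)
  have i0: "0 \<le> i" using P0 by (simp add: i_def)
  have sqP: "0 < sqrt P" using P0 by simp
  have hd: "h_d \<noteq> 0" using s1 unfolding s_def by auto
  have ratio: "\<bar>h_c\<bar> * x / \<bar>h_d\<bar> = i / s * x" for x
    using sqP hd by (simp add: i_def s_def)
  define M1 where "M1 = nat \<lfloor>s / (2 * D)\<rfloor>"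
  \<comment> \<open>The largest order of level count whose received amplitude stays below one half.
    \<open>J\<close> in place of \<open>i\<close> prevents more levels than the amplitude allows
    when the interference is weaker than the noise.\<close>
  define Mf where "Mf = 1 + nat \<lfloor>s / (2 * D * J)\<rfloor>"
  \<comment> \<open>The range of symbols of user 2: at most \<open>s\<close> by its own amplitude,
    and at most \<open>s * (s / (2 * J))\<close> so that the cancellation fits into half the
    amplitude of transmitter 1.\<close>
  define B where "B = s * min 1 (s / (2 * J))"
  \<comment> \<open>Coarse levels that the link can carry, and coarse levels that still fit into the
    range \<open>B\<close>.\<close>
  define x where "x = min (2 powr CG) (B / (D * Mf))"
  define Mc where "Mc = max 1 (nat \<lfloor>x\<rfloor>)"
  have q1: "1 \<le> s / (2 * D)" using s D2 by (simp add: le_divide_eq)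
  have "1 \<le> \<lfloor>s / (2 * D)\<rfloor>" using q1 by (simp only: one_le_floor)
  then have M1: "1 \<le> M1" unfolding M1_def by linarith
  have M1le: "real M1 \<le> s / (2 * D)" unfolding M1_def using q1 by simp
  have Mf1: "1 \<le> Mf" "1 \<le> Mc" by (simp_all add: Mf_def Mc_def)
  have DJ: "0 < 2 * D * J" using D2 J by simp
  have q2: "0 < s / (2 * D * J)" using s1 DJ by simp
  have Mfle: "real Mf - 1 \<le> s / (2 * D * J)" unfolding Mf_def using q2 by simp
  have Mfge: "s / (2 * D * J) \<le> Mf" unfolding Mf_def using q2 by linarith
  have MfD: "(real Mf - 1) * D \<le> s / (2 * J)"
  proof -
    have "(real Mf - 1) * D \<le> s / (2 * D * J) * D" using Mfle D2 by (intro mult_right_mono) auto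
    then show ?thesis using D2 by simp
  qed
  have B0: "0 < B" unfolding B_def using s1 J by simp
  have Bs: "B \<le> s" unfolding B_def using s1 by (simp add: mult_left_le)
  have BJ: "i / s * B \<le> s / 2"
  proof -
    have "i / s * B \<le> J / s * (s * (s / (2 * J)))"
      unfolding B_def using J i0 s1 by (intro mult_mono divide_right_mono) auto
    then show ?thesis using J s1 by simp
  qed
  have x0: "0 < x" unfolding x_def using B0 D2 Mf1 by simp
  have Mf_s: "s / (2 * J) \<le> s" using J s1 by (simp add: divide_le_eq)
  have fineJ: "i / s * ((real Mf - 1) * D) \<le> 1 / 2"
  proof -
    have "i / s * ((real Mf - 1) * D) \<le> J / s * (s / (2 * J))"
      using MfD J i0 s1 D2 Mf1 by (intro mult_mono divide_right_mono) auto
    then show ?thesis using J s1 by simp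
  qed
  \<comment> \<open>If \<open>x < 1\<close> a single coarse level is forced although
    \<open>B\<close> may then be exceeded. In that case the bounds on the fine levels alone give the
    amplitude conditions.\<close>
  have McB: "Mc = 1 \<or> (real Mc \<le> 2 powr CG \<and> real (Mf * Mc) * D \<le> B)"
  proof (cases "1 \<le> x")
    case True
    then have "real Mc = of_int \<lfloor>x\<rfloor>" by (simp add: Mc_def max_def) linarith
    then have le: "real Mc \<le> x" by linarith
    then have "real Mc \<le> B / (D * Mf)" by (simp add: x_def)
    then have "real Mc * (D * Mf) \<le> B" using D2 Mf1 by (simp add: le_divide_eq)
    then show ?thesis using le by (simp add: x_def mult_ac)
  next
    case False
    then show ?thesis using x0 by (simp add: Mc_def)
  qed
  \<comment> \<open>Clipping at 0 matches the alternative \<open>R = 0\<close> in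
    \<open>achievable\<close>: a negative rate is replaced by a single message.\<close>
  define R1 where "R1 = max 0 ((1 - 2 * \<delta>) * log 2 M1 - 2)"
  define R2 where "R2 = max 0 ((1 - 2 * \<delta>) * log 2 (real (Mf * Mc)) - 4)"
  have ach: "securely_achievable h_d h_c P CG R1 R2"
  proof (rule achievable[OF hd P0 D T \<delta>(1) M1 Mf1 _ _ _ _ _ tail])
    have "real M1 * D \<le> s / (2 * D) * D" using M1le D2 by (intro mult_right_mono) auto
    then show "real M1 * D \<le> \<bar>h_d\<bar> * sqrt P / 2" using D2 by (simp add: s_def)
    show "\<bar>h_c\<bar> * ((real Mf - 1) * D) / \<bar>h_d\<bar> \<le> 1 / 2" unfolding ratio by (rule fineJ)
    show "(real (Mf * Mc) - 1) * D \<le> \<bar>h_d\<bar> * sqrt P"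
      using McB
    proof
      assume "Mc = 1" then show ?thesis using MfD Mf_s by (simp add: s_def)
    next
      assume "real Mc \<le> 2 powr CG \<and> real (Mf * Mc) * D \<le> B"
      then show ?thesis using Bs D2 by (simp add: s_def left_diff_distrib)
    qed
    show "\<bar>h_c\<bar> * ((real (Mf * Mc) - 1) * D) / \<bar>h_d\<bar> \<le> \<bar>h_d\<bar> * sqrt P / 2"
      unfolding ratio s_def[symmetric] using McB
    proof
      assume "Mc = 1" then have "real (Mf * Mc) = real Mf" by simp
      then show "i / s * ((real (Mf * Mc) - 1) * D) \<le> s / 2" using fineJ s1 by (simp only:)
    next
      assume "real Mc \<le> 2 powr CG \<and> real (Mf * Mc) * D \<le> B"
      then have "(real (Mf * Mc) - 1) * D \<le> B" using D2 by (simp add: left_diff_distrib)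
      then have "i / s * ((real (Mf * Mc) - 1) * D) \<le> i / s * B" using i0 s1 by (intro mult_left_mono) auto
      then show "i / s * ((real (Mf * Mc) - 1) * D) \<le> s / 2" using BJ by linarith
    qed
    show "log 2 (real Mc) \<le> CG"
      using McB
    proof
      assume "real Mc \<le> 2 powr CG \<and> real (Mf * Mc) * D \<le> B"
      then have "log 2 (real Mc) \<le> log 2 (2 powr CG)" using Mf1 by (subst log_le_cancel_iff) auto
      then show ?thesis by simp
    qed (use CG in simp)
  qed (auto simp: R1_def R2_def)
  have l1: "log 2 (s / (2 * D)) - 1 \<le> log 2 M1"
    using log2_nat_floor[of "s / (2 * D)"] q1 M1 unfolding M1_def by simp
  have lMf: "log 2 (s / (2 * D * J)) \<le> log 2 Mf"
    using Mfge q2 Mf1 by (subst log_le_cancel_iff) auto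
  have lx: "log 2 x = min CG (log 2 (B / (D * Mf)))"
  proof -
    have "log 2 (min a b) = min (log 2 a) (log 2 b)" if "0 < a" "0 < b" for a b :: real
      using that by (cases "a \<le> b") (auto simp: min_def)
    then show ?thesis unfolding x_def using B0 D2 Mf1 by simp
  qed
  have lMc: "log 2 x - 1 \<le> log 2 Mc" using log2_nat_floor[OF x0] by (simp add: Mc_def)
  have "log 2 (B / D) = log 2 Mf + log 2 (B / (D * Mf))"
    using B0 D2 Mf1 by (simp add: log_divide log_mult)
  moreover have "log 2 (real (Mf * Mc)) = log 2 Mf + log 2 Mc" using Mf1 by (simp add: log_mult)
  ultimately have l2: "min (log 2 (s / (2 * D * J)) + CG - 1) (log 2 (B / D) - 1) \<le> log 2 (real (Mf * Mc))"
    using lMc lMf unfolding lx by linarith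
  have "(1 - 2 * \<delta>) * ((log 2 (s / (2 * D)) - 1) + min (log 2 (s / (2 * D * J)) + CG - 1) (log 2 (B / D) - 1))
     \<le> (1 - 2 * \<delta>) * (log 2 M1 + log 2 (real (Mf * Mc)))"
    using l1 l2 \<delta> by (intro mult_left_mono add_mono) auto
  also have "\<dots> \<le> R1 + R2 + 6"
    unfolding R1_def R2_def distrib_left by linarith
  finally show ?thesis using ach unfolding B_def by (intro exI[of _ R1] exI[of _ R2]) simp
qed

lemma log2_sqrt: "0 < x \<Longrightarrow> log 2 (sqrt x) = log 2 x / 2"
  by (simp add: log_def ln_sqrt)

lemma le_powr_log2: "0 \<le> x \<Longrightarrow> log 2 x \<le> y \<Longrightarrow> x \<le> 2 powr y"
  by (cases "x = 0") (auto simp: log_le_iff)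

text \<open>\<open>7 \<le> e * l\<close> absorbs the additive bits: 3 from \<open>rsd\<close>, 2
  from the prediction width and 2 from the final bit, all halved in the second bound. That bound
  divides by \<open>h_c\<close> and therefore asks for \<open>e < \<kappa>\<close>.\<close>

lemma C_sum_upper:
  fixes S INR l :: real
  assumes P: "0 < P" and S: "h_d\<^sup>2 * P = S" and INR: "h_c\<^sup>2 * P = INR"
    and \<kappa>: "0 \<le> \<kappa>" "\<kappa> \<le> 1" and e: "0 < e" and S2: "2 \<le> S" and l: "l = log 2 S"
    and up: "log 2 INR \<le> (\<kappa> + e) * l" and low: "(\<kappa> - e) * l \<le> log 2 INR"
    and CG: "CG \<le> (\<gamma> + e) * l / 2" and big: "7 \<le> e * l"
    and ach: "securely_achievable h_d h_c P CG R1 R2"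
  shows "C_sum h_d h_c P CG \<le> (2 + 4 * e) * l / 2"
    and "e < \<kappa> \<Longrightarrow> C_sum h_d h_c P CG \<le> (2 - \<kappa> + \<gamma> + 4 * e) * l / 2"
proof -
  have l1: "1 \<le> l" unfolding l using S2 by (simp add: le_log_iff)
  have Sl: "S = 2 powr l" unfolding l using S2 by simp
  have INR0: "0 \<le> INR" unfolding INR[symmetric] using P by simp
  \<comment> \<open>A common bound for the three summands \<open>S\<close>, \<open>INR\<close> and 1
    in \<open>rsd\<close>; it uses \<open>\<kappa> \<le> 1\<close>.\<close>
  define Q where "Q = 2 powr ((1 + e) * l)"
  have "log 2 INR \<le> (1 + e) * l"
    using up mult_right_mono[of "\<kappa> + e" "1 + e" l] \<kappa> l1 by linarith
  then have INRQ: "INR \<le> Q" unfolding Q_def by (intro le_powr_log2 INR0)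
  have SQ: "S \<le> Q" unfolding Q_def Sl using e l1 by (intro powr_mono) (auto simp: algebra_simps)
  have Q1: "1 \<le> Q" unfolding Q_def using e l1 by (intro ge_one_powr_ge_zero) auto
  have rad: "0 < 2 * (S + INR + 1)" using S2 INR0 by simp
  have "log 2 (rsd h_d h_c P) = log 2 (2 * (S + INR + 1)) / 2"
    unfolding rsd_def S INR by (rule log2_sqrt[OF rad])
  also have "\<dots> \<le> log 2 (8 * Q) / 2"
    using SQ INRQ Q1 rad by (intro divide_right_mono) (auto simp: log_le_cancel_iff)
  also have "log 2 (8 * Q) = 3 + (1 + e) * l"
  proof -
    have "log 2 (8::real) = 3" using log_pow_cancel[of 2 3] by simp
    then show ?thesis unfolding Q_def by (simp add: log_mult)
  qed
  finally have sig: "log 2 (rsd h_d h_c P) \<le> (3 + (1 + e) * l) / 2" .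
  note C = C_sum_bounds(2,3)[OF P ach]
  show "C_sum h_d h_c P CG \<le> (2 + 4 * e) * l / 2"
    using C(1) sig big by (simp add: algebra_simps)
  assume ek: "e < \<kappa>"
  have "0 < (\<kappa> - e) * l" using ek l1 by simp
  then have lI: "0 < log 2 INR" using low by linarith
  \<comment> \<open>The logarithm of 0 evaluates to 0, so a positive logarithm excludes
    \<open>INR = 0\<close>.\<close>
  then have I0: "0 < INR" using INR0 by (cases "INR = 0") (auto simp: log_def)
  then have hc: "h_c \<noteq> 0" unfolding INR[symmetric] by auto
  have "(h_d / h_c)\<^sup>2 = S / INR"
    unfolding S[symmetric] INR[symmetric] using P by (simp add: power_divide)
  define W where "W = 2 powr ((1 - \<kappa> + e) * l)"
  have "S / INR = 2 powr (l - log 2 INR)"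
    using I0 by (simp add: powr_diff Sl)
  also have "\<dots> \<le> W" unfolding W_def using low by (intro powr_mono) (auto simp: algebra_simps)
  finally have SW: "S / INR \<le> W" .
  have W1: "1 \<le> W" unfolding W_def using \<kappa> e l1 by (intro ge_one_powr_ge_zero mult_nonneg_nonneg) auto
  have SI0: "0 < S / INR" using S2 I0 by simp
  have "log 2 (sqrt (2 * (1 + (h_d / h_c)\<^sup>2))) = log 2 (2 * (1 + S / INR)) / 2"
    unfolding \<open>(h_d / h_c)\<^sup>2 = S / INR\<close> using SI0 by (intro log2_sqrt) simp
  also have "\<dots> \<le> log 2 (4 * W) / 2"
    using SW W1 SI0 by (intro divide_right_mono) (auto simp: log_le_cancel_iff)
  also have "log 2 (4 * W) = 2 + (1 - \<kappa> + e) * l"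
  proof -
    have "log 2 (4::real) = 2" using log_pow_cancel[of 2 2] by simp
    then show ?thesis unfolding W_def by (simp add: log_mult)
  qed
  finally have tau: "log 2 (sqrt (2 * (1 + (h_d / h_c)\<^sup>2))) \<le> (2 + (1 - \<kappa> + e) * l) / 2" .
  show "C_sum h_d h_c P CG \<le> (2 - \<kappa> + \<gamma> + 4 * e) * l / 2"
    using C(2)[OF hc] sig tau CG big by (simp add: algebra_simps)
qed

text \<open>The loss \<open>7 * e\<close> in units of \<open>l / 2\<close> is
  \<open>2 + 4 + 1\<close>: deviation of the exponents from their limits, the factor
  \<open>1 - 2 * e\<close> for outliers applied to at most \<open>l\<close>, and the constants
  \<open>2 * c + 9\<close>.\<close>

lemma sum_rate_lower:
  fixes S INR l c :: real
  assumes P: "0 < P" and S: "h_d\<^sup>2 * P = S" and INR: "h_c\<^sup>2 * P = INR"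
    and \<kappa>: "0 \<le> \<kappa>" "\<kappa> \<le> 1" and e: "0 < e" "e \<le> 1 / 2" and l: "l = log 2 S"
    and D: "D = 2 * T + 2" and T: "0 \<le> T" and SD: "2 * D \<le> sqrt S" and c: "c = log 2 (2 * D)"
    and tail: "\<And>N. (\<integral>\<^sup>+z. indicator {z. e * real N < real (outliers N T z)} z \<partial>noise_vec N) \<le> ennreal ((1 / 2) ^ N)"
    and up: "log 2 INR \<le> (\<kappa> + e) * l"
    and CG: "0 \<le> CG" "(\<gamma> - e) * l / 2 \<le> CG" and big: "2 * (2 * c + 9) \<le> e * l"
  shows "\<exists>R1 R2. securely_achievable h_d h_c P CG R1 R2 \<and> (min 2 (2 - \<kappa> + \<gamma>) - 7 * e) * l / 2 \<le> R1 + R2"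
proof -
  define J where "J = max 1 (sqrt INR)"
  have s: "\<bar>h_d\<bar> * sqrt P = sqrt S" and i: "\<bar>h_c\<bar> * sqrt P = sqrt INR"
    unfolding S[symmetric] INR[symmetric] by (simp_all add: real_sqrt_mult)
  have D2: "2 \<le> D" using D T by simp
  have s4: "4 \<le> sqrt S" using SD D2 by simp
  then have S0: "0 < S" by (metis le_less_trans not_le real_sqrt_gt_0_iff zero_less_numeral less_le_trans)
  have "2 powr 4 \<le> S"
    using power_mono[OF s4, of 2] S0 by simp
  then have l4: "4 \<le> l" unfolding l using S0 by (simp add: le_log_iff)
  have INR0: "0 \<le> INR" unfolding INR[symmetric] using P by simp
  have ls: "log 2 (sqrt S) = l / 2" unfolding l by (rule log2_sqrt[OF S0])
  have c0: "0 \<le> c" unfolding c using D2 by simp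
  have lD: "log 2 D \<le> c" unfolding c using D2 by (subst log_le_cancel_iff) auto
  have J1: "1 \<le> J" by (simp add: J_def)
  have lJ: "log 2 J \<le> (\<kappa> + e) * l / 2"
  proof (cases "INR \<le> 1")
    case True
    then have "J = 1" using INR0 by (simp add: J_def)
    then show ?thesis using \<kappa> e l4 by simp
  next
    case False
    then have "J = sqrt INR" by (simp add: J_def)
    then show ?thesis using False up by (simp add: log2_sqrt)
  qed
  have kl: "(\<kappa> + e) * l / 2 \<le> (1 + e) * l / 2" using \<kappa> l4 by (intro divide_right_mono mult_right_mono) auto
  obtain R1 R2 where ach: "securely_achievable h_d h_c P CG R1 R2"
    and sum: "(1 - 2 * e) * ((log 2 (sqrt S / (2 * D)) - 1) +
        min (log 2 (sqrt S / (2 * D * J)) + CG - 1) (log 2 (sqrt S * min 1 (sqrt S / (2 * J)) / D) - 1)) - 6 \<le> R1 + R2"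
    using pam_sum_rate[OF P D T less_imp_le[OF e(1)] e(2) _ CG(1) tail, of h_d h_c, unfolded s i, OF SD, folded J_def] by blast
  have sS: "0 < sqrt S" using s4 by linarith
  have 1: "log 2 (sqrt S / (2 * D)) = l / 2 - c"
    using sS D2 unfolding c by (simp add: log_divide ls)
  have 2: "log 2 (sqrt S / (2 * D * J)) = l / 2 - (c + log 2 J)"
    using sS D2 J1 unfolding c by (simp add: log_divide log_mult ls)
  have 3: "l / 2 - 1 - e * l / 2 - c \<le> log 2 (sqrt S * min 1 (sqrt S / (2 * J)) / D)"
  proof (cases "sqrt S / (2 * J) \<le> 1")
    case True
    then have "min 1 (sqrt S / (2 * J)) = sqrt S / (2 * J)" by (rule min.absorb2)
    then have "log 2 (sqrt S * min 1 (sqrt S / (2 * J)) / D) = log 2 (sqrt S * (sqrt S / (2 * J)) / D)"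
      by (simp only:)
    also have "\<dots> = l / 2 + (l / 2 - (1 + log 2 J)) - log 2 D"
      using sS D2 J1 by (simp add: log_divide log_mult ls del: real_sqrt_mult_self)
    finally show ?thesis using lJ kl lD by (simp add: algebra_simps)
  next
    case False
    then have "log 2 (sqrt S * min 1 (sqrt S / (2 * J)) / D) = l / 2 - log 2 D"
      using sS D2 by (simp add: min_def log_divide ls)
    moreover have "0 \<le> e * l" using e l4 by simp
    ultimately show ?thesis using lD by linarith
  qed
  define t where "t = min 2 (2 - \<kappa> + \<gamma>)"
  \<comment> \<open>A common lower bound for both branches of the minimum: the link-limited branch
    gives \<open>2 - \<kappa> + \<gamma>\<close>, the amplitude-limited branch gives 2.\<close>
  define X where "X = (t - 2 * e) * l / 2 - (2 * c + 3)"
  have t2: "t \<le> 2" "t \<le> 2 - \<kappa> + \<gamma>" by (simp_all add: t_def)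
  have tl: "t * l \<le> 2 * l" "t * l \<le> (2 - \<kappa> + \<gamma>) * l" using t2 l4 by (auto intro: mult_right_mono)
  have el: "0 \<le> e * l" using e l4 by simp
  have "X \<le> (l / 2 - c - 1) + (l / 2 - (c + log 2 J) + CG - 1)"
    using tl(2) lJ CG(2) unfolding X_def by (simp add: field_simps)
  moreover have "X \<le> (l / 2 - c - 1) + (log 2 (sqrt S * min 1 (sqrt S / (2 * J)) / D) - 1)"
    using tl(1) 3 el unfolding X_def by (simp add: field_simps)
  ultimately have "X \<le> (log 2 (sqrt S / (2 * D)) - 1) +
        min (log 2 (sqrt S / (2 * D * J)) + CG - 1) (log 2 (sqrt S * min 1 (sqrt S / (2 * J)) / D) - 1)"
    unfolding 1 2 by (simp add: min_def)
  then have "(1 - 2 * e) * X \<le> (1 - 2 * e) * ((log 2 (sqrt S / (2 * D)) - 1) +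
        min (log 2 (sqrt S / (2 * D * J)) + CG - 1) (log 2 (sqrt S * min 1 (sqrt S / (2 * J)) / D) - 1))"
    using e by (intro mult_left_mono) auto
  then have r: "(1 - 2 * e) * X - 6 \<le> R1 + R2" using sum by linarith
  have "X \<le> l" using tl(1) el c0 unfolding X_def by (simp add: algebra_simps)
  then have "e * X \<le> e * l" using e by (intro mult_left_mono) auto
  then have "X - 2 * (e * l) \<le> (1 - 2 * e) * X" by (simp add: algebra_simps)
  then have "X - 2 * (e * l) - 6 \<le> R1 + R2" using r by linarith
  then have "(t - 7 * e) * l / 2 \<le> R1 + R2"
    using big unfolding X_def by (simp add: field_simps)
  then show ?thesis using ach unfolding t_def by blast
qed

theorem theorem6:
  fixes h_d h_c P INR CG :: "real \<Rightarrow> real" and \<kappa> \<gamma> :: real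
  assumes "0 \<le> \<kappa>" and "\<kappa> \<le> 1"
    and "\<forall>\<^sub>F S in at_top. 0 < P S"
    and "\<forall>\<^sub>F S in at_top. (h_d S)\<^sup>2 * P S = S"
    and "\<forall>\<^sub>F S in at_top. (h_c S)\<^sup>2 * P S = INR S"
    and "\<forall>\<^sub>F S in at_top. 0 \<le> CG S"
    and "((\<lambda>S. log 2 (INR S) / log 2 S) \<longlongrightarrow> \<kappa>) at_top"
    and "((\<lambda>S. CG S / (0.5 * log 2 S)) \<longlongrightarrow> \<gamma>) at_top"
  shows "((\<lambda>S. C_sum (h_d S) (h_c S) (P S) (CG S) / (0.5 * log 2 S))
           \<longlongrightarrow> min 2 (2 - \<kappa> + min \<gamma> 1)) at_top"
proof -
  have big: "\<forall>\<^sub>F S in at_top. K \<le> log 2 S" for K :: real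
  proof -
    have "\<forall>\<^sub>F S in at_top. 2 powr K \<le> (S :: real)" by (rule eventually_ge_at_top)
    then show ?thesis
    proof eventually_elim
      case (elim S)
      then have "0 < S" by (rule less_le_trans[rotated]) simp
      then show ?case using elim by (simp add: le_log_iff)
    qed
  qed
  have "\<forall>\<^sub>F S in at_top. 0 \<le> CG S / (0.5 * log 2 S)"
    using assms(6) big[of 0] by eventually_elim simp
  then have \<gamma>0: "0 \<le> \<gamma>"
    by (rule tendsto_lowerbound[OF assms(8)]) simp
  define t where "t = min 2 (2 - \<kappa> + \<gamma>)"
  \<comment> \<open>For \<open>\<gamma> \<ge> 1\<close> both sides equal 2, since
    \<open>\<kappa> \<le> 1\<close>; capping the link at 1 changes nothing.\<close>
  have t_eq: "min 2 (2 - \<kappa> + min \<gamma> 1) = t" unfolding t_def using assms(1,2) by (auto simp: min_def)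
  show ?thesis
    unfolding t_eq
  proof (rule tendstoI)
    fix \<epsilon> :: real assume \<epsilon>: "0 < \<epsilon>"
    \<comment> \<open>Small enough that all losses, at most \<open>7 * e\<close>, stay below
      \<open>\<epsilon>\<close>, that the outlier factor \<open>1 - 2 * e\<close> is nonnegative,
      and that \<open>e < \<kappa>\<close> whenever \<open>\<kappa>\<close> is positive.\<close>
    define e where "e = min (min (\<epsilon> / 16) (1 / 8)) (if 0 < \<kappa> then \<kappa> / 2 else 1)"
    have e: "0 < e" "e \<le> 1 / 2" "16 * e \<le> \<epsilon>" and e\<kappa>: "0 < \<kappa> \<Longrightarrow> e < \<kappa>"
      using \<epsilon> by (auto simp: e_def min_def)
    \<comment> \<open>The noise threshold, and with it the spacing \<open>D\<close>, is fixed before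
      \<open>S\<close> grows; hence \<open>c\<close> is a constant.\<close>
    obtain T where T: "0 \<le> T"
      "\<And>N. (\<integral>\<^sup>+z. indicator {z. e * real N < real (outliers N T z)} z \<partial>noise_vec N) \<le> ennreal ((1 / 2) ^ N)"
      using noise_outliers[OF e(1)] by blast
    define D where "D = 2 * T + 2"
    define c where "c = log 2 (2 * D)"
    have D2: "2 \<le> D" using T(1) by (simp add: D_def)
    have "\<forall>\<^sub>F S in at_top. dist (log 2 (INR S) / log 2 S) \<kappa> < e"
      by (rule tendstoD[OF assms(7) e(1)])
    moreover have "\<forall>\<^sub>F S in at_top. dist (CG S / (0.5 * log 2 S)) \<gamma> < e"
      by (rule tendstoD[OF assms(8) e(1)])
    ultimately show "\<forall>\<^sub>F S in at_top. dist (C_sum (h_d S) (h_c S) (P S) (CG S) / (0.5 * log 2 S)) t < \<epsilon>"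
      using assms(3-6) big[of 1] big[of "7 / e"] big[of "2 * (2 * c + 9) / e"]
        eventually_ge_at_top[of 2] eventually_ge_at_top[of "(2 * D)\<^sup>2"]
    proof eventually_elim
      case (elim S)
      define l where "l = log 2 S"
      define C where "C = C_sum (h_d S) (h_c S) (P S) (CG S)"
      have l1: "1 \<le> l" "7 \<le> e * l" "2 * (2 * c + 9) \<le> e * l"
        using elim(7-9) e(1) by (simp_all add: l_def pos_divide_le_eq mult.commute)
      have "\<kappa> - e < log 2 (INR S) / l" "log 2 (INR S) / l < \<kappa> + e"
        using elim(1) unfolding l_def dist_real_def by linarith+
      then have I: "log 2 (INR S) \<le> (\<kappa> + e) * l" "(\<kappa> - e) * l \<le> log 2 (INR S)"
        using l1 by (simp_all add: field_simps)
      have "\<gamma> - e < CG S / (0.5 * l)" "CG S / (0.5 * l) < \<gamma> + e"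
        using elim(2) unfolding l_def dist_real_def by linarith+
      then have G: "CG S \<le> (\<gamma> + e) * l / 2" "(\<gamma> - e) * l / 2 \<le> CG S"
        using l1 by (simp_all add: field_simps)
      have "2 * D \<le> sqrt S" using elim(11) by (rule real_le_rsqrt)
      then obtain R1 R2 where R: "securely_achievable (h_d S) (h_c S) (P S) (CG S) R1 R2"
        "(t - 7 * e) * l / 2 \<le> R1 + R2"
        using sum_rate_lower[OF elim(3,4,5) assms(1,2) e(1,2) l_def D_def T(1) _ c_def T(2) I(1) elim(6) G(2) l1(3)]
        unfolding t_def by blast
      have lower: "(t - 7 * e) * l / 2 \<le> C"
        unfolding C_def using R(2) C_sum_bounds(1)[OF elim(3) R(1)] by linarith
      note up = C_sum_upper[OF elim(3,4,5) assms(1,2) e(1) elim(10) l_def I G(1) l1(2) R(1), folded C_def]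
      have upper: "C \<le> (t + 4 * e) * l / 2"
      \<comment> \<open>If 2 is the minimum, the sum of the two single-user bounds suffices.
        Otherwise \<open>\<gamma> < \<kappa>\<close>, so \<open>\<kappa>\<close> is positive and the
        secrecy bound is available.\<close>
      proof (cases "2 \<le> 2 - \<kappa> + \<gamma>")
        case True
        then show ?thesis using up(1) by (simp add: t_def)
      next
        case False
        then have "0 < \<kappa>" "t = 2 - \<kappa> + \<gamma>" using \<gamma>0 by (auto simp: t_def)
        then show ?thesis using up(2) e\<kappa> by simp
      qed
      have "t - 7 * e \<le> C / (0.5 * l)" "C / (0.5 * l) \<le> t + 4 * e"
        using lower upper l1(1) by (simp_all add: field_simps)
      then show ?case
        using e unfolding C_def[symmetric] l_def[symmetric] dist_real_def by linarith
    qed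
  qed
qed

end
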